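(* Let $m\ge1$ be an integer, $t_1,\dots,t_m\in\mathbb{R}$ with $t_m>0$, and $\lambda>-1$. Put $$\Delta_n=\frac{2\lambda+1}{2}\bigl(1-(-1)^n\bigr).$$ For $p\in\mathbb{N}^+$ and $k=1,2,\dots,m$ define $E_{p,k}(n)$ by $$F_{k,n}=N_kn^{\frac km}\Bigl(\sum_{s=0}^{p}\frac{a_{s,k}+b_{s,k}(\Delta_n)}{n^{s/m}}+n^{-\frac{p+1}{m}}E_{p,k}(n)\Bigr),$$ where the coefficients $a_{s,k}$ and $b_{s,k}(\Delta_n)$ are determined recursively by substituting this expansion into the discrete Painlevé I hierarchy equation $$\sum_{k=1}^{m}2kt_kF_{k,n}-\Bigl(\lambda+\tfrac12\Bigr)\bigl(1-(-1)^n\bigr)=n.$$ Then for every $p\in\mathbb{N}^+$ and $k=1,\dots,m$ the error terms satisfy $E_{p,k}(n)=\mathcal{O}(1)$ as $n\to\infty$. Moreover: (i) the $a_{s,k}$ are constants independent of $n$, with $a_{0,k}=1$ for all $k=1,\dots,m$; (ii) $a_{s,1}=a_s$ for $s=1,2,\dots,m-1$, where the $a_s$ are the coefficients of the expansion of $\beta_n$ in the case $\lambda=-\frac12$ (see context); (iii) the $b_{s,k}(\Delta_n)$ are polynomials in $\Delta_n$ such that $b_{s,k}(0)=0$ for all $s\in\mathbb{N}^+$, $k=1,\dots,m$; (iv) $b_{s,k}(\Delta_n)=0$ for $s=1,2,\dots,m-1$ and all $k=1,\dots,m$.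
   Context: Let $T_m=(t_1,\dots,t_m)$ and $w(x;T_m;\lambda)=|x|^{2\lambda+1}\exp(-\sum_{k=1}^m t_kx^{2k})$ on $\mathbb{R}\setminus\{0\}$. $P_n(x;T_m;\lambda)$ is the monic polynomial of degree $n$ in the sequence orthogonal with respect to $w\,dx$ on $\mathbb{R}$; since $w$ is even, $xP_n=P_{n+1}+\beta_nP_{n-1}$ with $P_0=1$, $P_{-1}=0$, $\beta_0=0$. The quantities $F_{k,n}$ are $F_{1,n}=\beta_n$ and, for $k=2,\dots,m$, $$F_{k,n}=F_{1,n}(F_{k-1,n-1}+2F_{k-1,n}+F_{k-1,n+1})+F_{1,n}\sum_{\substack{i+j=k-1\\1\le i,j\le k-2}}(F_{i,n}+F_{i,n+1})(F_{j,n-1}+F_{j,n})-\sum_{\substack{i+j=k\\1\le i,j\le k-1}}F_{i,n}F_{j,n}$$ (empty sums are zero). The constants $N_k$ are $$N_1=\frac14\Bigl(\frac{\Gamma(\frac12)\Gamma(m)}{t_m\Gamma(m+\frac12)}\Bigr)^{1/m},\qquad N_k=\frac12\binom{2k}{k}N_1^k,\quad k=1,\dots,m.$$ For $\lambda=-\frac12$ and the same $T_m$, it is known (Deift et al.) that $\beta_n\sim\bigl(\frac{n}{4^mA_m}\bigr)^{1/m}\bigl(1+\sum_{i=1}^\infty a_in^{-i/m}\bigr)$ as $n\to\infty$, where $A_m=\frac{t_m\Gamma(m+\frac12)}{\Gamma(\frac12)\Gamma(m)}$; this defines the constants $a_i$. *)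

theory Defs
  imports
    "HOL-Analysis.Analysis"
    "HOL-Library.Landau_Symbols"
    "HOL-Computational_Algebra.Computational_Algebra"
begin

(* The value at 0 is 0; the origin is a null set. *)
definition weight :: "nat \<Rightarrow> (nat \<Rightarrow> real) \<Rightarrow> real \<Rightarrow> real \<Rightarrow> real" where
  "weight m t lam x = \<bar>x\<bar> powr (2 * lam + 1) * exp (- (\<Sum>k=1..m. t k * x ^ (2 * k)))"

definition monic_orthogonal :: "(real \<Rightarrow> real) \<Rightarrow> (nat \<Rightarrow> real poly) \<Rightarrow> bool" where
  "monic_orthogonal w P \<longleftrightarrow>
     (\<forall>n. degree (P n) = n \<and> lead_coeff (P n) = 1) \<and>
     (\<forall>i j. i \<noteq> j \<longrightarrow> (LINT x|lborel. poly (P i) x * poly (P j) x * w x) = 0)"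

definition three_term :: "(nat \<Rightarrow> real poly) \<Rightarrow> (nat \<Rightarrow> real) \<Rightarrow> bool" where
  "three_term P \<beta> \<longleftrightarrow>
     \<beta> 0 = 0 \<and>
     (\<forall>n. [:0, 1:] * P n = P (Suc n) + smult (\<beta> n) (if n = 0 then 0 else P (n - 1)))"

(* For n = 0 the truncated index n - 1 is harmless: every term containing it carries
   the factor F \<beta> 1 0 = \<beta> 0 = 0.  The index k = 0 is unused. *)
fun F :: "(nat \<Rightarrow> real) \<Rightarrow> nat \<Rightarrow> nat \<Rightarrow> real" where
  "F \<beta> 0 n = 0"
| "F \<beta> (Suc 0) n = \<beta> n"
| "F \<beta> (Suc (Suc l)) n =
     F \<beta> 1 n * (F \<beta> (Suc l) (n - 1) + 2 * F \<beta> (Suc l) n + F \<beta> (Suc l) (n + 1))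
     + F \<beta> 1 n * (\<Sum>i\<in>{1..l}. (F \<beta> i n + F \<beta> i (n + 1)) *
                               (F \<beta> (Suc l - i) (n - 1) + F \<beta> (Suc l - i) n))
     - (\<Sum>i\<in>{1..Suc l}. F \<beta> i n * F \<beta> (Suc (Suc l) - i) n)"

definition Delta :: "real \<Rightarrow> nat \<Rightarrow> real" where
  "Delta lam n = (2 * lam + 1) / 2 * (1 - (-1) ^ n)"

definition N1 :: "nat \<Rightarrow> (nat \<Rightarrow> real) \<Rightarrow> real" where
  "N1 m t = 1 / 4 * (Gamma (1 / 2) * Gamma (real m) / (t m * Gamma (real m + 1 / 2)))
                     powr (1 / real m)"

definition N :: "nat \<Rightarrow> (nat \<Rightarrow> real) \<Rightarrow> nat \<Rightarrow> real" where
  "N m t k = 1 / 2 * real ((2 * k) choose k) * N1 m t ^ k"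

(* An expansion n^(k/m) * (\<Sum>s. g\<^sub>s(\<Delta>\<^sub>n) n^(-s/m)) is encoded as the power series
   \<Sum>s. g\<^sub>s z^s in z = n^(-1/m), whose coefficients g\<^sub>s are polynomials in the
   indeterminate \<Delta>; the prefactor n^(k/m) = z^(-k) is kept implicit. *)

definition ansatz ::
  "nat \<Rightarrow> (nat \<Rightarrow> real) \<Rightarrow> (nat \<Rightarrow> nat \<Rightarrow> real) \<Rightarrow> (nat \<Rightarrow> nat \<Rightarrow> real poly)
     \<Rightarrow> nat \<Rightarrow> real poly fps" where
  "ansatz m t a b k = Abs_fps (\<lambda>s. smult (N m t k) ([:a s k:] + b s k))"

(* The shift n \<mapsto> n + \<sigma> for \<sigma> = 1, -1.  It replaces \<Delta>\<^sub>n by 2\<lambda> + 1 - \<Delta>\<^sub>n and expands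
   (n + \<sigma>)^((k - s)/m) = n^((k - s)/m) * (\<Sum>j. binom((k - s)/m, j) \<sigma>^j n^(-j)), n^(-j) = z^(m j). *)
definition shift_fps ::
  "nat \<Rightarrow> real \<Rightarrow> real \<Rightarrow> nat \<Rightarrow> real poly fps \<Rightarrow> real poly fps" where
  "shift_fps m lam \<sigma> k G = Abs_fps (\<lambda>r. \<Sum>j = 0..r div m.
     smult ((((real k - real (r - m * j)) / real m) gchoose j) * \<sigma> ^ j)
           (pcompose (fps_nth G (r - m * j)) [:2 * lam + 1, -1:]))"

(* Both the recursion defining the quantities F and the hierarchy hold identically in z and
   \<Delta>; each summand of the recursion for F k carries the same implicit factor z^(-k), and the
   last equation is the hierarchy multiplied by z^m = 1/n. *)
definition formal_solution ::
  "nat \<Rightarrow> (nat \<Rightarrow> real) \<Rightarrow> real \<Rightarrow> (nat \<Rightarrow> nat \<Rightarrow> real) \<Rightarrow> (nat \<Rightarrow> nat \<Rightarrow> real poly) \<Rightarrow> bool" where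
  "formal_solution m t lam a b \<longleftrightarrow>
     (let G = ansatz m t a b;
          U = (\<lambda>k. shift_fps m lam 1 k (G k));
          D = (\<lambda>k. shift_fps m lam (-1) k (G k))
      in (\<forall>k\<in>{2..m}.
            G k = G 1 * (D (k - 1) + 2 * G (k - 1) + U (k - 1))
                  + G 1 * (\<Sum>i\<in>{1..k - 2}. (G i + U i) * (D (k - 1 - i) + G (k - 1 - i)))
                  - (\<Sum>i\<in>{1..k - 1}. G i * G (k - i)))
       \<and> (\<Sum>k=1..m. fps_const [:2 * real k * t k:] * fps_X ^ (m - k) * G k)
           = 1 + fps_const [:0, 1:] * fps_X ^ m)"

(* F k n = N k n^(k/m) (\<Sum>s\<le>p. (a s k + b s k (\<Delta> n)) n^(-s/m) + n^(-(p+1)/m) E p k n),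
   solved for E p k n. *)
definition E ::
  "nat \<Rightarrow> (nat \<Rightarrow> real) \<Rightarrow> real \<Rightarrow> (nat \<Rightarrow> real) \<Rightarrow> (nat \<Rightarrow> nat \<Rightarrow> real) \<Rightarrow> (nat \<Rightarrow> nat \<Rightarrow> real poly)
     \<Rightarrow> nat \<Rightarrow> nat \<Rightarrow> nat \<Rightarrow> real" where
  "E m t lam \<beta> a b p k n =
     real n powr (real (p + 1) / real m) *
     (F \<beta> k n / (N m t k * real n powr (real k / real m))
      - (\<Sum>s=0..p. (a s k + poly (b s k) (Delta lam n)) / real n powr (real s / real m)))"

definition A :: "nat \<Rightarrow> (nat \<Rightarrow> real) \<Rightarrow> real" where
  "A m t = t m * Gamma (real m + 1 / 2) / (Gamma (1 / 2) * Gamma (real m))"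

(* The coefficient d 0 is unused. *)
definition beta_expansion ::
  "nat \<Rightarrow> (nat \<Rightarrow> real) \<Rightarrow> (nat \<Rightarrow> real) \<Rightarrow> (nat \<Rightarrow> real) \<Rightarrow> bool" where
  "beta_expansion m t \<beta> d \<longleftrightarrow>
     (\<forall>q. (\<lambda>n. \<beta> n / (real n / (4 ^ m * A m t)) powr (1 / real m)
               - (1 + (\<Sum>i=1..q. d i * real n powr (- (real i / real m)))))
          \<in> O(\<lambda>n. real n powr (- (real (q + 1) / real m))))"

end

theory Submission
  imports Defs "HOL-Real_Asymp.Real_Asymp"
begin

text \<open>
  Let \<open>a n = sqrt (\<beta> n)\<close> and let \<open>J\<close> be the Jacobi matrix with off-diagonal entries \<open>a\<close>. An identity
  for the resolvent of \<open>J\<close> shows that the recursion for \<open>F \<beta> k n\<close> computes \<open>a n\<close> times the entry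
  \<open>(n, n - 1)\<close> of \<open>J ^ (2 * k - 1)\<close>; integration by parts then yields the string equation, and
  the moments of \<open>P n\<close> yield \<open>\<beta> n \<approx> n powr (1 / m)\<close> up to constant factors.

  Summed against a test sequence, \<open>F \<beta> k\<close> is a sum over closed walks. In the variables \<open>ln (\<beta> n)\<close> it
  is the gradient of a sum of exponentials of linear forms, hence of a convex function, and the walks
  along a single edge make the convexity uniform. Testing the difference of two sequences of size
  \<open>n powr (1 / m)\<close> with an exponentially localised weight therefore bounds the difference of their
  logarithms at \<open>n\<close> by the residual near \<open>n\<close>. No asymptotics of \<open>\<beta>\<close> need to be known beforehand, so this
  applies directly to \<open>\<beta>\<close> and a truncation of the formal solution.

  The formal solution exists and is unique because the linearised recursion acts on polynomials in \<open>\<Delta>\<close>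
  with nonzero multipliers on the parts that are even and odd under \<open>\<Delta> \<mapsto> 2\<lambda> + 1 - \<Delta>\<close>. Below
  order \<open>m\<close> neither \<open>\<Delta>\<close> nor \<open>\<lambda>\<close> enters the equations.
\<close>

text \<open>The lower coefficients \<open>t k\<close> may be negative, and \<beta> is known only
  through a nonlinear equation that couples every index to its neighbours. Linearising around the
  formal solution would presuppose that \<beta> is already close to it. Convexity avoids this: the
  weight of a closed walk is the exponential of a linear form in the logarithms, so the difference
  of two gradients, paired with the difference of the logarithms, is a sum over walks of a positive
  mean times the square of a linear form. A localising weight spoils the squares only by a
  commutator, which is small when the weight varies slowly. The recursion for F is the
  coefficientwise form of W + W^2 = X \<beta>_n D_n D_(n-1), where D and W are the generating
  functions of the entries (n, n) and, scaled by a_n, (n, n - 1) of the powers of J. At constant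
  sequences it reduces to B = (1 - 4 a X)^(-1/2). The response to a constant perturbation is then X
  B^3 and to an alternating one X B; their positive coefficients are the nonzero multipliers of the
  formal theory.\<close>

section \<open>Powers of a Jacobi matrix\<close>

text \<open>At \<open>n = 0\<close> the truncated index \<open>n - 1\<close> is harmless, because \<open>a 0 = 0\<close> in all uses.\<close>

primrec jacobi_pow :: "(nat \<Rightarrow> real) \<Rightarrow> nat \<Rightarrow> nat \<Rightarrow> nat \<Rightarrow> real" where
  "jacobi_pow a 0 n i = (if n = i then 1 else 0)"
| "jacobi_pow a (Suc j) n i = a (Suc n) * jacobi_pow a j (Suc n) i + a n * jacobi_pow a j (n - 1) i"

lemma jacobi_pow_Suc_right:
  assumes "a 0 = 0"
  shows "jacobi_pow a (Suc j) n i
    = jacobi_pow a j n (Suc i) * a (Suc i) + jacobi_pow a j n (i - 1) * a i"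
proof (induction j arbitrary: n)
  case 0
  show ?case using assms by (cases n; cases i) auto
next
  case (Suc j)
  show ?case
    by (subst jacobi_pow.simps(2), subst Suc.IH, subst Suc.IH) (simp add: algebra_simps)
qed

lemma jacobi_pow_sym:
  assumes "a 0 = 0"
  shows "jacobi_pow a j n i = jacobi_pow a j i n"
proof (induction j arbitrary: n i)
  case (Suc j)
  show ?case
    by (subst jacobi_pow_Suc_right[where a = a, OF assms], subst jacobi_pow.simps(2))
      (simp add: Suc.IH[of _ i] mult.commute)
qed auto

lemma jacobi_pow_nonneg: "(\<And>n. a n \<ge> 0) \<Longrightarrow> jacobi_pow a j n i \<ge> 0"
  by (induction j arbitrary: n) auto

text \<open>With X = z^(-2), \<open>offdiag_fps a n\<close> is \<open>a n\<close> times the entry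
  (n, n - 1) of the resolvent (z - J)^(-1), and \<open>diag_fps a n\<close> is z times its diagonal
  entry. J links only indices of different parity, so each series sees one parity of powers.\<close>

definition offdiag_fps :: "(nat \<Rightarrow> real) \<Rightarrow> nat \<Rightarrow> real fps" where
  "offdiag_fps a n = Abs_fps (\<lambda>k. if k = 0 then 0 else a n * jacobi_pow a (2 * k - 1) n (n - 1))"

definition diag_fps :: "(nat \<Rightarrow> real) \<Rightarrow> nat \<Rightarrow> real fps" where
  "diag_fps a n = Abs_fps (\<lambda>k. jacobi_pow a (2 * k) n n)"

lemma jacobi_pow_diag:
  assumes "a 0 = 0" "k \<ge> 1"
  shows "jacobi_pow a (2 * k) n n
    = a n * jacobi_pow a (2 * k - 1) n (n - 1) + a (Suc n) * jacobi_pow a (2 * k - 1) (Suc n) n"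
proof -
  obtain k' where k: "k = Suc k'" using assms(2) by (cases k) auto
  have "jacobi_pow a (2 * k) n n = jacobi_pow a (Suc (2 * k - 1)) n n"
    by (simp add: k)
  also have "\<dots> = a (Suc n) * jacobi_pow a (2 * k - 1) (Suc n) n + a n * jacobi_pow a (2 * k - 1) (n - 1) n"
    by (rule jacobi_pow.simps)
  finally show ?thesis using jacobi_pow_sym[where a = a, OF assms(1), of _ n "n - 1"] by simp
qed

lemma diag_fps_eq:
  assumes "a 0 = 0"
  shows "diag_fps a n = 1 + offdiag_fps a n + offdiag_fps a (Suc n)"
proof (rule fps_ext)
  fix k
  show "fps_nth (diag_fps a n) k = fps_nth (1 + offdiag_fps a n + offdiag_fps a (Suc n)) k"
    using jacobi_pow_diag[where a = a, OF assms, of k n]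
    by (cases "k = 0") (auto simp: diag_fps_def offdiag_fps_def)
qed

text \<open>Expanding the last step of one power and the first step of the other produces the same
  entry (n + 1, n - 1) with the same factor \<open>a n * a (Suc n)\<close>. It cancels, and only
  diagonal entries remain.\<close>

lemma offdiag_fps_diff:
  assumes "a 0 = 0"
  shows "offdiag_fps a (Suc n) - offdiag_fps a n = fps_X *
    (fps_const ((a (Suc n))\<^sup>2) * diag_fps a (Suc n) - fps_const ((a n)\<^sup>2) * diag_fps a (n - 1))"
proof (rule fps_ext)
  fix k
  show "fps_nth (offdiag_fps a (Suc n) - offdiag_fps a n) k = fps_nth (fps_X *
    (fps_const ((a (Suc n))\<^sup>2) * diag_fps a (Suc n) - fps_const ((a n)\<^sup>2) * diag_fps a (n - 1))) k"
  proof (cases k)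
    case (Suc j)
    have 1: "jacobi_pow a (Suc (2 * j)) (Suc n) n = jacobi_pow a (2 * j) (Suc n) (Suc n) * a (Suc n)
        + jacobi_pow a (2 * j) (Suc n) (n - 1) * a n"
      by (rule jacobi_pow_Suc_right[where a = a, OF assms])
    have 2: "a n * jacobi_pow a (Suc (2 * j)) n (n - 1)
        = a n * (a (Suc n) * jacobi_pow a (2 * j) (Suc n) (n - 1) + a n * jacobi_pow a (2 * j) (n - 1) (n - 1))"
      by simp
    show ?thesis unfolding offdiag_fps_def diag_fps_def
      using 1 2 by (simp add: Suc algebra_simps power2_eq_square del: jacobi_pow.simps)
  qed (simp add: offdiag_fps_def diag_fps_def)
qed

text \<open>Telescoping in n: the increment of W + W^2 is (W_(n+1) - W_n)(1 + W_n + W_(n+1)), whose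
  second factor is \<open>diag_fps a n\<close>, so \<open>offdiag_fps_diff\<close> turns it into the
  increment of the right-hand side.\<close>

lemma offdiag_fps_quadratic:
  assumes "a 0 = 0"
  shows "offdiag_fps a n + offdiag_fps a n * offdiag_fps a n
    = fps_X * fps_const ((a n)\<^sup>2) * diag_fps a n * diag_fps a (n - 1)"
proof (induction n)
  case 0
  have "offdiag_fps a 0 = 0" by (rule fps_ext) (simp add: offdiag_fps_def assms)
  then show ?case by (simp add: assms)
next
  case (Suc n)
  let ?W = "offdiag_fps a"
  have "?W (Suc n) + ?W (Suc n) * ?W (Suc n) - (?W n + ?W n * ?W n)
      = (?W (Suc n) - ?W n) * (1 + ?W n + ?W (Suc n))"
    by (simp add: algebra_simps)
  also have "\<dots> = fps_X * (fps_const ((a (Suc n))\<^sup>2) * diag_fps a (Suc n)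
      - fps_const ((a n)\<^sup>2) * diag_fps a (n - 1)) * diag_fps a n"
    by (simp only: offdiag_fps_diff[where a = a, OF assms] diag_fps_eq[where a = a and n = n, OF assms])
  also have "\<dots> = fps_X * fps_const ((a (Suc n))\<^sup>2) * diag_fps a (Suc n) * diag_fps a n
      - fps_X * fps_const ((a n)\<^sup>2) * diag_fps a n * diag_fps a (n - 1)"
    by (simp add: algebra_simps)
  finally show ?case using Suc by (simp add: algebra_simps)
qed

lemma fps_mult_nth_no_const:
  fixes f g :: "'a::comm_semiring_0 fps"
  assumes "fps_nth f 0 = 0" "fps_nth g 0 = 0"
  shows "fps_nth (f * g) (Suc n) = (\<Sum>i\<in>{1..n}. fps_nth f i * fps_nth g (Suc n - i))"
proof -
  have "fps_nth (f * g) (Suc n) = (\<Sum>i=0..Suc n. fps_nth f i * fps_nth g (Suc n - i))"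
    by (simp add: fps_mult_nth)
  also have "\<dots> = (\<Sum>i\<in>{1..n}. fps_nth f i * fps_nth g (Suc n - i))"
    by (rule sum.mono_neutral_right) (auto simp: assms le_Suc_eq Suc_le_eq)
  finally show ?thesis .
qed

text \<open>Replacing both diagonal series in the quadratic identity by \<open>diag_fps_eq\<close>
  and reading off the coefficient of X^k gives exactly the recursion that defines
  \<open>F\<close>.\<close>

theorem F_eq_jacobi_pow:
  assumes \<beta>: "\<beta> 0 = 0" "\<And>n. \<beta> n \<ge> 0" and "k \<ge> 1"
  shows "F \<beta> k n = sqrt (\<beta> n) * jacobi_pow (\<lambda>n. sqrt (\<beta> n)) (2 * k - 1) n (n - 1)"
proof -
  define a where "a = (\<lambda>n. sqrt (\<beta> n))"
  have a0: "a 0 = 0" and asq: "(a n)\<^sup>2 = \<beta> n" for n using \<beta> by (auto simp: a_def)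
  let ?W = "\<lambda>n. offdiag_fps a n"
  have W: "fps_nth (?W n) k = F \<beta> k n" for k n
  proof (induction k arbitrary: n rule: less_induct)
    case (less k)
    consider "k = 0" | "k = 1" | l where "k = Suc (Suc l)"
      by (metis One_nat_def not0_implies_Suc)
    then show ?case
    proof cases
      case 1
      then show ?thesis by (simp add: offdiag_fps_def)
    next
      case 2
      have "n = 0 \<Longrightarrow> \<beta> 0 = 0" using \<beta> by simp
      then show ?thesis using 2 asq[of n]
        by (cases n) (auto simp: offdiag_fps_def a0 power2_eq_square)
    next
      case (3 l)
      have IH: "fps_nth (?W n) i = F \<beta> i n" if "i \<le> Suc l" for i n
        using less.IH[of i n] that 3 by auto
      have W0: "fps_nth (?W n) 0 = 0" for n by (simp add: offdiag_fps_def)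
      define A where "A = ?W n + ?W (Suc n)"
      define B where "B = ?W (n - 1) + ?W n"
      have A0: "fps_nth A 0 = 0" and B0: "fps_nth B 0 = 0" by (simp_all add: A_def B_def W0)
      \<comment> \<open>At n = 0 the truncated index n - 1 spoils the second alternative, but there
        the diagonal series is multiplied by \<beta> 0 = 0.\<close>
      have d: "\<beta> n = 0 \<or> diag_fps a (n - 1) = 1 + B"
        using diag_fps_eq[where a = a, OF a0, of "n - 1"] \<beta> by (cases n) (auto simp: B_def)
      have "?W n + ?W n * ?W n = fps_X * (fps_const (\<beta> n) * ((1 + A) * (1 + B)))"
        using offdiag_fps_quadratic[where a = a, OF a0, of n] diag_fps_eq[where a = a, OF a0, of n] d
        by (auto simp: asq A_def algebra_simps)
      also have "(1 + A) * (1 + B) = 1 + A + B + A * B" by (simp add: algebra_simps)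
      finally have eq: "?W n = fps_X * (fps_const (\<beta> n) * (1 + A + B + A * B)) - ?W n * ?W n"
        by (simp add: algebra_simps)
      have "fps_nth (?W n) (Suc (Suc l)) = \<beta> n * (fps_nth A (Suc l) + fps_nth B (Suc l)
          + fps_nth (A * B) (Suc l)) - fps_nth (?W n * ?W n) (Suc (Suc l))"
        by (subst eq) simp
      also have "fps_nth (?W n * ?W n) (Suc (Suc l))
          = (\<Sum>i\<in>{1..Suc l}. F \<beta> i n * F \<beta> (Suc (Suc l) - i) n)"
        unfolding fps_mult_nth_no_const[OF W0 W0] by (intro sum.cong refl arg_cong2[where f = "(*)"] IH) auto
      also have "fps_nth (A * B) (Suc l) = (\<Sum>i\<in>{1..l}. (F \<beta> i n + F \<beta> i (n + 1)) *
                               (F \<beta> (Suc l - i) (n - 1) + F \<beta> (Suc l - i) n))"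
        unfolding fps_mult_nth_no_const[OF A0 B0]
        by (intro sum.cong refl arg_cong2[where f = "(*)"]) (auto simp: A_def B_def IH)
      also have "fps_nth A (Suc l) = F \<beta> (Suc l) n + F \<beta> (Suc l) (n + 1)"
        by (simp add: A_def IH)
      also have "fps_nth B (Suc l) = F \<beta> (Suc l) (n - 1) + F \<beta> (Suc l) n"
        by (simp add: B_def IH)
      finally show ?thesis unfolding 3 by (simp only: F.simps) (simp add: algebra_simps)
    qed
  qed
  show ?thesis using W[of n k] \<open>k \<ge> 1\<close> by (simp add: offdiag_fps_def a_def)
qed

lemma F_nonneg:
  assumes "\<beta> 0 = 0" "\<And>n. \<beta> n \<ge> 0"
  shows "F \<beta> k n \<ge> 0"
  using F_eq_jacobi_pow[where \<beta> = \<beta>, OF assms, of k n] assms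
  by (cases "k = 0") (auto intro!: mult_nonneg_nonneg jacobi_pow_nonneg)

text \<open>Locality in n: a sequence may be altered outside a window without affecting the
  hierarchy well inside it.\<close>

lemma F_cong:
  assumes "\<And>j. j \<le> n + k \<Longrightarrow> n \<le> j + k \<Longrightarrow> x j = y j"
  shows "F x k n = F y k n"
  using assms
proof (induction k arbitrary: n rule: less_induct)
  case (less k)
  consider "k = 0" | "k = 1" | l where "k = Suc (Suc l)"
    by (metis One_nat_def not0_implies_Suc)
  then show ?case
  proof cases
    case (3 l)
    have IH: "F x i j = F y i j" if "i \<le> Suc l" "j \<le> n + 1" "n \<le> j + 1" for i j
      by (rule less.IH) (use that 3 less.prems in auto)
    show ?thesis unfolding 3 F.simps
      by (intro arg_cong2[where f = "(+)"] arg_cong2[where f = "(-)"] arg_cong2[where f = "(*)"]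
          sum.cong refl IH) auto
  qed (use less.prems in auto)
qed

section \<open>Closed walks\<close>

definition adj :: "nat \<Rightarrow> nat \<Rightarrow> bool" where
  "adj x y \<longleftrightarrow> x = Suc y \<or> y = Suc x"

text \<open>Matching \<open>w\<close> with its rotation includes the closing step from the last
  vertex to the first. The bound B makes the sums over walks finite; it is later taken so large that
  no walk through the edges of interest is cut off.\<close>

definition closed_walks :: "nat \<Rightarrow> nat \<Rightarrow> nat list set" where
  "closed_walks K B = {w. set w \<subseteq> {..B} \<and> length w = K \<and> list_all2 adj w (rotate1 w)}"

text \<open>The edge between n - 1 and n is named by its upper end n, the index of the Jacobi entry
  that it carries.\<close>

definition edges :: "nat list \<Rightarrow> nat list" where
  "edges w = map2 max w (rotate1 w)"

lemma finite_closed_walks: "finite (closed_walks K B)"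
  by (rule finite_subset[OF _ finite_lists_length_eq[of "{..B}" K]]) (auto simp: closed_walks_def)

lemma length_edges [simp]: "length (edges w) = length w"
  by (simp add: edges_def)

lemma edges_rotate1: "edges (rotate1 w) = rotate1 (edges w)"
proof -
  have "map2 f (rotate1 xs) (rotate1 ys) = rotate1 (map2 f xs ys)" if "length xs = length ys"
    for f :: "nat \<Rightarrow> nat \<Rightarrow> nat" and xs ys
    using that by (cases xs; cases ys) auto
  then show ?thesis by (simp add: edges_def)
qed

lemma list_all2_rotate1: "list_all2 P xs ys \<Longrightarrow> list_all2 P (rotate1 xs) (rotate1 ys)"
  by (cases xs; cases ys) (auto intro: list_all2_appendI)

lemma rotate1_closed_walks: "w \<in> closed_walks K B \<Longrightarrow> rotate1 w \<in> closed_walks K B"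
  by (auto simp: closed_walks_def intro: list_all2_rotate1)

lemma sum_rotate_closed_walks:
  "(\<Sum>w\<in>closed_walks K B. f (rotate i w)) = (\<Sum>w\<in>closed_walks K B. f w :: real)"
proof (induction i)
  case (Suc i)
  have inj: "inj_on rotate1 (closed_walks K B)"
    by (rule inj_onI) (metis rotate1_hd_tl rotate1_rotate_swap rotate_length01 inj_rotate1 injD)
  have "rotate1 ` closed_walks K B = closed_walks K B"
    by (rule endo_inj_surj[OF finite_closed_walks]) (auto intro: rotate1_closed_walks inj)
  then have bij: "bij_betw rotate1 (closed_walks K B) (closed_walks K B)"
    using inj by (simp add: bij_betw_def)
  have "(\<Sum>w\<in>closed_walks K B. f (rotate (Suc i) w)) = (\<Sum>w\<in>closed_walks K B. f (rotate i (rotate1 w)))"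
    by (simp add: rotate1_rotate_swap)
  also have "\<dots> = (\<Sum>w\<in>closed_walks K B. f (rotate i w))"
    by (rule sum.reindex_bij_betw[OF bij])
  finally show ?case using Suc by simp
qed simp

text \<open>Rotation carries each of the K edges to the first position and preserves both the set of
  walks and g, so a sum over all edges reduces to a sum over the first edge.\<close>

lemma sum_edges_closed_walks:
  fixes \<psi> :: "nat \<Rightarrow> real"
  assumes g: "\<And>w. g (rotate1 w) = g w"
  shows "(\<Sum>w\<in>closed_walks K B. (\<Sum>e\<leftarrow>edges w. \<psi> e) * g w)
    = real K * (\<Sum>w\<in>closed_walks K B. \<psi> (hd (edges w)) * g w)"
proof -
  have gi: "g (rotate i w) = g w" for i w
    by (induction i) (auto simp: g)
  have er: "edges (rotate i w) = rotate i (edges w)" for i w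
    by (induction i) (auto simp: edges_rotate1)
  have *: "(\<Sum>e\<leftarrow>edges w. \<psi> e) * g w = (\<Sum>i<K. \<psi> (hd (edges (rotate i w))) * g (rotate i w))"
    if "w \<in> closed_walks K B" for w
  proof -
    have l: "length w = K" using that by (simp add: closed_walks_def)
    have "(\<Sum>e\<leftarrow>edges w. \<psi> e) = (\<Sum>i<K. \<psi> (edges w ! i))"
      by (simp add: sum_list_sum_nth l atLeast0LessThan)
    also have "\<dots> = (\<Sum>i<K. \<psi> (hd (edges (rotate i w))))"
    proof (intro sum.cong refl)
      fix i assume "i \<in> {..<K}"
      then have i: "i < length (edges w)" using l by auto
      then have "edges w \<noteq> []" by (metis list.size(3) not_less_zero)
      with i show "\<psi> (edges w ! i) = \<psi> (hd (edges (rotate i w)))"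
        by (simp add: er hd_rotate_conv_nth)
    qed
    finally show ?thesis by (simp add: sum_distrib_right gi)
  qed
  have "(\<Sum>w\<in>closed_walks K B. (\<Sum>e\<leftarrow>edges w. \<psi> e) * g w)
      = (\<Sum>w\<in>closed_walks K B. \<Sum>i<K. \<psi> (hd (edges (rotate i w))) * g (rotate i w))"
    by (rule sum.cong) (auto simp: *)
  also have "\<dots> = (\<Sum>i<K. \<Sum>w\<in>closed_walks K B. \<psi> (hd (edges (rotate i w))) * g (rotate i w))"
    by (rule sum.swap)
  also have "\<dots> = (\<Sum>i<K. \<Sum>w\<in>closed_walks K B. \<psi> (hd (edges w)) * g w)"
    by (simp only: sum_rotate_closed_walks[where f = "\<lambda>w. \<psi> (hd (edges w)) * g w"])
  finally show ?thesis by simp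
qed

text \<open>The path expansion of a matrix power; \<open>v\<close> lists the j interior vertices.
  The hypothesis on B ensures that the height bound excludes no path from x.\<close>

lemma path_sum_eq_jacobi_pow:
  assumes a0: "a 0 = 0" and B: "x + Suc j \<le> B"
  shows "(\<Sum>v | set v \<subseteq> {..B} \<and> length v = j \<and> list_all2 adj (x # v) (v @ [y]).
      prod_list (map a (map2 max (x # v) (v @ [y])))) = jacobi_pow a (Suc j) x y"
  using B
proof (induction j arbitrary: x)
  case 0
  have eq: "{v. set v \<subseteq> {..B} \<and> length v = 0 \<and> list_all2 adj (x # v) (v @ [y])}
      = (if adj x y then {[]} else {})" by auto
  have "(if adj x y then a (max x y) else 0) = jacobi_pow a (Suc 0) x y"
    using a0 by (cases x) (auto simp: adj_def)
  then show ?case unfolding eq by (cases "adj x y") simp_all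
next
  case (Suc j)
  define Q where "Q = (\<lambda>z. {v. set v \<subseteq> {..B} \<and> length v = j \<and> list_all2 adj (z # v) (v @ [y])})"
  define f where "f = (\<lambda>z v. prod_list (map a (map2 max (z # v) (v @ [y]))))"
  define Z where "Z = {z. z \<le> B \<and> adj x z}"
  have finQ: "finite (Q z)" for z
    by (rule finite_subset[OF _ finite_lists_length_eq[of "{..B}" j]]) (auto simp: Q_def)
  have Z: "Z = (if x = 0 then {Suc x} else {Suc x, x - 1})"
    using Suc.prems by (auto simp: Z_def adj_def)
  have eq: "{v. set v \<subseteq> {..B} \<and> length v = Suc j \<and> list_all2 adj (x # v) (v @ [y])}
      = (\<lambda>(z, v). z # v) ` Sigma Z Q"
    by (auto simp: Z_def Q_def length_Suc_conv image_iff)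
  have "(\<Sum>v | set v \<subseteq> {..B} \<and> length v = Suc j \<and> list_all2 adj (x # v) (v @ [y]).
      prod_list (map a (map2 max (x # v) (v @ [y])))) = (\<Sum>(z, v)\<in>Sigma Z Q. a (max x z) * f z v)"
    unfolding eq by (subst sum.reindex) (auto simp: inj_on_def f_def intro!: sum.cong)
  also have "\<dots> = (\<Sum>z\<in>Z. \<Sum>v\<in>Q z. a (max x z) * f z v)"
    by (rule sum.Sigma[symmetric]) (auto simp: Z finQ)
  also have "\<dots> = (\<Sum>z\<in>Z. a (max x z) * jacobi_pow a (Suc j) z y)"
  proof (intro sum.cong refl)
    fix z assume "z \<in> Z"
    then have "z + Suc j \<le> B" using Suc.prems by (auto simp: Z_def adj_def)
    from Suc.IH[OF this]
    show "(\<Sum>v\<in>Q z. a (max x z) * f z v) = a (max x z) * jacobi_pow a (Suc j) z y"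
      unfolding f_def Q_def by (simp only: sum_distrib_left[symmetric])
  qed
  also have "\<dots> = jacobi_pow a (Suc (Suc j)) x y"
    using a0 by (cases x) (auto simp: Z)
  finally show ?case .
qed

text \<open>The first edge is n exactly when the walk starts with n, n - 1 or with n - 1, n. By
  symmetry of J the two ways back contribute equally, hence the factor 2.\<close>

lemma sum_closed_walks_hd:
  fixes \<beta> :: "nat \<Rightarrow> real"
  assumes \<beta>: "\<beta> 0 = 0" "\<And>n. \<beta> n \<ge> 0" and k: "k \<ge> 1" and n: "n \<ge> 1" "n + 2 * k \<le> B"
  shows "(\<Sum>w | w \<in> closed_walks (2 * k) B \<and> hd (edges w) = n. \<Prod>e\<leftarrow>edges w. sqrt (\<beta> e)) = 2 * F \<beta> k n"
proof -
  define a where "a = (\<lambda>n. sqrt (\<beta> n))"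
  have a0: "a 0 = 0" by (simp add: a_def \<beta>)
  define j where "j = 2 * k - 2"
  have jk: "2 * k = Suc (Suc j)" using k by (simp add: j_def)
  define Q where "Q = (\<lambda>x y. {v. set v \<subseteq> {..B} \<and> length v = j \<and> list_all2 adj (y # v) (v @ [x])})"
  have finQ: "finite (Q x y)" for x y
    by (rule finite_subset[OF _ finite_lists_length_eq[of "{..B}" j]]) (auto simp: Q_def)
  define f where "f = (\<lambda>x y v. a (max x y) * prod_list (map a (map2 max (y # v) (v @ [x]))))"
  have eq: "{w. w \<in> closed_walks (2 * k) B \<and> hd (edges w) = n}
    = (\<lambda>v. n # (n - 1) # v) ` Q n (n - 1) \<union> (\<lambda>v. (n - 1) # n # v) ` Q (n - 1) n" (is "?L = ?R")
  proof (intro equalityI subsetI)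
    fix w assume w: "w \<in> ?L"
    then obtain x y v where w': "w = x # y # v"
      by (auto simp: closed_walks_def jk length_Suc_conv)
    show "w \<in> ?R" using w n by (auto simp: w' closed_walks_def edges_def adj_def Q_def image_iff jk)
  next
    fix w assume "w \<in> ?R"
    then show "w \<in> ?L" using n by (auto simp: closed_walks_def edges_def adj_def Q_def jk)
  qed
  have S: "(\<Sum>v\<in>Q x y. f x y v) = a (max x y) * jacobi_pow a (Suc j) y x" if "y \<le> n" for x y
    unfolding f_def Q_def sum_distrib_left[symmetric]
    using path_sum_eq_jacobi_pow[where a = a and x = y and j = j and y = x and B = B, OF a0] n that
    by (simp add: jk)
  have "(\<Sum>w | w \<in> closed_walks (2 * k) B \<and> hd (edges w) = n. prod_list (map a (edges w)))
     = (\<Sum>w\<in>(\<lambda>v. n # (n - 1) # v) ` Q n (n - 1). prod_list (map a (edges w)))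
     + (\<Sum>w\<in>(\<lambda>v. (n - 1) # n # v) ` Q (n - 1) n. prod_list (map a (edges w)))"
    unfolding eq by (rule sum.union_disjoint) (use n finQ in auto)
  also have "\<dots> = (\<Sum>v\<in>Q n (n - 1). f n (n - 1) v) + (\<Sum>v\<in>Q (n - 1) n. f (n - 1) n v)"
    by (subst (1 2) sum.reindex) (auto simp: inj_on_def f_def edges_def)
  also have "\<dots> = a n * jacobi_pow a (Suc j) (n - 1) n + a n * jacobi_pow a (Suc j) n (n - 1)"
    by (simp only: S[OF diff_le_self] S[OF order_refl] max_absorb1[OF diff_le_self] max_absorb2[OF diff_le_self])
  also have "\<dots> = 2 * (a n * jacobi_pow a (2 * k - 1) n (n - 1))"
    using jacobi_pow_sym[where a = a, OF a0, of "Suc j" n "n - 1"] by (simp add: jk del: jacobi_pow.simps)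
  also have "a n * jacobi_pow a (2 * k - 1) n (n - 1) = F \<beta> k n"
    using F_eq_jacobi_pow[where \<beta> = \<beta>, OF \<beta> k, of n] by (simp add: a_def)
  finally show ?thesis by (simp add: a_def)
qed

text \<open>The factor 4 k is the number 2 k of positions of an edge times its two directions. For
  \<psi> the indicator of n and positive \<beta> n it says that 2 k F is the derivative of the walk
  sum with respect to ln (\<beta> n).\<close>

theorem sum_closed_walks_F:
  fixes \<beta> \<psi> :: "nat \<Rightarrow> real"
  assumes \<beta>: "\<beta> 0 = 0" "\<And>n. \<beta> n \<ge> 0" and k: "k \<ge> 1"
    and S: "S \<subseteq> {1..}" "\<And>n. n \<in> S \<Longrightarrow> n + 2 * k \<le> B" and \<psi>: "\<And>n. n \<notin> S \<Longrightarrow> \<psi> n = 0"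
  shows "(\<Sum>w\<in>closed_walks (2 * k) B. (\<Sum>e\<leftarrow>edges w. \<psi> e) * (\<Prod>e\<leftarrow>edges w. sqrt (\<beta> e)))
    = 4 * real k * (\<Sum>n\<in>S. \<psi> n * F \<beta> k n)"
proof -
  define g where "g = (\<lambda>w. \<Prod>e\<leftarrow>edges w. sqrt (\<beta> e))"
  let ?C = "closed_walks (2 * k) B"
  have finS: "finite S" by (rule finite_subset[of _ "{..B}"]) (use S(2) in fastforce)+
  have g: "g (rotate1 w) = g w" for w
    unfolding g_def edges_rotate1 by (cases "edges w") (auto simp: mult.commute)
  have "(\<Sum>w\<in>?C. \<psi> (hd (edges w)) * g w) = (\<Sum>w\<in>?C. \<Sum>n\<in>S. if n = hd (edges w) then \<psi> n * g w else 0)"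
    using \<psi> finS by (intro sum.cong refl) auto
  also have "\<dots> = (\<Sum>n\<in>S. \<Sum>w\<in>?C. if n = hd (edges w) then \<psi> n * g w else 0)"
    by (rule sum.swap)
  also have "\<dots> = (\<Sum>n\<in>S. \<psi> n * (2 * F \<beta> k n))"
  proof (intro sum.cong refl)
    fix n assume "n \<in> S"
    have "(\<Sum>w\<in>?C. if n = hd (edges w) then \<psi> n * g w else 0)
        = (\<Sum>w | w \<in> ?C \<and> hd (edges w) = n. \<psi> n * g w)"
      by (subst sum.inter_filter[OF finite_closed_walks, symmetric])
        (auto intro!: sum.cong)
    also have "\<dots> = \<psi> n * (2 * F \<beta> k n)"
      using sum_closed_walks_hd[where \<beta> = \<beta>, OF \<beta> k, of n B] S \<open>n \<in> S\<close>
      by (auto simp: g_def sum_distrib_left[symmetric])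
    finally show "(\<Sum>w\<in>?C. if n = hd (edges w) then \<psi> n * g w else 0) = \<psi> n * (2 * F \<beta> k n)" .
  qed
  finally have "(\<Sum>w\<in>?C. \<psi> (hd (edges w)) * g w) = (\<Sum>n\<in>S. \<psi> n * (2 * F \<beta> k n))" .
  then show ?thesis
    using sum_edges_closed_walks[where g = g and \<psi> = \<psi> and K = "2 * k" and B = B, OF g]
    by (simp add: g_def sum_distrib_left mult_ac)
qed

section \<open>Convexity in logarithmic variables\<close>

text \<open>\<theta> is the logarithmic mean. Both bounds come from ln u <= u - 1, applied to the
  two ratios. The upper bound is the sum rather than the maximum so that it splits into one walk sum
  for each sequence.\<close>

lemma exists_log_mean:
  fixes X Y :: real
  assumes "X > 0" "Y > 0"
  shows "\<exists>\<theta>. min X Y \<le> \<theta> \<and> \<theta> \<le> X + Y \<and> X - Y = \<theta> * (ln X - ln Y)"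
proof -
  have *: "\<exists>\<theta>. B \<le> \<theta> \<and> \<theta> \<le> A + B \<and> A - B = \<theta> * (ln A - ln B)" if "A > B" "B > 0" for A B :: real
  proof (intro exI conjI)
    have l: "ln A - ln B > 0" using that by simp
    have "ln (A / B) \<le> A / B - 1" using that by (intro ln_le_minus_one) simp
    then have "B * (ln A - ln B) \<le> A - B" using that by (simp add: ln_div field_simps)
    then show "B \<le> (A - B) / (ln A - ln B)" using l by (simp add: field_simps)
    have "ln (B / A) \<le> B / A - 1" using that by (intro ln_le_minus_one) simp
    then have "A - B \<le> A * (ln A - ln B)" using that by (simp add: ln_div field_simps)
    also have "\<dots> \<le> (A + B) * (ln A - ln B)" using that l by (intro mult_right_mono) auto
    finally show "(A - B) / (ln A - ln B) \<le> A + B" using l by (simp add: field_simps)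
    show "A - B = (A - B) / (ln A - ln B) * (ln A - ln B)" using l by simp
  qed
  consider "X > Y" | "X = Y" | "Y > X" by linarith
  then show ?thesis
  proof cases
    case 1
    then show ?thesis using *[of Y X] assms by auto
  next
    case 2
    then show ?thesis using assms by (intro exI[of _ X]) auto
  next
    case 3
    from *[OF this assms(1)] obtain \<theta> where "X \<le> \<theta>" "\<theta> \<le> Y + X" "Y - X = \<theta> * (ln Y - ln X)" by blast
    then show ?thesis using 3 by (intro exI[of _ \<theta>]) (auto simp: algebra_simps)
  qed
qed

text \<open>Symmetrising in i and j replaces u_i^2 by (u_i^2 + u_j^2) / 2 = u_i u_j + (u_i - u_j)^2
  / 2. The first part gives the square; the second is the commutator, bounded by the Cauchy-Schwarz
  inequality.\<close>

lemma commutator_lower_bound: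
  fixes u d :: "nat \<Rightarrow> real"
  assumes u: "\<And>i. i < K \<Longrightarrow> u i \<ge> 0"
    and \<kappa>: "\<And>i j. i < K \<Longrightarrow> j < K \<Longrightarrow> (u i - u j)\<^sup>2 \<le> \<kappa> * (u i * u j)" and "\<kappa> \<ge> 0"
  shows "(\<Sum>i<K. (u i)\<^sup>2 * d i) * (\<Sum>i<K. d i)
    \<ge> (\<Sum>i<K. u i * d i)\<^sup>2 - \<kappa> / 2 * real K * (\<Sum>i<K. (u i)\<^sup>2 * (d i)\<^sup>2)"
proof -
  have sq: "(\<Sum>i<K. f i)\<^sup>2 = (\<Sum>i<K. \<Sum>j<K. f i * f j)" for f :: "nat \<Rightarrow> real"
    by (simp add: power2_eq_square sum_product)
  have a: "(\<Sum>i<K. (u i)\<^sup>2 * d i) * (\<Sum>i<K. d i) = (\<Sum>i<K. \<Sum>j<K. (u i)\<^sup>2 * d i * d j)"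
    by (simp add: sum_product)
  have "2 * (\<Sum>i<K. \<Sum>j<K. (u i)\<^sup>2 * d i * d j) = (\<Sum>i<K. \<Sum>j<K. (u i)\<^sup>2 * d i * d j) + (\<Sum>i<K. \<Sum>j<K. (u j)\<^sup>2 * d j * d i)"
    by (subst (2) sum.swap) simp
  also have "\<dots> = 2 * (\<Sum>i<K. u i * d i)\<^sup>2 + (\<Sum>i<K. \<Sum>j<K. (u i - u j)\<^sup>2 * (d i * d j))"
    unfolding sq sum_distrib_left sum.distrib[symmetric]
    by (intro sum.cong refl) (simp add: power2_eq_square algebra_simps)
  finally have 1: "2 * ((\<Sum>i<K. (u i)\<^sup>2 * d i) * (\<Sum>i<K. d i))
     = 2 * (\<Sum>i<K. u i * d i)\<^sup>2 + (\<Sum>i<K. \<Sum>j<K. (u i - u j)\<^sup>2 * (d i * d j))"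
    unfolding a .
  have "- (\<Sum>i<K. \<Sum>j<K. (u i - u j)\<^sup>2 * (d i * d j)) \<le> (\<Sum>i<K. \<Sum>j<K. \<kappa> * (u i * \<bar>d i\<bar> * (u j * \<bar>d j\<bar>)))"
    unfolding sum_negf[symmetric]
  proof (intro sum_mono)
    fix i j assume ij: "i \<in> {..<K}" "j \<in> {..<K}"
    have "- ((u i - u j)\<^sup>2 * (d i * d j)) \<le> (u i - u j)\<^sup>2 * \<bar>d i * d j\<bar>"
      by (metis abs_ge_minus_self abs_mult abs_power2)
    also have "\<dots> \<le> \<kappa> * (u i * u j) * \<bar>d i * d j\<bar>"
      using \<kappa>[of i j] ij by (intro mult_right_mono) auto
    finally show "- ((u i - u j)\<^sup>2 * (d i * d j)) \<le> \<kappa> * (u i * \<bar>d i\<bar> * (u j * \<bar>d j\<bar>))"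
      by (simp add: abs_mult mult_ac)
  qed
  also have "\<dots> = \<kappa> * (\<Sum>i<K. u i * \<bar>d i\<bar>)\<^sup>2" by (simp add: sq sum_distrib_left)
  also have "\<dots> \<le> \<kappa> * (real K * (\<Sum>i<K. (u i * \<bar>d i\<bar>)\<^sup>2))"
    using sum_squared_le_sum_of_squares[of "\<lambda>i. u i * \<bar>d i\<bar>" "{..<K}"] \<open>\<kappa> \<ge> 0\<close>
    by (intro mult_left_mono) (auto simp: mult_ac)
  finally show ?thesis using 1 by (simp add: power_mult_distrib mult_ac)
qed

lemma weighted_product_bound:
  fixes u d :: "nat \<Rightarrow> real"
  assumes \<Lambda>: "\<And>i j. i < K \<Longrightarrow> j < K \<Longrightarrow> (u i)\<^sup>2 \<le> \<Lambda> * (u j)\<^sup>2"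
  shows "\<bar>(\<Sum>i<K. (u i)\<^sup>2 * d i) * (\<Sum>i<K. d i)\<bar> \<le> real K * (1 + \<Lambda>) / 2 * (\<Sum>i<K. (u i)\<^sup>2 * (d i)\<^sup>2)"
proof -
  have "\<bar>(\<Sum>i<K. (u i)\<^sup>2 * d i) * (\<Sum>i<K. d i)\<bar> \<le> (\<Sum>i<K. \<Sum>j<K. \<bar>(u i)\<^sup>2 * d i * d j\<bar>)"
    unfolding sum_product by (intro order_trans[OF sum_abs] sum_mono sum_abs)
  also have "\<dots> \<le> (\<Sum>i<K. \<Sum>j<K. (u i)\<^sup>2 * (d i)\<^sup>2 / 2 + \<Lambda> / 2 * ((u j)\<^sup>2 * (d j)\<^sup>2))"
  proof (intro sum_mono)
    fix i j assume ij: "i \<in> {..<K}" "j \<in> {..<K}"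
    have "2 * (\<bar>d i\<bar> * \<bar>d j\<bar>) \<le> (d i)\<^sup>2 + (d j)\<^sup>2"
      using sum_squares_bound[of "\<bar>d i\<bar>" "\<bar>d j\<bar>"] by simp
    then have "(u i)\<^sup>2 * (2 * (\<bar>d i\<bar> * \<bar>d j\<bar>)) \<le> (u i)\<^sup>2 * ((d i)\<^sup>2 + (d j)\<^sup>2)"
      by (intro mult_left_mono) auto
    moreover have "(u i)\<^sup>2 * (d j)\<^sup>2 \<le> \<Lambda> * (u j)\<^sup>2 * (d j)\<^sup>2"
      using \<Lambda>[of i j] ij by (intro mult_right_mono) auto
    ultimately show "\<bar>(u i)\<^sup>2 * d i * d j\<bar> \<le> (u i)\<^sup>2 * (d i)\<^sup>2 / 2 + \<Lambda> / 2 * ((u j)\<^sup>2 * (d j)\<^sup>2)"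
      by (simp add: abs_mult algebra_simps)
  qed
  also have "\<dots> = real K * (\<Sum>i<K. (u i)\<^sup>2 * (d i)\<^sup>2 / 2) + real K * (\<Sum>j<K. \<Lambda> / 2 * ((u j)\<^sup>2 * (d j)\<^sup>2))"
    by (simp add: sum.distrib sum_distrib_left)
  also have "\<dots> = real K * (1 + \<Lambda>) / 2 * (\<Sum>i<K. (u i)\<^sup>2 * (d i)\<^sup>2)"
    by (simp add: sum_distrib_left[symmetric] sum_divide_distrib[symmetric] field_simps)
  finally show ?thesis .
qed

lemma closed_walks_edge_pos: "w \<in> closed_walks K B \<Longrightarrow> e \<in> set (edges w) \<Longrightarrow> e \<ge> 1"
  by (auto simp: closed_walks_def edges_def list_all2_iff adj_def)

lemma closed_walks_nth_diff:
  assumes "w \<in> closed_walks K B" "j < K" "i \<le> j"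
  shows "w ! j \<le> w ! i + (j - i)" "w ! i \<le> w ! j + (j - i)"
proof -
  have l: "length w = K" and a: "list_all2 adj w (rotate1 w)" using assms by (auto simp: closed_walks_def)
  have s: "adj (w ! i) (w ! Suc i)" if "Suc i < K" for i
    using list_all2_nthD[OF a, of i] that l by (simp add: nth_rotate1)
  have "w ! (i + d) \<le> w ! i + d \<and> w ! i \<le> w ! (i + d) + d" if "i + d < K" for d
    using that
  proof (induction d)
    case (Suc d)
    then show ?case using s[of "i + d"] by (auto simp: adj_def)
  qed simp
  from this[of "j - i"] assms show "w ! j \<le> w ! i + (j - i)" "w ! i \<le> w ! j + (j - i)" by auto
qed

lemma closed_walks_edge_diff:
  assumes w: "w \<in> closed_walks K B" and ij: "i < K" "j < K"
  shows "edges w ! i \<le> edges w ! j + 2 * K"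
proof -
  have l: "length w = K" using w by (auto simp: closed_walks_def)
  have d: "w ! p \<le> w ! q + K" if "p < K" "q < K" for p q
    using closed_walks_nth_diff[OF w, of p q] closed_walks_nth_diff[OF w, of q p] that by (cases "p \<le> q") auto
  have e: "edges w ! p = max (w ! p) (w ! (Suc p mod K))" if "p < K" for p
    using that l by (simp add: edges_def nth_rotate1)
  have "Suc p mod K < K" if "p < K" for p using that by simp
  with ij d[of i j] d[of "Suc i mod K" j] have "w ! i \<le> w ! j + K" "w ! (Suc i mod K) \<le> w ! j + K" by auto
  then show ?thesis using ij by (simp add: e max_def)
qed

section \<open>Growth bounds for F\<close>

definition step_const :: "(nat \<Rightarrow> real) \<Rightarrow> nat \<Rightarrow> real" where
  "step_const D l = D (Suc l) * (3 + 2 ^ Suc l) + (\<Sum>i\<in>{1..l}. D i * (1 + 2 ^ i) * (2 * D (Suc l - i)))"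

lemma step_const_nonneg: "(\<And>i. D i \<ge> 0) \<Longrightarrow> step_const D l \<ge> 0"
  unfolding step_const_def by (intro add_nonneg_nonneg mult_nonneg_nonneg sum_nonneg) auto

text \<open>The subtracted sum is nonnegative and is dropped. A shift to n + 1 costs 2 ^ i and a
  shift to n - 1 nothing, which gives \<open>step_const\<close>. The factor \<beta> n is kept
  instead of being bounded by a multiple of r n, because it later yields a lower bound for
  \<beta>.\<close>

lemma F_step_bound:
  fixes r :: "nat \<Rightarrow> real"
  assumes r: "\<And>n. r n \<ge> 0" "\<And>n. r n \<le> r (Suc n)" "\<And>n. r (Suc n) \<le> 2 * r n"
    and \<beta>: "\<beta> 0 = 0" "\<And>n. \<beta> n \<ge> 0"
    and D: "\<And>i. D i \<ge> 0" and DF: "\<And>i n. i \<le> Suc l \<Longrightarrow> F \<beta> i n \<le> D i * r n ^ i"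
  shows "F \<beta> (Suc (Suc l)) n \<le> \<beta> n * (step_const D l * r n ^ Suc l)"
proof -
  have pos: "F \<beta> i n \<ge> 0" for i n by (rule F_nonneg[where \<beta> = \<beta>, OF \<beta>])
  have U1: "F \<beta> i (n + 1) \<le> D i * 2 ^ i * r n ^ i" if "i \<le> Suc l" for i
  proof -
    have "F \<beta> i (n + 1) \<le> D i * r (Suc n) ^ i" using DF[OF that, of "n + 1"] by simp
    also have "\<dots> \<le> D i * (2 * r n) ^ i" using r D by (intro mult_left_mono power_mono) auto
    finally show ?thesis by (simp add: power_mult_distrib mult_ac)
  qed
  have Um: "F \<beta> i (n - 1) \<le> D i * r n ^ i" if "i \<le> Suc l" for i
  proof -
    have "F \<beta> i (n - 1) \<le> D i * r (n - 1) ^ i" using DF[OF that] .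
    also have "\<dots> \<le> D i * r n ^ i" using r(1) r(2)[of "n - 1"] D
      by (intro mult_left_mono power_mono) (cases n, auto)
    finally show ?thesis .
  qed
  have T: "F \<beta> (Suc l) (n - 1) + 2 * F \<beta> (Suc l) n + F \<beta> (Suc l) (n + 1) \<le> D (Suc l) * (3 + 2 ^ Suc l) * r n ^ Suc l"
    using DF[of "Suc l" n] U1[of "Suc l"] Um[of "Suc l"] by (simp add: algebra_simps)
  have S: "(\<Sum>i\<in>{1..l}. (F \<beta> i n + F \<beta> i (n + 1)) * (F \<beta> (Suc l - i) (n - 1) + F \<beta> (Suc l - i) n))
    \<le> (\<Sum>i\<in>{1..l}. D i * (1 + 2 ^ i) * (2 * D (Suc l - i)) * r n ^ Suc l)"
  proof (rule sum_mono)
    fix i assume i: "i \<in> {1..l}"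
    have "(F \<beta> i n + F \<beta> i (n + 1)) * (F \<beta> (Suc l - i) (n - 1) + F \<beta> (Suc l - i) n)
        \<le> (D i * (1 + 2 ^ i) * r n ^ i) * (2 * D (Suc l - i) * r n ^ (Suc l - i))"
    proof (rule mult_mono)
      show "F \<beta> i n + F \<beta> i (n + 1) \<le> D i * (1 + 2 ^ i) * r n ^ i"
        using DF[of i n] U1[of i] i by (simp add: algebra_simps)
      show "F \<beta> (Suc l - i) (n - 1) + F \<beta> (Suc l - i) n \<le> 2 * D (Suc l - i) * r n ^ (Suc l - i)"
        using DF[of "Suc l - i" n] Um[of "Suc l - i"] i by simp
    qed (use D r(1) pos in \<open>auto intro!: mult_nonneg_nonneg add_nonneg_nonneg\<close>)
    also have "\<dots> = D i * (1 + 2 ^ i) * (2 * D (Suc l - i)) * (r n ^ i * r n ^ (Suc l - i))"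
      by (simp add: mult_ac)
    also have "r n ^ i * r n ^ (Suc l - i) = r n ^ Suc l"
      using i by (simp add: power_add[symmetric] del: power_Suc)
    finally show "(F \<beta> i n + F \<beta> i (n + 1)) * (F \<beta> (Suc l - i) (n - 1) + F \<beta> (Suc l - i) n)
        \<le> D i * (1 + 2 ^ i) * (2 * D (Suc l - i)) * r n ^ Suc l" .
  qed
  have "0 \<le> (\<Sum>i\<in>{1..Suc l}. F \<beta> i n * F \<beta> (Suc (Suc l) - i) n)"
    by (intro sum_nonneg mult_nonneg_nonneg pos)
  then have "F \<beta> (Suc (Suc l)) n \<le> F \<beta> 1 n * (F \<beta> (Suc l) (n - 1) + 2 * F \<beta> (Suc l) n + F \<beta> (Suc l) (n + 1))
    + F \<beta> 1 n * (\<Sum>i\<in>{1..l}. (F \<beta> i n + F \<beta> i (n + 1)) * (F \<beta> (Suc l - i) (n - 1) + F \<beta> (Suc l - i) n))"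
    unfolding F.simps(3)[of \<beta> l n] by linarith
  also have "\<dots> \<le> F \<beta> 1 n * (D (Suc l) * (3 + 2 ^ Suc l) * r n ^ Suc l)
    + F \<beta> 1 n * (\<Sum>i\<in>{1..l}. D i * (1 + 2 ^ i) * (2 * D (Suc l - i)) * r n ^ Suc l)"
    by (intro add_mono mult_left_mono[OF T] mult_left_mono[OF S] pos)
  also have "\<dots> = \<beta> n * (step_const D l * r n ^ Suc l)"
    unfolding sum_distrib_right[symmetric] step_const_def by (simp add: algebra_simps)
  finally show ?thesis .
qed

text \<open>The constant is chosen before \<beta>, so that one constant serves all sequences that
  are compared.\<close>

lemma F_upper_bound:
  fixes r :: "nat \<Rightarrow> real"
  assumes r: "\<And>n. r n \<ge> 0" "\<And>n. r n \<le> r (Suc n)" "\<And>n. r (Suc n) \<le> 2 * r n" and "C \<ge> 0"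
  shows "\<exists>D\<ge>0. \<forall>\<beta> n. \<beta> 0 = 0 \<longrightarrow> (\<forall>n. 0 \<le> \<beta> n \<and> \<beta> n \<le> C * r n) \<longrightarrow> F \<beta> k n \<le> D * r n ^ k"
proof (induction k rule: less_induct)
  case (less k)
  consider "k = 0" | "k = 1" | l where "k = Suc (Suc l)"
    by (metis One_nat_def not0_implies_Suc)
  then show ?case
  proof cases
    case 1
    then show ?thesis by (intro exI[of _ 0]) auto
  next
    case 2
    then show ?thesis using \<open>C \<ge> 0\<close> by (intro exI[of _ C]) auto
  next
    case (3 l)
    have "\<forall>i. \<exists>D\<ge>0. i \<le> Suc l \<longrightarrow> (\<forall>\<beta> n. \<beta> 0 = 0 \<longrightarrow> (\<forall>n. 0 \<le> \<beta> n \<and> \<beta> n \<le> C * r n) \<longrightarrow> F \<beta> i n \<le> D * r n ^ i)"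
    proof
      fix i
      show "\<exists>D\<ge>0. i \<le> Suc l \<longrightarrow> (\<forall>\<beta> n. \<beta> 0 = 0 \<longrightarrow> (\<forall>n. 0 \<le> \<beta> n \<and> \<beta> n \<le> C * r n) \<longrightarrow> F \<beta> i n \<le> D * r n ^ i)"
        using less.IH[of i] 3 by (cases "i \<le> Suc l") auto
    qed
    then obtain D where D: "\<And>i. D i \<ge> 0"
      "\<And>i \<beta> n. i \<le> Suc l \<Longrightarrow> \<beta> 0 = 0 \<Longrightarrow> (\<forall>n. 0 \<le> \<beta> n \<and> \<beta> n \<le> C * r n) \<Longrightarrow> F \<beta> i n \<le> D i * r n ^ i"
      by metis
    show ?thesis
    proof (intro exI conjI allI impI)
      show "C * step_const D l \<ge> 0" using \<open>C \<ge> 0\<close> step_const_nonneg[OF D(1)] by simp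
      fix \<beta> :: "nat \<Rightarrow> real" and n
      assume \<beta>: "\<beta> 0 = 0" "\<forall>n. 0 \<le> \<beta> n \<and> \<beta> n \<le> C * r n"
      have "F \<beta> (Suc (Suc l)) n \<le> \<beta> n * (step_const D l * r n ^ Suc l)"
        by (rule F_step_bound[where r = r]) (use r D \<beta> in auto)
      also have "\<dots> \<le> C * r n * (step_const D l * r n ^ Suc l)"
        using \<beta> r(1) step_const_nonneg[OF D(1)]
        by (intro mult_right_mono mult_nonneg_nonneg zero_le_power) auto
      finally show "F \<beta> k n \<le> C * step_const D l * r n ^ k" by (simp add: 3 mult_ac)
    qed
  qed
qed

lemma zigzag_walk:
  assumes "n \<ge> 1" "n \<le> B" "k \<ge> 1"
  defines "w \<equiv> map (\<lambda>i. if even i then n else n - 1) [0..<2 * k]"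
  shows "w \<in> closed_walks (2 * k) B" "edges w = replicate (2 * k) n"
proof -
  have r: "rotate1 w ! i = (if even i then n - 1 else n)" if "i < 2 * k" for i
  proof -
    \<comment> \<open>The length is even, so the alternating pattern also fits at the closing
      step.\<close>
    have "even (Suc i mod (2 * k)) = odd i" by (simp add: dvd_mod_iff)
    then show ?thesis using that assms(3) by (simp add: w_def nth_rotate1)
  qed
  have "list_all2 adj w (rotate1 w)"
    unfolding list_all2_conv_all_nth using r assms(1) by (auto simp: w_def adj_def)
  then show "w \<in> closed_walks (2 * k) B" using assms(1,2) by (auto simp: closed_walks_def w_def)
  show "edges w = replicate (2 * k) n"
  proof (rule nth_equalityI)
    fix i assume "i < length (edges w)"
    then have i: "i < 2 * k" by (simp add: w_def)
    then have "edges w ! i = max (w ! i) (rotate1 w ! i)" by (simp add: edges_def w_def)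
    then show "edges w ! i = replicate (2 * k) n ! i" using r[OF i] i by (simp add: w_def)
  qed (simp add: w_def)
qed

section \<open>Logarithmic difference of two sequences\<close>

locale log_difference =
  fixes x y :: "nat \<Rightarrow> real" and S :: "nat set" and \<delta> \<phi> :: "nat \<Rightarrow> real" and k :: nat
  assumes x0: "x 0 = 0" and y0: "y 0 = 0"
    and xpos: "\<And>n. n \<ge> 1 \<Longrightarrow> x n > 0" and ypos: "\<And>n. n \<ge> 1 \<Longrightarrow> y n > 0"
    and k: "k \<ge> 1" and finS: "finite S" and S1: "S \<subseteq> {1..}"
    and \<delta>: "\<And>n. n \<ge> 1 \<Longrightarrow> \<delta> n = ln (x n) - ln (y n)" and \<delta>0: "\<And>n. n \<notin> S \<Longrightarrow> \<delta> n = 0"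
    and \<phi>: "\<And>n. \<phi> n > 0"
begin

text \<open>The bound leaves room for every walk through an edge in S; \<open>insert 0\<close>
  covers empty S.\<close>

definition "walks = closed_walks (2 * k) (Max (insert 0 S) + 2 * k)"
definition "wx w = (\<Prod>e\<leftarrow>edges w. sqrt (x e))"
definition "wy w = (\<Prod>e\<leftarrow>edges w. sqrt (y e))"

lemma x_nonneg: "x n \<ge> 0" and y_nonneg: "y n \<ge> 0"
  using x0 y0 xpos[of n] ypos[of n] by (cases n; auto)+

lemma sum_walks:
  assumes "\<And>n. n \<notin> S \<Longrightarrow> \<psi> n = 0"
  shows "(\<Sum>w\<in>walks. (\<Sum>e\<leftarrow>edges w. \<psi> e) * wx w) = 4 * real k * (\<Sum>n\<in>S. \<psi> n * F x k n)"
    "(\<Sum>w\<in>walks. (\<Sum>e\<leftarrow>edges w. \<psi> e) * wy w) = 4 * real k * (\<Sum>n\<in>S. \<psi> n * F y k n)"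
proof -
  have "n \<le> Max (insert 0 S)" if "n \<in> S" for n using that finS by simp
  then have B: "n + 2 * k \<le> Max (insert 0 S) + 2 * k" if "n \<in> S" for n using that by simp
  show "(\<Sum>w\<in>walks. (\<Sum>e\<leftarrow>edges w. \<psi> e) * wx w) = 4 * real k * (\<Sum>n\<in>S. \<psi> n * F x k n)"
    unfolding walks_def wx_def
    by (rule sum_closed_walks_F[where \<beta> = x and \<psi> = \<psi>, OF x0 x_nonneg k S1 B assms])
  show "(\<Sum>w\<in>walks. (\<Sum>e\<leftarrow>edges w. \<psi> e) * wy w) = 4 * real k * (\<Sum>n\<in>S. \<psi> n * F y k n)"
    unfolding walks_def wy_def
    by (rule sum_closed_walks_F[where \<beta> = y and \<psi> = \<psi>, OF y0 y_nonneg k S1 B assms])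
qed

lemma sum_list_edges:
  "w \<in> walks \<Longrightarrow> (\<Sum>e\<leftarrow>edges w. f e) = (\<Sum>i<2 * k. f (edges w ! i) :: real)"
  by (simp add: walks_def closed_walks_def sum_list_sum_nth atLeast0LessThan)

lemma prod_list_sqrt:
  assumes "\<And>e. e \<in> set es \<Longrightarrow> e \<ge> 1" "\<And>n. n \<ge> 1 \<Longrightarrow> z n > (0::real)"
  shows "(\<Prod>e\<leftarrow>es. sqrt (z e)) > 0" "ln (\<Prod>e\<leftarrow>es. sqrt (z e)) = (\<Sum>e\<leftarrow>es. ln (z e)) / 2"
proof -
  have "(\<Prod>e\<leftarrow>es. sqrt (z e)) > 0 \<and> ln (\<Prod>e\<leftarrow>es. sqrt (z e)) = (\<Sum>e\<leftarrow>es. ln (z e)) / 2"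
    using assms(1)
  proof (induction es)
    case (Cons e es)
    have "z e > 0" using Cons.prems assms(2) by auto
    then show ?case using Cons by (auto simp: ln_mult ln_sqrt add_divide_distrib)
  qed auto
  then show "(\<Prod>e\<leftarrow>es. sqrt (z e)) > 0" "ln (\<Prod>e\<leftarrow>es. sqrt (z e)) = (\<Sum>e\<leftarrow>es. ln (z e)) / 2" by auto
qed

lemma walk_edge_pos: "w \<in> walks \<Longrightarrow> e \<in> set (edges w) \<Longrightarrow> e \<ge> 1"
  unfolding walks_def by (rule closed_walks_edge_pos)

lemma wx_pos: "w \<in> walks \<Longrightarrow> wx w > 0" and wy_pos: "w \<in> walks \<Longrightarrow> wy w > 0"
  unfolding wx_def wy_def by (rule prod_list_sqrt; use walk_edge_pos xpos ypos in blast)+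

text \<open>The logarithm of a walk weight is half the sum of the logarithms over its edges, so the
  difference for x and y is a linear form in \<delta>.\<close>

lemma log_mean_walk:
  assumes w: "w \<in> walks"
  shows "\<exists>\<theta>. min (wx w) (wy w) \<le> \<theta> \<and> \<theta> \<le> wx w + wy w
    \<and> wx w - wy w = \<theta> * ((\<Sum>e\<leftarrow>edges w. \<delta> e) / 2)"
proof -
  have "ln (wx w) - ln (wy w) = ((\<Sum>e\<leftarrow>edges w. ln (x e)) - (\<Sum>e\<leftarrow>edges w. ln (y e))) / 2"
    unfolding wx_def wy_def
    using prod_list_sqrt(2)[of "edges w" x] prod_list_sqrt(2)[of "edges w" y]
      walk_edge_pos[OF w] xpos ypos by (auto simp: diff_divide_distrib)
  also have "(\<Sum>e\<leftarrow>edges w. ln (x e)) - (\<Sum>e\<leftarrow>edges w. ln (y e)) = (\<Sum>e\<leftarrow>edges w. ln (x e) - ln (y e))"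
    by (rule sum_list_subtractf[symmetric])
  also have "\<dots> = (\<Sum>e\<leftarrow>edges w. \<delta> e)"
    by (intro arg_cong[where f = sum_list] map_cong refl) (use \<delta> walk_edge_pos[OF w] in auto)
  finally have "ln (wx w) - ln (wy w) = (\<Sum>e\<leftarrow>edges w. \<delta> e) / 2" .
  then show ?thesis using exists_log_mean[OF wx_pos[OF w] wy_pos[OF w]] by metis
qed

lemma sum_difference:
  "4 * real k * (\<Sum>n\<in>S. (\<phi> n)\<^sup>2 * \<delta> n * (F x k n - F y k n))
    = (\<Sum>w\<in>walks. (\<Sum>e\<leftarrow>edges w. (\<phi> e)\<^sup>2 * \<delta> e) * (wx w - wy w))"
proof -
  have *: "(\<phi> n)\<^sup>2 * \<delta> n = 0" if "n \<notin> S" for n using \<delta>0 that by simp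
  note sum_walks[where \<psi> = "\<lambda>n. (\<phi> n)\<^sup>2 * \<delta> n"]
  then show ?thesis
    unfolding right_diff_distrib sum_subtractf using * by presburger
qed

lemma sum_squares:
  "(\<Sum>w\<in>walks. (wx w + wy w) * (\<Sum>i<2 * k. (\<phi> (edges w ! i))\<^sup>2 * (\<delta> (edges w ! i))\<^sup>2))
    = 4 * real k * (\<Sum>n\<in>S. (\<phi> n)\<^sup>2 * (\<delta> n)\<^sup>2 * (F x k n + F y k n))"
proof -
  have *: "(\<phi> n)\<^sup>2 * (\<delta> n)\<^sup>2 = 0" if "n \<notin> S" for n using \<delta>0 that by simp
  have "(\<Sum>w\<in>walks. (wx w + wy w) * (\<Sum>i<2 * k. (\<phi> (edges w ! i))\<^sup>2 * (\<delta> (edges w ! i))\<^sup>2))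
      = (\<Sum>w\<in>walks. (\<Sum>e\<leftarrow>edges w. (\<phi> e)\<^sup>2 * (\<delta> e)\<^sup>2) * wx w)
      + (\<Sum>w\<in>walks. (\<Sum>e\<leftarrow>edges w. (\<phi> e)\<^sup>2 * (\<delta> e)\<^sup>2) * wy w)"
    unfolding sum.distrib[symmetric]
    by (intro sum.cong refl) (simp add: sum_list_edges algebra_simps)
  also have "\<dots> = 4 * real k * (\<Sum>n\<in>S. (\<phi> n)\<^sup>2 * (\<delta> n)\<^sup>2 * (F x k n + F y k n))"
    unfolding distrib_left sum.distrib
    using sum_walks[where \<psi> = "\<lambda>n. (\<phi> n)\<^sup>2 * (\<delta> n)\<^sup>2"] * by presburger
  finally show ?thesis .
qed

lemma edge_close:
  assumes "w \<in> walks" "i < 2 * k" "j < 2 * k"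
  shows "edges w ! i \<le> edges w ! j + 4 * k"
  using closed_walks_edge_diff[of w "2 * k" _ i j] assms by (auto simp: walks_def)

text \<open>Meant for k < m, where the sign of \<open>t k\<close> is unknown: only the size counts,
  and the mixed products are bounded by squares without any use of convexity.\<close>

theorem difference_upper_bound:
  assumes \<Lambda>: "\<And>i j. i \<le> j + 4 * k \<Longrightarrow> j \<le> i + 4 * k \<Longrightarrow> (\<phi> i)\<^sup>2 \<le> \<Lambda> * (\<phi> j)\<^sup>2"
  shows "\<bar>\<Sum>n\<in>S. (\<phi> n)\<^sup>2 * \<delta> n * (F x k n - F y k n)\<bar>
    \<le> real k * (1 + \<Lambda>) / 2 * (\<Sum>n\<in>S. (\<phi> n)\<^sup>2 * (\<delta> n)\<^sup>2 * (F x k n + F y k n))"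
proof -
  define q where "q w = (\<Sum>i<2 * k. (\<phi> (edges w ! i))\<^sup>2 * (\<delta> (edges w ! i))\<^sup>2)" for w
  have "\<bar>(\<Sum>e\<leftarrow>edges w. (\<phi> e)\<^sup>2 * \<delta> e) * (wx w - wy w)\<bar> \<le> real k * (1 + \<Lambda>) / 2 * ((wx w + wy w) * q w)"
    if w: "w \<in> walks" for w
  proof -
    obtain \<theta> where \<theta>: "min (wx w) (wy w) \<le> \<theta>" "\<theta> \<le> wx w + wy w"
      "wx w - wy w = \<theta> * ((\<Sum>e\<leftarrow>edges w. \<delta> e) / 2)" using log_mean_walk[OF w] by blast
    have \<theta>0: "\<theta> \<ge> 0" using \<theta>(1) wx_pos[OF w] wy_pos[OF w] by linarith
    have q: "q w \<ge> 0" by (auto simp: q_def intro: sum_nonneg)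
    have L: "\<bar>(\<Sum>i<2*k. (\<phi> (edges w ! i))\<^sup>2 * \<delta> (edges w ! i)) * (\<Sum>i<2*k. \<delta> (edges w ! i))\<bar>
        \<le> real (2 * k) * (1 + \<Lambda>) / 2 * q w"
      unfolding q_def by (rule weighted_product_bound) (intro \<Lambda> edge_close[OF w])
    have "\<bar>(\<Sum>e\<leftarrow>edges w. (\<phi> e)\<^sup>2 * \<delta> e) * (wx w - wy w)\<bar>
      = \<theta> / 2 * \<bar>(\<Sum>i<2*k. (\<phi> (edges w ! i))\<^sup>2 * \<delta> (edges w ! i)) * (\<Sum>i<2*k. \<delta> (edges w ! i))\<bar>"
      unfolding \<theta>(3) sum_list_edges[OF w] using \<theta>0 by (simp add: abs_mult)
    also have "\<dots> \<le> \<theta> / 2 * (real (2 * k) * (1 + \<Lambda>) / 2 * q w)"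
      using L \<theta>0 by (intro mult_left_mono) auto
    also have "\<dots> = real k * (1 + \<Lambda>) / 2 * (\<theta> * q w)" by simp
    also have "\<dots> \<le> real k * (1 + \<Lambda>) / 2 * ((wx w + wy w) * q w)"
    proof (intro mult_left_mono mult_right_mono \<theta>(2) q)
      have "(\<phi> 0)\<^sup>2 \<le> \<Lambda> * (\<phi> 0)\<^sup>2" by (rule \<Lambda>) auto
      then have "\<Lambda> \<ge> 1" using \<phi>[of 0] by simp
      then show "0 \<le> real k * (1 + \<Lambda>) / 2" by simp
    qed
    finally show ?thesis .
  qed
  then have "\<bar>4 * real k * (\<Sum>n\<in>S. (\<phi> n)\<^sup>2 * \<delta> n * (F x k n - F y k n))\<bar>
      \<le> (\<Sum>w\<in>walks. real k * (1 + \<Lambda>) / 2 * ((wx w + wy w) * q w))"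
    unfolding sum_difference by (intro order_trans[OF sum_abs] sum_mono)
  also have "\<dots> = 4 * real k * (real k * (1 + \<Lambda>) / 2 * (\<Sum>n\<in>S. (\<phi> n)\<^sup>2 * (\<delta> n)\<^sup>2 * (F x k n + F y k n)))"
    unfolding sum_distrib_left[symmetric] q_def sum_squares by simp
  finally show ?thesis using k by (simp add: abs_mult)
qed

text \<open>In the variables \<open>ln (x n)\<close> the weight of a walk is the exponential of a linear form, so the
  quadratic form of the difference is a sum of squares up to the commutator with \<open>\<phi>\<close>;
  the walks going back and forth along a single edge make it coercive.\<close>

theorem difference_lower_bound:
  assumes \<kappa>: "\<And>i j. i \<le> j + 4 * k \<Longrightarrow> j \<le> i + 4 * k \<Longrightarrow> (\<phi> i - \<phi> j)\<^sup>2 \<le> \<kappa> * (\<phi> i * \<phi> j)" and \<kappa>0: "\<kappa> \<ge> 0"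
  shows "(\<Sum>n\<in>S. (\<phi> n)\<^sup>2 * \<delta> n * (F x k n - F y k n))
    \<ge> real k / 2 * (\<Sum>n\<in>S. (\<phi> n)\<^sup>2 * (\<delta> n)\<^sup>2 * (min (x n) (y n)) ^ k)
      - real k * \<kappa> / 2 * (\<Sum>n\<in>S. (\<phi> n)\<^sup>2 * (\<delta> n)\<^sup>2 * (F x k n + F y k n))"
proof -
  define q where "q w = (\<Sum>i<2 * k. (\<phi> (edges w ! i))\<^sup>2 * (\<delta> (edges w ! i))\<^sup>2)" for w
  define l where "l w = (\<Sum>i<2 * k. \<phi> (edges w ! i) * \<delta> (edges w ! i))" for w
  define z where "z n = map (\<lambda>i. if even i then n else n - 1) [0..<2 * k]" for n :: nat
  have finw: "finite walks" by (simp add: walks_def finite_closed_walks)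
  have each: "(\<Sum>e\<leftarrow>edges w. (\<phi> e)\<^sup>2 * \<delta> e) * (wx w - wy w)
      \<ge> min (wx w) (wy w) / 2 * (l w)\<^sup>2 - real k * \<kappa> / 2 * ((wx w + wy w) * q w)"
    if w: "w \<in> walks" for w
  proof -
    obtain \<theta> where \<theta>: "min (wx w) (wy w) \<le> \<theta>" "\<theta> \<le> wx w + wy w"
      "wx w - wy w = \<theta> * ((\<Sum>e\<leftarrow>edges w. \<delta> e) / 2)" using log_mean_walk[OF w] by blast
    have \<theta>0: "\<theta> \<ge> 0" using \<theta>(1) wx_pos[OF w] wy_pos[OF w] by linarith
    have q: "q w \<ge> 0" by (auto simp: q_def intro: sum_nonneg)
    have L: "(\<Sum>i<2*k. (\<phi> (edges w ! i))\<^sup>2 * \<delta> (edges w ! i)) * (\<Sum>i<2*k. \<delta> (edges w ! i))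
        \<ge> (l w)\<^sup>2 - \<kappa> / 2 * real (2 * k) * q w"
      unfolding q_def l_def
      by (rule commutator_lower_bound[OF _ _ \<kappa>0]) (auto intro!: \<kappa> edge_close[OF w] less_imp_le[OF \<phi>])
    \<comment> \<open>\<theta> is bounded below by the minimum in front of the square and above by
      the sum in front of the commutator.\<close>
    have "min (wx w) (wy w) / 2 * (l w)\<^sup>2 - real k * \<kappa> / 2 * ((wx w + wy w) * q w)
        \<le> \<theta> / 2 * (l w)\<^sup>2 - real k * \<kappa> / 2 * (\<theta> * q w)"
      using \<theta>(1,2) q \<kappa>0 by (intro diff_mono mult_left_mono mult_right_mono) auto
    also have "\<dots> = \<theta> / 2 * ((l w)\<^sup>2 - \<kappa> / 2 * real (2 * k) * q w)" by (simp add: algebra_simps)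
    also have "\<dots> \<le> \<theta> / 2 * ((\<Sum>i<2*k. (\<phi> (edges w ! i))\<^sup>2 * \<delta> (edges w ! i)) * (\<Sum>i<2*k. \<delta> (edges w ! i)))"
      using L \<theta>0 by (intro mult_left_mono) auto
    also have "\<dots> = (\<Sum>e\<leftarrow>edges w. (\<phi> e)\<^sup>2 * \<delta> e) * (wx w - wy w)"
      unfolding \<theta>(3) sum_list_edges[OF w] by simp
    finally show ?thesis .
  qed
  have inj: "inj_on z S"
  proof (rule inj_onI)
    fix n n' assume "z n = z n'"
    then have "z n ! 0 = z n' ! 0" by simp
    then show "n = n'" using k by (simp add: z_def)
  qed
  have zw: "z n \<in> walks" "edges (z n) = replicate (2 * k) n" if "n \<in> S" for n
  proof -
    have "n \<ge> 1" "n \<le> Max (insert 0 S) + 2 * k" using that S1 finS by (auto intro: trans_le_add1)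
    from zigzag_walk[OF this k] show "z n \<in> walks" "edges (z n) = replicate (2 * k) n"
      by (simp_all add: z_def walks_def)
  qed
  have "(\<Sum>n\<in>S. min (x n ^ k) (y n ^ k) / 2 * (2 * real k * (\<phi> n * \<delta> n))\<^sup>2)
      = (\<Sum>w\<in>z ` S. min (wx w) (wy w) / 2 * (l w)\<^sup>2)"
  proof (subst sum.reindex[OF inj], intro sum.cong refl)
    fix n assume n: "n \<in> S"
    have "wx (z n) = x n ^ k" "wy (z n) = y n ^ k"
      unfolding wx_def wy_def zw(2)[OF n]
      by (simp_all add: prod_list_replicate power_mult x_nonneg y_nonneg)
    moreover have "l (z n) = 2 * real k * (\<phi> n * \<delta> n)"
      unfolding l_def zw(2)[OF n] by simp
    ultimately show "min (x n ^ k) (y n ^ k) / 2 * (2 * real k * (\<phi> n * \<delta> n))\<^sup>2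
      = ((\<lambda>w. min (wx w) (wy w) / 2 * (l w)\<^sup>2) \<circ> z) n" by simp
  qed
  \<comment> \<open>Every other walk contributes a nonnegative square and is dropped.\<close>
  also have "\<dots> \<le> (\<Sum>w\<in>walks. min (wx w) (wy w) / 2 * (l w)\<^sup>2)"
    by (rule sum_mono2[OF finw]) (auto simp: zw intro!: mult_nonneg_nonneg less_imp_le[OF wx_pos] less_imp_le[OF wy_pos])
  finally have A: "(\<Sum>n\<in>S. min (x n ^ k) (y n ^ k) / 2 * (2 * real k * (\<phi> n * \<delta> n))\<^sup>2)
      \<le> (\<Sum>w\<in>walks. min (wx w) (wy w) / 2 * (l w)\<^sup>2)" .
  have m: "min (x n ^ k) (y n ^ k) = (min (x n) (y n)) ^ k" for n
    using power_mono[OF _ x_nonneg, of n "y n" k] power_mono[OF _ y_nonneg, of n "x n" k]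
    by (auto simp: min_def)
  have B: "(\<Sum>w\<in>walks. (wx w + wy w) * q w)
     = 4 * real k * (\<Sum>n\<in>S. (\<phi> n)\<^sup>2 * (\<delta> n)\<^sup>2 * (F x k n + F y k n))"
    unfolding q_def by (rule sum_squares)
  have "4 * real k * (real k / 2 * (\<Sum>n\<in>S. (\<phi> n)\<^sup>2 * (\<delta> n)\<^sup>2 * (min (x n) (y n)) ^ k)
      - real k * \<kappa> / 2 * (\<Sum>n\<in>S. (\<phi> n)\<^sup>2 * (\<delta> n)\<^sup>2 * (F x k n + F y k n)))
     = (\<Sum>n\<in>S. min (x n ^ k) (y n ^ k) / 2 * (2 * real k * (\<phi> n * \<delta> n))\<^sup>2)
      - real k * \<kappa> / 2 * (\<Sum>w\<in>walks. (wx w + wy w) * q w)"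
    unfolding B right_diff_distrib m
    by (simp add: sum_distrib_left power_mult_distrib power2_eq_square mult_ac)
  also have "\<dots> \<le> (\<Sum>w\<in>walks. min (wx w) (wy w) / 2 * (l w)\<^sup>2 - real k * \<kappa> / 2 * ((wx w + wy w) * q w))"
    unfolding sum_subtractf sum_distrib_left[symmetric] using A by simp
  also have "\<dots> \<le> 4 * real k * (\<Sum>n\<in>S. (\<phi> n)\<^sup>2 * \<delta> n * (F x k n - F y k n))"
    unfolding sum_difference by (intro sum_mono each)
  finally show ?thesis using k by (simp add: mult_le_cancel_left_pos)
qed

end

section \<open>The energy estimate\<close>

text \<open>The shift to \<open>n + 1\<close> keeps the scale positive at \<open>n = 0\<close>.\<close>

definition rscale :: "nat \<Rightarrow> nat \<Rightarrow> real" where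
  "rscale m n = real (Suc n) powr (1 / real m)"

definition hierarchy :: "nat \<Rightarrow> (nat \<Rightarrow> real) \<Rightarrow> (nat \<Rightarrow> real) \<Rightarrow> nat \<Rightarrow> real" where
  "hierarchy m t \<beta> n = (\<Sum>k=1..m. 2 * real k * t k * F \<beta> k n)"

lemma rscale_pos: "rscale m n > 0" and rscale_ge_1: "rscale m n \<ge> 1"
  by (auto simp: rscale_def intro: ge_one_powr_ge_zero)

lemma rscale_mono: "n \<le> n' \<Longrightarrow> rscale m n \<le> rscale m n'"
  unfolding rscale_def by (intro powr_mono2) auto

lemma rscale_power: "m \<ge> 1 \<Longrightarrow> rscale m n ^ m = real (Suc n)"
  unfolding rscale_def by (subst powr_power) auto

lemma rscale_Suc_le:
  assumes "m \<ge> 1"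
  shows "rscale m (Suc n) \<le> 2 * rscale m n"
proof -
  have "rscale m (Suc n) ^ m \<le> (2 * rscale m n) ^ m"
  proof -
    have "rscale m (Suc n) ^ m \<le> 2 ^ 1 * rscale m n ^ m" unfolding rscale_power[OF assms] by simp
    also have "\<dots> \<le> 2 ^ m * rscale m n ^ m" using assms rscale_pos[of m n]
      by (intro mult_right_mono power_increasing) auto
    finally show ?thesis by (simp add: power_mult_distrib)
  qed
  then show ?thesis
    by (subst (asm) power_mono_iff) (use less_imp_le[OF rscale_pos] rscale_pos[of m n] assms in auto)
qed

lemma F_scale_bound:
  assumes "m \<ge> 1" "C \<ge> 0"
  shows "\<exists>D. (\<forall>k. D k \<ge> 0) \<and> (\<forall>\<beta> k n. \<beta> 0 = 0 \<longrightarrow> (\<forall>n\<ge>1. 0 < \<beta> n \<and> \<beta> n \<le> C * rscale m n)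
    \<longrightarrow> 0 \<le> F \<beta> k n \<and> F \<beta> k n \<le> D k * rscale m n ^ k)"
proof -
  have "\<forall>k. \<exists>D\<ge>0. \<forall>\<beta> n. \<beta> 0 = 0 \<longrightarrow> (\<forall>n. 0 \<le> \<beta> n \<and> \<beta> n \<le> C * rscale m n) \<longrightarrow> F \<beta> k n \<le> D * rscale m n ^ k"
    by (intro allI F_upper_bound)
      (auto intro: less_imp_le[OF rscale_pos] rscale_mono rscale_Suc_le assms)
  then obtain D where D: "\<And>k. D k \<ge> 0" "\<And>k \<beta> n. \<beta> 0 = 0 \<Longrightarrow> (\<forall>n. 0 \<le> \<beta> n \<and> \<beta> n \<le> C * rscale m n)
    \<Longrightarrow> F \<beta> k n \<le> D k * rscale m n ^ k" by metis
  have "0 \<le> F \<beta> k n \<and> F \<beta> k n \<le> D k * rscale m n ^ k"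
    if "\<beta> 0 = 0" "\<forall>n\<ge>1. 0 < \<beta> n \<and> \<beta> n \<le> C * rscale m n" for \<beta> k n
  proof -
    have "0 \<le> \<beta> n \<and> \<beta> n \<le> C * rscale m n" for n
      using that assms(2) less_imp_le[OF rscale_pos[of m n]] by (cases n) (auto simp: less_imp_le)
    then show ?thesis using D(2)[of \<beta> k n] F_nonneg[where \<beta> = \<beta>] that(1) by blast
  qed
  then show ?thesis using D(1) by blast
qed

text \<open>Over a distance K the exponent changes by at most K \<epsilon> <= ln (1 + s), so the
  weight changes at most by the factor 1 + s. The commutator constant is then s^2, which a slow rate
  \<epsilon> makes as small as required.\<close>

lemma exp_weight_close:
  fixes N :: real and i j K :: nat
  assumes s: "0 \<le> s" and K: "real K * \<epsilon> \<le> ln (1 + s)" and \<epsilon>: "\<epsilon> \<ge> 0"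
    and ij: "i \<le> j + K" "j \<le> i + K"
  defines "\<phi> \<equiv> \<lambda>i. exp (- \<epsilon> * \<bar>real i - N\<bar>)"
  shows "\<phi> i \<le> (1 + s) * \<phi> j" "(\<phi> i - \<phi> j)\<^sup>2 \<le> s\<^sup>2 * (\<phi> i * \<phi> j)"
proof -
  have *: "\<phi> i \<le> (1 + s) * \<phi> j" if ij: "i \<le> j + K" "j \<le> i + K" for i j
  proof -
    have "\<bar>real j - N\<bar> \<le> \<bar>real i - N\<bar> + real K" using ij by linarith
    from mult_left_mono[OF this \<epsilon>]
    have "- \<epsilon> * \<bar>real i - N\<bar> \<le> ln (1 + s) + - \<epsilon> * \<bar>real j - N\<bar>" using K by (simp add: algebra_simps)
    then have "\<phi> i \<le> exp (ln (1 + s) + - \<epsilon> * \<bar>real j - N\<bar>)" by (simp add: \<phi>_def)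
    also have "\<dots> = (1 + s) * \<phi> j" using s unfolding exp_add by (simp add: \<phi>_def)
    finally show ?thesis .
  qed
  show "\<phi> i \<le> (1 + s) * \<phi> j" using * ij by blast
  have sq: "(\<phi> i - \<phi> j)\<^sup>2 \<le> s\<^sup>2 * (\<phi> i * \<phi> j)" if "\<phi> j \<le> \<phi> i" "\<phi> i \<le> (1 + s) * \<phi> j" for i j
  proof -
    have p: "\<phi> j > 0" by (simp add: \<phi>_def)
    have "(\<phi> i - \<phi> j)\<^sup>2 \<le> (s * \<phi> j)\<^sup>2" using that by (intro power_mono) (auto simp: algebra_simps)
    also have "\<dots> = s\<^sup>2 * (\<phi> j * \<phi> j)" by (simp add: power2_eq_square mult_ac)
    also have "\<dots> \<le> s\<^sup>2 * (\<phi> i * \<phi> j)" using that p by (intro mult_left_mono mult_right_mono) auto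
    finally show ?thesis .
  qed
  show "(\<phi> i - \<phi> j)\<^sup>2 \<le> s\<^sup>2 * (\<phi> i * \<phi> j)"
    using sq[of j i] sq[of i j] *[OF ij] *[OF ij(2,1)]
    by (cases "\<phi> j \<le> \<phi> i") (auto simp: power2_commute mult.commute)
qed

text \<open>The constants do not depend on the sequences or on the set where they differ; the lower order
  terms of the hierarchy are absorbed because they are smaller by the factor \<open>rscale m n0\<close>.\<close>

theorem energy_estimate:
  assumes m: "m \<ge> 1" and tm: "t m > 0" and c: "c > 0" and C: "C \<ge> 0"
  shows "\<exists>\<epsilon>>0. \<exists>Q\<ge>0. \<exists>n0\<ge>1. \<forall>x y N S.
    x 0 = 0 \<longrightarrow> y 0 = 0 \<longrightarrow> (\<forall>n\<ge>1. c * rscale m n \<le> x n \<and> x n \<le> C * rscale m n) \<longrightarrow>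
    (\<forall>n\<ge>1. c * rscale m n \<le> y n \<and> y n \<le> C * rscale m n) \<longrightarrow>
    finite S \<longrightarrow> S \<subseteq> {n0..} \<longrightarrow> (\<forall>n. n \<notin> S \<longrightarrow> x n = y n) \<longrightarrow>
    (\<Sum>n\<in>S. (exp (- \<epsilon> * \<bar>real n - N\<bar>))\<^sup>2 * (ln (x n) - ln (y n))\<^sup>2 * real (Suc n))
    \<le> Q * (\<Sum>n\<in>S. (exp (- \<epsilon> * \<bar>real n - N\<bar>))\<^sup>2 * (hierarchy m t x n - hierarchy m t y n)\<^sup>2 / real (Suc n))"
proof -
  from F_scale_bound[OF m C] obtain D where D: "\<And>k. D k \<ge> 0"
    and DF: "\<And>\<beta> k n. \<beta> 0 = 0 \<Longrightarrow> (\<forall>n\<ge>1. 0 < \<beta> n \<and> \<beta> n \<le> C * rscale m n)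
      \<Longrightarrow> 0 \<le> F \<beta> k n \<and> F \<beta> k n \<le> D k * rscale m n ^ k" by blast
  \<comment> \<open>Chosen so that the commutator costs at most half of the coercive term, whose
    constant is c ^ m; D m + 1 avoids a zero denominator.\<close>
  define s where "s = min 1 (c ^ m / (4 * (D m + 1)))"
  have s: "s > 0" "s \<le> 1" "s * (D m) \<le> c ^ m / 4"
  proof -
    show "s > 0" "s \<le> 1" using c D[of m] by (auto simp: s_def)
    have "s * D m \<le> s * (D m + 1)" using \<open>s > 0\<close> by simp
    also have "\<dots> \<le> c ^ m / (4 * (D m + 1)) * (D m + 1)"
      using D[of m] by (intro mult_right_mono) (auto simp: s_def)
    also have "\<dots> = c ^ m / 4" using D[of m] by (simp add: field_simps)
    finally show "s * (D m) \<le> c ^ m / 4" .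
  qed
  \<comment> \<open>Two edges of a closed walk of length 2 k differ by at most 4 k <= 4 m.\<close>
  define \<epsilon> where "\<epsilon> = ln (1 + s) / (4 * real m)"
  have \<epsilon>: "\<epsilon> > 0" using s m by (simp add: \<epsilon>_def)
  \<comment> \<open>The leading term is coercive with constant 2 g. One g is spent on the terms k <
    m, and half of the other on the inequality of arithmetic and geometric means at the end.\<close>
  define g where "g = (real m)\<^sup>2 * t m * c ^ m / 4"
  have g: "g > 0" using m tm c by (simp add: g_def)
  \<comment> \<open>The factors are 2 k from the hierarchy, k (1 + 4) / 2 from the upper bound with
    \<Lambda> = 4, and 2 D k from bounding the sum of both F.\<close>
  define G where "G = (\<Sum>k\<in>{1..<m}. 10 * (real k)\<^sup>2 * \<bar>t k\<bar> * D k)"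
  have G: "G \<ge> 0" unfolding G_def using D by (intro sum_nonneg) auto
  obtain n1 :: nat where n1: "real n1 \<ge> (G / g) ^ m" using real_arch_simple by blast
  define n0 where "n0 = max n1 1"
  have Gn0: "G \<le> g * rscale m n0"
  proof (rule ccontr)
    assume "\<not> ?thesis"
    then have "rscale m n0 \<le> G / g" using g by (simp add: field_simps)
    then have "rscale m n0 ^ m \<le> (G / g) ^ m" by (intro power_mono less_imp_le[OF rscale_pos]) auto
    then show False using n1 by (simp add: rscale_power[OF m] n0_def)
  qed
  show ?thesis
  proof (rule exI[of _ \<epsilon>], rule conjI[OF \<epsilon>], rule exI[of _ "1 / g\<^sup>2"], rule conjI, simp,
      rule exI[of _ n0], rule conjI, simp add: n0_def, intro allI impI)
    fix x y :: "nat \<Rightarrow> real" and N :: real and S :: "nat set"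
    assume x0: "x 0 = 0" and y0: "y 0 = 0"
      and xb: "\<forall>n\<ge>1. c * rscale m n \<le> x n \<and> x n \<le> C * rscale m n"
      and yb: "\<forall>n\<ge>1. c * rscale m n \<le> y n \<and> y n \<le> C * rscale m n"
      and finS: "finite S" and S: "S \<subseteq> {n0..}" and xy: "\<forall>n. n \<notin> S \<longrightarrow> x n = y n"
    define \<phi> where "\<phi> = (\<lambda>n. exp (- \<epsilon> * \<bar>real n - N\<bar>))"
    define \<delta> where "\<delta> = (\<lambda>n. ln (x n) - ln (y n))"
    have cs: "c * rscale m n > 0" for n using c rscale_pos[of m n] by simp
    have xp: "x n > 0" and yp: "y n > 0" if "n \<ge> 1" for n
      using xb yb that cs[of n] by (meson less_le_trans)+
    have Fx: "0 \<le> F x k n \<and> F x k n \<le> D k * rscale m n ^ k"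
      and Fy: "0 \<le> F y k n \<and> F y k n \<le> D k * rscale m n ^ k" for k n
      using DF[of x k n] DF[of y k n] x0 y0 xp yp xb yb by blast+
    have ld: "log_difference x y S \<delta> \<phi> k" if "k \<ge> 1" for k
      by unfold_locales (use x0 y0 xp yp finS S xy that in \<open>auto simp: \<delta>_def \<phi>_def n0_def\<close>)
    have K: "real (4 * k) * \<epsilon> \<le> ln (1 + s)" if "k \<le> m" for k
    proof -
      have "real (4 * k) * \<epsilon> \<le> real (4 * m) * \<epsilon>" using \<epsilon> that by (intro mult_right_mono) auto
      then show ?thesis using m by (simp add: \<epsilon>_def)
    qed
    have cl1: "\<phi> i \<le> (1 + s) * \<phi> j" if "k \<le> m" "i \<le> j + 4 * k" "j \<le> i + 4 * k" for i j k
      unfolding \<phi>_def by (rule exp_weight_close(1)[OF _ K[OF that(1)] _ that(2,3)]) (use s \<epsilon> in auto)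
    define e where "e = (\<lambda>n. (\<phi> n)\<^sup>2 * (\<delta> n)\<^sup>2)"
    have e: "e n \<ge> 0" for n by (simp add: e_def)
    define En where "En = (\<Sum>n\<in>S. e n * real (Suc n))"
    have En: "En \<ge> 0" unfolding En_def by (intro sum_nonneg mult_nonneg_nonneg e) auto
    define L where "L = (\<lambda>k. \<Sum>n\<in>S. (\<phi> n)\<^sup>2 * \<delta> n * (F x k n - F y k n))"
    have Fsum: "(\<Sum>n\<in>S. e n * (F x k n + F y k n)) \<le> 2 * D k * (\<Sum>n\<in>S. e n * rscale m n ^ k)" for k
      unfolding sum_distrib_left
    proof (intro sum_mono)
      fix n
      have "e n * (F x k n + F y k n) \<le> e n * (2 * (D k * rscale m n ^ k))"
        using Fx[of k n] Fy[of k n] by (intro mult_left_mono e) auto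
      then show "e n * (F x k n + F y k n) \<le> 2 * D k * (e n * rscale m n ^ k)" by (simp add: mult_ac)
    qed
    have cl: "(\<phi> i - \<phi> j)\<^sup>2 \<le> s\<^sup>2 * (\<phi> i * \<phi> j)" if "i \<le> j + 4 * m" "j \<le> i + 4 * m" for i j
      unfolding \<phi>_def by (rule exp_weight_close(2)[OF _ K[OF order_refl] _ that]) (use s \<epsilon> in auto)
    have Lm: "L m \<ge> real m / 4 * c ^ m * En"
    proof -
      have "real m / 2 * (\<Sum>n\<in>S. e n * (min (x n) (y n)) ^ m) - real m * s\<^sup>2 / 2 * (\<Sum>n\<in>S. e n * (F x m n + F y m n)) \<le> L m"
        unfolding L_def e_def
        by (rule log_difference.difference_lower_bound[OF ld[OF m]]) (use cl in auto)
      moreover have "c ^ m * En \<le> (\<Sum>n\<in>S. e n * (min (x n) (y n)) ^ m)"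
        unfolding En_def sum_distrib_left
      proof (intro sum_mono)
        fix n assume "n \<in> S"
        then have n: "n \<ge> 1" using S by (auto simp: n0_def)
        have "(c * rscale m n) ^ m \<le> (min (x n) (y n)) ^ m"
          using xb yb n cs[of n] by (intro power_mono) (auto simp: less_imp_le)
        then have "e n * (c * rscale m n) ^ m \<le> e n * (min (x n) (y n)) ^ m"
          by (intro mult_left_mono e)
        then show "c ^ m * (e n * real (Suc n)) \<le> e n * (min (x n) (y n)) ^ m"
          by (simp only: power_mult_distrib rscale_power[OF m] mult_ac)
      qed
      moreover have "s\<^sup>2 * (\<Sum>n\<in>S. e n * (F x m n + F y m n)) \<le> c ^ m / 2 * En"
      proof -
        have "s\<^sup>2 * (\<Sum>n\<in>S. e n * (F x m n + F y m n)) \<le> s\<^sup>2 * (2 * D m * En)"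
          using Fsum[of m] by (intro mult_left_mono) (auto simp: rscale_power[OF m] En_def)
        also have "\<dots> = s * (s * D m) * (2 * En)" by (simp add: power2_eq_square)
        also have "\<dots> \<le> 1 * (c ^ m / 4) * (2 * En)"
          using s En D[of m] by (intro mult_right_mono mult_mono) auto
        finally show ?thesis by (simp add: mult.commute)
      qed
      ultimately have "real m / 2 * (c ^ m * En) - real m / 2 * (c ^ m / 2 * En) \<le> L m"
        using mult_left_mono[of "c ^ m * En" _ "real m / 2"] mult_left_mono[of _ "c ^ m / 2 * En" "real m / 2"]
        by (smt (verit) divide_nonneg_nonneg of_nat_0_le_iff times_divide_eq_left mult.assoc)
      then show ?thesis by (simp add: field_simps)
    qed
    have Lk: "\<bar>2 * real k * t k * L k\<bar> \<le> 10 * (real k)\<^sup>2 * \<bar>t k\<bar> * D k * (En / rscale m n0)"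
      if k: "k \<in> {1..<m}" for k
    proof -
      have "\<bar>L k\<bar> \<le> real k * (1 + 4) / 2 * (\<Sum>n\<in>S. e n * (F x k n + F y k n))"
        unfolding L_def e_def
      proof (rule log_difference.difference_upper_bound[OF ld])
        fix i j :: nat assume "i \<le> j + 4 * k" "j \<le> i + 4 * k"
        then have "\<phi> i \<le> (1 + s) * \<phi> j" using k by (intro cl1[of k]) auto
        also have "\<dots> \<le> 2 * \<phi> j" using s by (intro mult_right_mono) (auto simp: \<phi>_def)
        finally have "(\<phi> i)\<^sup>2 \<le> (2 * \<phi> j)\<^sup>2" by (intro power_mono) (auto simp: \<phi>_def)
        then show "(\<phi> i)\<^sup>2 \<le> 4 * (\<phi> j)\<^sup>2" by (simp add: power_mult_distrib)
      qed (use k in auto)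
      also have "\<dots> \<le> real k * (1 + 4) / 2 * (2 * D k * (En / rscale m n0))"
      proof (intro mult_left_mono order_trans[OF Fsum])
        show "(\<Sum>n\<in>S. e n * rscale m n ^ k) \<le> En / rscale m n0"
          unfolding En_def sum_divide_distrib
        proof (intro sum_mono)
          fix n assume "n \<in> S"
          then have "rscale m n0 \<le> rscale m n" using S by (intro rscale_mono) auto
          then have "rscale m n ^ k * rscale m n0 \<le> rscale m n ^ k * rscale m n"
            using rscale_pos[of m n] by (intro mult_left_mono) auto
          also have "\<dots> = rscale m n ^ Suc k" by simp
          also have "\<dots> \<le> rscale m n ^ m" using k rscale_ge_1[of m n] by (intro power_increasing) auto
          finally have "e n * (rscale m n ^ k * rscale m n0) \<le> e n * real (Suc n)"
            using e by (intro mult_left_mono) (auto simp: rscale_power[OF m])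
          then show "e n * rscale m n ^ k \<le> e n * real (Suc n) / rscale m n0"
            using rscale_pos[of m n0] by (simp add: field_simps)
        qed
      qed (use D in auto)
      finally have "2 * real k * \<bar>t k\<bar> * \<bar>L k\<bar> \<le> 2 * real k * \<bar>t k\<bar> * (real k * (1 + 4) / 2 * (2 * D k * (En / rscale m n0)))"
        by (intro mult_left_mono) auto
      then show ?thesis by (simp add: abs_mult power2_eq_square mult_ac)
    qed
    define R where "R = (\<lambda>n. hierarchy m t x n - hierarchy m t y n)"
    have "(\<Sum>n\<in>S. (\<phi> n)\<^sup>2 * \<delta> n * R n) = (\<Sum>k=1..m. 2 * real k * t k * L k)"
    proof -
      have R: "R n = (\<Sum>k=1..m. 2 * real k * t k * (F x k n - F y k n))" for n
        by (simp add: R_def hierarchy_def sum_subtractf right_diff_distrib)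
      show ?thesis
        unfolding R L_def sum_distrib_left by (subst sum.swap) (simp add: mult_ac)
    qed
    also have "\<dots> = 2 * real m * t m * L m + (\<Sum>k\<in>{1..<m}. 2 * real k * t k * L k)"
    proof -
      have "{1..m} = insert m {1..<m}" using m by auto
      then show ?thesis by simp
    qed
    also have "\<dots> \<ge> 2 * g * En - g * En"
    proof -
      have "2 * real m * t m * (real m / 4 * c ^ m * En) \<le> 2 * real m * t m * L m"
        using Lm tm by (intro mult_left_mono) auto
      then have 1: "2 * g * En \<le> 2 * real m * t m * L m" by (simp add: g_def power2_eq_square mult_ac)
      have "\<bar>\<Sum>k\<in>{1..<m}. 2 * real k * t k * L k\<bar> \<le> G * (En / rscale m n0)"
        unfolding G_def sum_distrib_right by (intro order_trans[OF sum_abs] sum_mono Lk)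
      also have "\<dots> = En * (G / rscale m n0)" by simp
      also have "\<dots> \<le> En * g"
        using Gn0 En rscale_pos[of m n0] by (intro mult_left_mono) (auto simp: field_simps)
      finally show ?thesis using 1 mult.commute[of En g] by linarith
    qed
    finally have low: "g * En \<le> (\<Sum>n\<in>S. (\<phi> n)\<^sup>2 * \<delta> n * R n)" by linarith
    also have "\<dots> \<le> (\<Sum>n\<in>S. g / 2 * (e n * real (Suc n)) + 1 / (2 * g) * ((\<phi> n)\<^sup>2 * (R n)\<^sup>2 / real (Suc n)))"
    proof (intro sum_mono)
      fix n
      have am: "2 * (p * q) \<le> p\<^sup>2 * z + q\<^sup>2 / z" if "z > 0" for p q z :: real
      proof -
        have "0 \<le> (p * z - q)\<^sup>2 / z" using that by simp
        also have "\<dots> = p\<^sup>2 * z + q\<^sup>2 / z - 2 * (p * q)"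
          using that by (simp add: power2_eq_square field_simps)
        finally show ?thesis by simp
      qed
      define v where "v = real (Suc n)"
      have v: "v > 0" by (simp add: v_def)
      have "(\<phi> n)\<^sup>2 * (2 * (\<delta> n * R n)) \<le> (\<phi> n)\<^sup>2 * ((\<delta> n)\<^sup>2 * (g * v) + (R n)\<^sup>2 / (g * v))"
        using g v by (intro mult_left_mono am mult_pos_pos) auto
      then have "(\<phi> n)\<^sup>2 * \<delta> n * R n \<le> (\<phi> n)\<^sup>2 * ((\<delta> n)\<^sup>2 * (g * v) + (R n)\<^sup>2 / (g * v)) / 2"
        by (simp add: mult_ac)
      also have "\<dots> = g / 2 * (e n * v) + 1 / (2 * g) * ((\<phi> n)\<^sup>2 * (R n)\<^sup>2 / v)"
        using g v by (simp add: e_def field_simps)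
      finally show "(\<phi> n)\<^sup>2 * \<delta> n * R n \<le> g / 2 * (e n * real (Suc n)) + 1 / (2 * g) * ((\<phi> n)\<^sup>2 * (R n)\<^sup>2 / real (Suc n))"
        by (simp only: v_def)
    qed
    also have "\<dots> = g / 2 * En + 1 / (2 * g) * (\<Sum>n\<in>S. (\<phi> n)\<^sup>2 * (R n)\<^sup>2 / real (Suc n))"
      by (simp add: En_def sum.distrib sum_distrib_left)
    finally have "En \<le> 1 / g\<^sup>2 * (\<Sum>n\<in>S. (\<phi> n)\<^sup>2 * (R n)\<^sup>2 / real (Suc n))"
      using g by (simp add: field_simps power2_eq_square)
    then show "(\<Sum>n\<in>S. (exp (- \<epsilon> * \<bar>real n - N\<bar>))\<^sup>2 * (ln (x n) - ln (y n))\<^sup>2 * real (Suc n))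
    \<le> 1 / g\<^sup>2 * (\<Sum>n\<in>S. (exp (- \<epsilon> * \<bar>real n - N\<bar>))\<^sup>2 * (hierarchy m t x n - hierarchy m t y n)\<^sup>2 / real (Suc n))"
      by (simp add: En_def e_def R_def \<phi>_def \<delta>_def)
  qed
qed

section \<open>From the weighted energy to a pointwise bound\<close>

lemma polynomial_exp_bounded:
  assumes "\<epsilon> > (0::real)" "a \<ge> 0"
  shows "\<exists>M. \<forall>d::nat. (a + 1 + real d) powr p * exp (- \<epsilon> * real d) \<le> M"
proof -
  define q where "q = \<bar>p\<bar> + 1"
  have "((\<lambda>d::nat. (a + 1 + real d) powr q * exp (- \<epsilon> * real d)) \<longlongrightarrow> 0) sequentially"
    using assms unfolding q_def by real_asymp
  then have "Bseq (\<lambda>d::nat. (a + 1 + real d) powr q * exp (- \<epsilon> * real d))"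
    by (intro convergent_imp_Bseq) (auto simp: convergent_def)
  then obtain M where M: "\<And>d::nat. norm ((a + 1 + real d) powr q * exp (- \<epsilon> * real d)) \<le> M"
    by (auto simp: Bseq_def)
  have "(a + 1 + real d) powr p * exp (- \<epsilon> * real d) \<le> M" for d :: nat
  proof -
    have "(a + 1 + real d) powr p * exp (- \<epsilon> * real d) \<le> (a + 1 + real d) powr q * exp (- \<epsilon> * real d)"
      using assms by (intro mult_right_mono powr_mono) (auto simp: q_def)
    also have "\<dots> \<le> M" using M[of d] by simp
    finally show ?thesis .
  qed
  then show ?thesis by blast
qed

lemma powr_ratio_bound:
  fixes u v w p :: real
  assumes "u > 0" "v > 0" "w \<ge> 1" "u \<le> w * v" "v \<le> w * u"
  shows "u powr p \<le> v powr p * w powr \<bar>p\<bar>"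
proof (cases "p \<ge> 0")
  case True
  have "u powr p \<le> (w * v) powr p" using assms True by (intro powr_mono2) auto
  then show ?thesis using assms True by (simp add: powr_mult mult.commute)
next
  case False
  have "v powr (- p) \<le> (w * u) powr (- p)" using assms False by (intro powr_mono2) auto
  then show ?thesis using assms False by (simp add: powr_mult powr_minus field_simps)
qed

lemma sum_exp_dist_le:
  fixes N :: nat
  assumes "\<epsilon> > 0"
  shows "(\<Sum>n\<in>{a..2 * N}. exp (- \<epsilon> * \<bar>real n - real N\<bar>)) \<le> 2 / (1 - exp (- \<epsilon>))"
proof -
  let ?f = "\<lambda>n. exp (- \<epsilon> * \<bar>real n - real N\<bar>)"
  let ?q = "exp (- \<epsilon>)"
  have q: "?q < 1" "?q > 0" using assms by auto
  have geo: "(\<Sum>d\<in>D. ?q ^ d) \<le> 1 / (1 - ?q)" if "finite D" for D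
    using sum_le_suminf[of "\<lambda>d. ?q ^ d" D] suminf_geometric[of ?q] that q
    by (auto simp: summable_geometric)
  have e: "?f n = ?q ^ nat \<bar>int n - int N\<bar>" for n
    by (simp add: exp_of_nat_mult[symmetric] mult.commute)
  have "(\<Sum>n\<in>{a..2 * N}. ?f n) \<le> (\<Sum>n\<in>{..2 * N}. ?f n)"
    by (rule sum_mono2) auto
  also have "{..2 * N} = {..N} \<union> {N<..2 * N}" by auto
  also have "(\<Sum>n\<in>\<dots>. ?f n) = (\<Sum>n\<in>{..N}. ?f n) + (\<Sum>n\<in>{N<..2 * N}. ?f n)"
    by (rule sum.union_disjoint) auto
  also have "(\<Sum>n\<in>{..N}. ?f n) = (\<Sum>d\<in>(\<lambda>n. N - n) ` {..N}. ?q ^ d)"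
    unfolding e by (subst sum.reindex) (auto simp: inj_on_def intro!: sum.cong arg_cong2[where f = "(^)"])
  also have "\<dots> \<le> 1 / (1 - ?q)" by (rule geo) auto
  also have "(\<Sum>n\<in>{N<..2 * N}. ?f n) = (\<Sum>d\<in>(\<lambda>n. n - N) ` {N<..2 * N}. ?q ^ d)"
    unfolding e by (subst sum.reindex) (auto simp: inj_on_def intro!: sum.cong arg_cong2[where f = "(^)"])
  also have "\<dots> \<le> 1 / (1 - ?q)" by (rule geo) auto
  finally show ?thesis by simp
qed

text \<open>The energy estimate centred at N is applied to x and to z, which equals y on {n1..2 N}
  and x elsewhere, so that the two differ on a finite set. Inside this window the hierarchies of z
  and y differ only within distance m of the ends. The left end is fixed and costs a constant; at
  the right end the exponential weight beats every power of N.\<close>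

theorem approximate_solution_close:
  fixes x y :: "nat \<Rightarrow> real"
  assumes m: "m \<ge> 1" and tm: "t m > 0" and c: "c > 0" and C: "C \<ge> 0"
    and x0: "x 0 = 0" and xb: "\<And>n. n \<ge> 1 \<Longrightarrow> c * rscale m n \<le> x n \<and> x n \<le> C * rscale m n"
    and yb: "eventually (\<lambda>n. c * rscale m n \<le> y n \<and> y n \<le> C * rscale m n) sequentially"
    and res: "eventually (\<lambda>n. \<bar>hierarchy m t x n - hierarchy m t y n\<bar> \<le> M0 * real (Suc n) powr (1 - q)) sequentially"
  shows "\<exists>M. eventually (\<lambda>n. \<bar>ln (x n) - ln (y n)\<bar> \<le> M * real (Suc n) powr (- q)) sequentially"
proof -
  from F_scale_bound[OF m C] obtain D where D: "\<And>k. D k \<ge> 0"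
    and DF: "\<And>\<beta> k n. \<beta> 0 = 0 \<Longrightarrow> (\<forall>n\<ge>1. 0 < \<beta> n \<and> \<beta> n \<le> C * rscale m n)
      \<Longrightarrow> 0 \<le> F \<beta> k n \<and> F \<beta> k n \<le> D k * rscale m n ^ k" by blast
  from energy_estimate[where t = t and m = m, OF m tm c C] obtain \<epsilon> Q n0 where \<epsilon>: "\<epsilon> > 0" and Q: "Q \<ge> 0" and n0: "n0 \<ge> 1"
    and energy: "\<forall>x y N S.
    x 0 = 0 \<longrightarrow> y 0 = 0 \<longrightarrow> (\<forall>n\<ge>1. c * rscale m n \<le> x n \<and> x n \<le> C * rscale m n) \<longrightarrow>
    (\<forall>n\<ge>1. c * rscale m n \<le> y n \<and> y n \<le> C * rscale m n) \<longrightarrow>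
    finite S \<longrightarrow> S \<subseteq> {n0..} \<longrightarrow> (\<forall>n. n \<notin> S \<longrightarrow> x n = y n) \<longrightarrow>
    (\<Sum>n\<in>S. (exp (- \<epsilon> * \<bar>real n - N\<bar>))\<^sup>2 * (ln (x n) - ln (y n))\<^sup>2 * real (Suc n))
    \<le> Q * (\<Sum>n\<in>S. (exp (- \<epsilon> * \<bar>real n - N\<bar>))\<^sup>2 * (hierarchy m t x n - hierarchy m t y n)\<^sup>2 / real (Suc n))"
    by (elim exE conjE) (rule that)
  from eventually_conj[OF yb res] obtain n2 where
    n2: "\<And>n. n \<ge> n2 \<Longrightarrow> c * rscale m n \<le> y n \<and> y n \<le> C * rscale m n"
      "\<And>n. n \<ge> n2 \<Longrightarrow> \<bar>hierarchy m t x n - hierarchy m t y n\<bar> \<le> M0 * real (Suc n) powr (1 - q)"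
    by (auto simp: eventually_sequentially)
  define n1 where "n1 = max n0 n2"
  define D' where "D' = (\<Sum>k=1..m. 2 * real k * \<bar>t k\<bar> * D k)"
  have D': "D' \<ge> 0" unfolding D'_def using D by (intro sum_nonneg) auto
  \<comment> \<open>The second summand pays for the crude residual near the left end, where n < n1 +
    m.\<close>
  define M1 where "M1 = \<bar>M0\<bar> + D' * real (n1 + m + 1) powr \<bar>q\<bar>"
  \<comment> \<open>With this offset N + 1 <= a + 1 + d whenever n + m > 2 N, where d is the
    distance from n to N.\<close>
  define a where "a = real m"
  \<comment> \<open>Large enough for both cases below: |1 - 2 q| compares powers of n and N, and 1 +
    2 |q| trades powers of N for powers of u at the right end.\<close>
  define p where "p = \<bar>1 - 2 * q\<bar> + 1 + 2 * \<bar>q\<bar>"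
  obtain M4 where M4: "\<And>d::nat. (a + 1 + real d) powr p * exp (- \<epsilon> * real d) \<le> M4"
    using polynomial_exp_bounded[OF \<epsilon>, of a p] by (auto simp: a_def)
  define M3 where "M3 = (M1\<^sup>2 + 2 * D'\<^sup>2) * M4"
  define M where "M = Q * (M3 * (2 / (1 - exp (- \<epsilon>))))"
  have cs: "c * rscale m n > 0" for n using c rscale_pos[of m n] by simp
  have "\<bar>ln (x N) - ln (y N)\<bar> \<le> sqrt M * real (Suc N) powr (- q)" if N: "N \<ge> n1" for N
  proof -
    define S where "S = {n1..2 * N}"
    define z where "z = (\<lambda>n. if n \<in> S then y n else x n)"
    have n1: "n1 \<ge> 1" "n1 \<ge> n2" "n1 \<ge> n0" using n0 by (auto simp: n1_def)
    have z0: "z 0 = 0" using n1 x0 by (auto simp: z_def S_def)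
    have zb: "\<forall>n\<ge>1. c * rscale m n \<le> z n \<and> z n \<le> C * rscale m n"
      using xb n2(1) n1 by (auto simp: z_def S_def)
    have xb': "\<forall>n\<ge>1. c * rscale m n \<le> x n \<and> x n \<le> C * rscale m n" using xb by blast
    have Fb: "0 \<le> F x k n" "F x k n \<le> D k * rscale m n ^ k"
        "0 \<le> F z k n" "F z k n \<le> D k * rscale m n ^ k" for k n
    proof -
      have "\<forall>n\<ge>1. 0 < x n \<and> x n \<le> C * rscale m n" "\<forall>n\<ge>1. 0 < z n \<and> z n \<le> C * rscale m n"
        using xb' zb cs by (meson less_le_trans)+
      from DF[where \<beta> = x, OF x0 this(1)] DF[where \<beta> = z, OF z0 this(2)]
      show "0 \<le> F x k n" "F x k n \<le> D k * rscale m n ^ k"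
        "0 \<le> F z k n" "F z k n \<le> D k * rscale m n ^ k" by blast+
    qed
    define R where "R = (\<lambda>n. hierarchy m t x n - hierarchy m t z n)"
    have Rcrude: "\<bar>R n\<bar> \<le> D' * real (Suc n)" for n
    proof -
      have "R n = (\<Sum>k=1..m. 2 * real k * t k * (F x k n - F z k n))"
        by (simp add: R_def hierarchy_def sum_subtractf right_diff_distrib)
      also have "\<bar>\<dots>\<bar> \<le> (\<Sum>k=1..m. 2 * real k * \<bar>t k\<bar> * D k * real (Suc n))"
      proof (intro order_trans[OF sum_abs] sum_mono)
        fix k assume k: "k \<in> {1..m}"
        have "\<bar>F x k n - F z k n\<bar> \<le> D k * rscale m n ^ k" using Fb[of k n] by linarith
        also have "\<dots> \<le> D k * rscale m n ^ m"
          using k rscale_ge_1[of m n] D by (intro mult_left_mono power_increasing) auto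
        finally have "\<bar>F x k n - F z k n\<bar> \<le> D k * real (Suc n)" by (simp only: rscale_power[OF m])
        then have "2 * real k * \<bar>t k\<bar> * \<bar>F x k n - F z k n\<bar> \<le> 2 * real k * \<bar>t k\<bar> * (D k * real (Suc n))"
          by (intro mult_left_mono) auto
        then show "\<bar>2 * real k * t k * (F x k n - F z k n)\<bar> \<le> 2 * real k * \<bar>t k\<bar> * D k * real (Suc n)"
          by (simp only: abs_mult abs_of_nat abs_numeral mult.assoc)
      qed
      finally show ?thesis by (simp add: D'_def sum_distrib_right)
    qed
    have Rgood: "\<bar>R n\<bar> \<le> M1 * real (Suc n) powr (1 - q)" if n: "n \<in> S" "n + m \<le> 2 * N" for n
    proof (cases "n1 + m \<le> n")
      case True
      have "F z k n = F y k n" if "k \<in> {1..m}" for k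
        by (rule F_cong) (use that True n in \<open>auto simp: z_def S_def\<close>)
      then have "R n = hierarchy m t x n - hierarchy m t y n" by (simp add: R_def hierarchy_def)
      also have "\<bar>\<dots>\<bar> \<le> M0 * real (Suc n) powr (1 - q)" using n2(2)[of n] n n1 by (auto simp: S_def)
      also have "\<dots> \<le> M1 * real (Suc n) powr (1 - q)"
        using D' by (intro mult_right_mono) (auto simp: M1_def intro: order_trans[OF abs_ge_self])
      finally show ?thesis .
    next
      case False
      have "real (Suc n) powr q \<le> real (n1 + m + 1) powr \<bar>q\<bar>"
        using False powr_mono[of q "\<bar>q\<bar>" "real (Suc n)", OF abs_ge_self] powr_mono2[of "\<bar>q\<bar>" "real (Suc n)" "real (n1 + m + 1)"]
        by simp
      then have "D' * real (n1 + m + 1) powr \<bar>q\<bar> * real (Suc n) powr (1 - q)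
          \<ge> D' * real (Suc n) powr q * real (Suc n) powr (1 - q)"
        using D' by (intro mult_right_mono mult_left_mono) auto
      moreover have "D' * real (Suc n) powr q * real (Suc n) powr (1 - q) = D' * real (Suc n)"
        by (simp add: powr_add[symmetric] mult.assoc del: of_nat_Suc)
      moreover have "M1 * real (Suc n) powr (1 - q)
        = \<bar>M0\<bar> * real (Suc n) powr (1 - q) + D' * real (n1 + m + 1) powr \<bar>q\<bar> * real (Suc n) powr (1 - q)"
        by (simp add: M1_def algebra_simps)
      moreover have "\<bar>M0\<bar> * real (Suc n) powr (1 - q) \<ge> 0" by simp
      ultimately show ?thesis using Rcrude[of n] by linarith
    qed
    have summand: "(exp (- \<epsilon> * \<bar>real n - real N\<bar>))\<^sup>2 * (R n)\<^sup>2 / real (Suc n)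
        \<le> M3 * real (Suc N) powr (1 - 2 * q) * exp (- \<epsilon> * \<bar>real n - real N\<bar>)" if n: "n \<in> S" for n
    proof -
      define d where "d = nat \<bar>int n - int N\<bar>"
      have d: "real d = \<bar>real n - real N\<bar>" by (simp add: d_def)
      define u where "u = a + 1 + real d"
      have u1: "u \<ge> 1" and ud: "u \<ge> 1 + real d" by (auto simp: u_def a_def)
      have e2: "(exp (- \<epsilon> * \<bar>real n - real N\<bar>))\<^sup>2 = exp (- \<epsilon> * real d) * exp (- \<epsilon> * real d)"
        by (simp add: power2_eq_square d)
      have nN: "real (Suc n) \<le> u * real (Suc N)" "real (Suc N) \<le> u * real (Suc n)"
      proof -
        have "real (Suc n) \<le> real (Suc N) + real d" "real (Suc N) \<le> real (Suc n) + real d" using d by auto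
        moreover have "real (Suc N) + real d \<le> (1 + real d) * real (Suc N)"
          "real (Suc n) + real d \<le> (1 + real d) * real (Suc n)" by (auto simp: algebra_simps)
        moreover have "(1 + real d) * real (Suc N) \<le> u * real (Suc N)" "(1 + real d) * real (Suc n) \<le> u * real (Suc n)"
          using ud by (auto intro!: mult_right_mono)
        ultimately show "real (Suc n) \<le> u * real (Suc N)" "real (Suc N) \<le> u * real (Suc n)" by linarith+
      qed
      have "(R n)\<^sup>2 / real (Suc n) \<le> (M1\<^sup>2 + 2 * D'\<^sup>2) * (real (Suc N) powr (1 - 2 * q) * u powr p)"
      proof (cases "n + m \<le> 2 * N")
        case True
        have "(R n)\<^sup>2 \<le> (M1 * real (Suc n) powr (1 - q))\<^sup>2"
          using Rgood[OF n True] by (metis abs_ge_zero power2_abs power_mono)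
        also have "\<dots> = M1\<^sup>2 * real (Suc n) powr (2 - 2 * q)"
          by (simp add: power_mult_distrib powr_power algebra_simps)
        finally have "(R n)\<^sup>2 / real (Suc n) \<le> M1\<^sup>2 * real (Suc n) powr (2 - 2 * q) / real (Suc n)"
          by (intro divide_right_mono) auto
        also have "\<dots> = M1\<^sup>2 * real (Suc n) powr (1 - 2 * q)"
          using powr_diff[of "real (Suc n)" "2 - 2 * q" 1] by simp
        also have "\<dots> \<le> M1\<^sup>2 * (real (Suc N) powr (1 - 2 * q) * u powr p)"
        proof (intro mult_left_mono)
          have "real (Suc n) powr (1 - 2 * q) \<le> real (Suc N) powr (1 - 2 * q) * u powr \<bar>1 - 2 * q\<bar>"
            by (rule powr_ratio_bound) (use nN u1 in auto)
          also have "\<dots> \<le> real (Suc N) powr (1 - 2 * q) * u powr p"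
            using u1 by (intro mult_left_mono powr_mono) (auto simp: p_def)
          finally show "real (Suc n) powr (1 - 2 * q) \<le> real (Suc N) powr (1 - 2 * q) * u powr p" .
        qed auto
        also have "\<dots> \<le> (M1\<^sup>2 + 2 * D'\<^sup>2) * (real (Suc N) powr (1 - 2 * q) * u powr p)"
          by (intro mult_right_mono) auto
        finally show ?thesis .
      next
        case False
        then have Nu: "real (Suc N) \<le> u" using d by (auto simp: u_def a_def)
        have "(R n)\<^sup>2 \<le> (D' * real (Suc n))\<^sup>2"
          using Rcrude[of n] by (metis abs_ge_zero power2_abs power_mono)
        then have "(R n)\<^sup>2 / real (Suc n) \<le> (D' * real (Suc n))\<^sup>2 / real (Suc n)"
          by (intro divide_right_mono) auto
        also have "\<dots> = D'\<^sup>2 * real (Suc n)" by (simp add: power2_eq_square)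
        also have "\<dots> \<le> D'\<^sup>2 * (u * real (Suc N))" using nN by (intro mult_left_mono) auto
        also have "real (Suc N) = real (Suc N) powr (1 - 2 * q) * real (Suc N) powr (2 * q)"
          by (simp add: powr_add[symmetric] del: of_nat_Suc)
        also have "D'\<^sup>2 * (u * (real (Suc N) powr (1 - 2 * q) * real (Suc N) powr (2 * q)))
            \<le> D'\<^sup>2 * (u powr 1 * (real (Suc N) powr (1 - 2 * q) * u powr (2 * \<bar>q\<bar>)))"
        proof -
          have "real (Suc N) powr (2 * q) \<le> real (Suc N) powr (2 * \<bar>q\<bar>)"
            by (intro powr_mono) auto
          also have "\<dots> \<le> u powr (2 * \<bar>q\<bar>)" using Nu by (intro powr_mono2) auto
          finally show ?thesis using u1 by (intro mult_left_mono) auto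
        qed
        also have "\<dots> = D'\<^sup>2 * (real (Suc N) powr (1 - 2 * q) * u powr (1 + 2 * \<bar>q\<bar>))"
          by (simp add: powr_add mult_ac)
        also have "\<dots> \<le> D'\<^sup>2 * (real (Suc N) powr (1 - 2 * q) * u powr p)"
          using u1 by (intro mult_left_mono powr_mono) (auto simp: p_def)
        also have "\<dots> \<le> (M1\<^sup>2 + 2 * D'\<^sup>2) * (real (Suc N) powr (1 - 2 * q) * u powr p)"
          by (intro mult_right_mono) auto
        finally show ?thesis .
      qed
      \<comment> \<open>One of the two exponential factors absorbs the power of u, the other makes
        the sum over n converge.\<close>
      then have "exp (- \<epsilon> * real d) * exp (- \<epsilon> * real d) * ((R n)\<^sup>2 / real (Suc n))
        \<le> exp (- \<epsilon> * real d) * exp (- \<epsilon> * real d) * ((M1\<^sup>2 + 2 * D'\<^sup>2) * (real (Suc N) powr (1 - 2 * q) * u powr p))"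
        by (intro mult_left_mono) auto
      also have "\<dots> = (M1\<^sup>2 + 2 * D'\<^sup>2) * (u powr p * exp (- \<epsilon> * real d)) * (real (Suc N) powr (1 - 2 * q) * exp (- \<epsilon> * real d))"
        by (simp add: mult_ac)
      also have "\<dots> \<le> (M1\<^sup>2 + 2 * D'\<^sup>2) * M4 * (real (Suc N) powr (1 - 2 * q) * exp (- \<epsilon> * real d))"
        using M4[of d] by (intro mult_right_mono mult_left_mono) (auto simp: u_def)
      finally show ?thesis unfolding e2 M3_def d by (simp add: mult_ac)
    qed
    have M3: "M3 \<ge> 0" using M4[of 0] unfolding M3_def
      by (intro mult_nonneg_nonneg) (auto simp: a_def intro: order_trans[rotated])
    have NS: "N \<in> S" using N by (auto simp: S_def)
    then have zN: "z N = y N" by (simp add: z_def)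
    \<comment> \<open>From the energy only the summand n = N is retained.\<close>
    have "(ln (x N) - ln (y N))\<^sup>2 * real (Suc N)
      = (\<Sum>n\<in>{N}. (exp (- \<epsilon> * \<bar>real n - real N\<bar>))\<^sup>2 * (ln (x n) - ln (z n))\<^sup>2 * real (Suc n))"
      by (simp add: zN)
    also have "\<dots> \<le> (\<Sum>n\<in>S. (exp (- \<epsilon> * \<bar>real n - real N\<bar>))\<^sup>2 * (ln (x n) - ln (z n))\<^sup>2 * real (Suc n))"
      by (rule sum_mono2) (use NS in \<open>auto simp: S_def\<close>)
    also have "\<dots> \<le> Q * (\<Sum>n\<in>S. (exp (- \<epsilon> * \<bar>real n - real N\<bar>))\<^sup>2 * (R n)\<^sup>2 / real (Suc n))"
      unfolding R_def
      by (rule energy[THEN spec[of _ x], THEN spec[of _ z], THEN spec[of _ "real N"], THEN spec[of _ S],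
            THEN mp, THEN mp, THEN mp, THEN mp, THEN mp, THEN mp, THEN mp, OF x0 z0 xb' zb])
        (use n1 in \<open>auto simp: S_def z_def\<close>)
    also have "\<dots> \<le> Q * (\<Sum>n\<in>S. M3 * real (Suc N) powr (1 - 2 * q) * exp (- \<epsilon> * \<bar>real n - real N\<bar>))"
      by (intro mult_left_mono sum_mono summand Q)
    also have "\<dots> \<le> Q * (M3 * real (Suc N) powr (1 - 2 * q) * (2 / (1 - exp (- \<epsilon>))))"
      unfolding sum_distrib_left[symmetric] S_def
      by (intro mult_left_mono sum_exp_dist_le[OF \<epsilon>] Q mult_nonneg_nonneg M3) auto
    also have "\<dots> = M * (real (Suc N) powr (- q))\<^sup>2 * real (Suc N)"
      using powr_add[of "real (Suc N)" "- (2 * q)" 1] by (simp add: M_def powr_power)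
    finally have "(ln (x N) - ln (y N))\<^sup>2 \<le> M * (real (Suc N) powr (- q))\<^sup>2"
      by (simp del: of_nat_Suc)
    then have "\<bar>ln (x N) - ln (y N)\<bar> \<le> sqrt (M * (real (Suc N) powr (- q))\<^sup>2)"
      using real_le_rsqrt real_sqrt_abs real_sqrt_le_mono by metis
    also have "\<dots> = sqrt M * real (Suc N) powr (- q)" by (simp add: real_sqrt_mult)
    finally show ?thesis .
  qed
  then show ?thesis by (intro exI[of _ "sqrt M"]) (auto simp: eventually_sequentially)
qed

section \<open>Formal solutions of the hierarchy\<close>

definition central_fps :: "real \<Rightarrow> real fps" where
  "central_fps a = Abs_fps (\<lambda>k. real ((2 * k) choose k) * a ^ k)"

lemma central_binomial_Suc:
  "Suc k * (2 * Suc k choose Suc k) = 2 * (2 * k + 1) * (2 * k choose k)"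
proof -
  have 1: "(2 * Suc k choose Suc k) * Suc k = (2 * Suc k) * (2 * k + 1 choose k)"
    using Suc_times_binomial_eq[of "2 * k + 1" k] by simp
  have 2: "(2 * k + 1 choose Suc k) * Suc k = (2 * k + 1) * (2 * k choose k)"
    using Suc_times_binomial_eq[of "2 * k" k] by simp
  have "(2 * k + 1 choose k) = (2 * k + 1 choose Suc k)"
    using binomial_symmetric[of k "2 * k + 1"] by simp
  with 1 have "(2 * Suc k choose Suc k) * Suc k = 2 * ((2 * k + 1 choose Suc k) * Suc k)"
    by (simp only: mult.assoc mult.commute[of "Suc k"])
  then show ?thesis unfolding 2 by (metis mult.assoc mult.commute)
qed

text \<open>Thus \<open>central_fps a\<close> is (1 - 4 a X)^(-1/2). The recursion of the central
  binomial coefficients is the differential equation B' (1 - 4 a X) = 2 a B, and this makes the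
  derivative of the left-hand side vanish.\<close>

lemma central_fps_square: "central_fps a * central_fps a * (1 - fps_const (4 * a) * fps_X) = 1"
proof -
  let ?B = "central_fps a"
  have rec: "real (Suc k) * fps_nth ?B (Suc k) = 2 * a * (2 * real k + 1) * fps_nth ?B k" for k
  proof -
    have "real (Suc k) * real (2 * Suc k choose Suc k) = 2 * (2 * real k + 1) * real (2 * k choose k)"
      using arg_cong[OF central_binomial_Suc[of k], of real]
      by (simp only: of_nat_mult of_nat_add of_nat_numeral of_nat_1)
    then have "real (Suc k) * real (2 * Suc k choose Suc k) * (a * a ^ k)
        = 2 * (2 * real k + 1) * real (2 * k choose k) * (a * a ^ k)"
      by (rule arg_cong)
    then show ?thesis unfolding central_fps_def fps_nth_Abs_fps power_Suc
      by (simp only: mult.assoc mult.left_commute[of a])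
  qed
  have ode: "fps_deriv ?B * (1 - fps_const (4 * a) * fps_X) = fps_const (2 * a) * ?B"
  proof (rule fps_ext)
    fix k
    have "fps_deriv ?B * (1 - fps_const (4 * a) * fps_X)
        = fps_deriv ?B - fps_const (4 * a) * (fps_X * fps_deriv ?B)" by (simp add: algebra_simps)
    then show "fps_nth (fps_deriv ?B * (1 - fps_const (4 * a) * fps_X)) k = fps_nth (fps_const (2 * a) * ?B) k"
      using rec[of k] by (cases k) (simp_all add: algebra_simps)
  qed
  have "fps_deriv (?B * ?B * (1 - fps_const (4 * a) * fps_X))
      = 2 * ?B * (fps_deriv ?B * (1 - fps_const (4 * a) * fps_X)) - fps_const (4 * a) * ?B * ?B"
    by (simp add: algebra_simps)
  also have "\<dots> = 0"
  proof -
    have "fps_const (4 * a) = 2 * fps_const (2 * a)"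
      by (simp add: fps_numeral_fps_const)
    then show ?thesis unfolding ode by (simp add: algebra_simps)
  qed
  finally have "?B * ?B * (1 - fps_const (4 * a) * fps_X) = fps_const (fps_nth (?B * ?B * (1 - fps_const (4 * a) * fps_X)) 0)"
    using fps_deriv_eq_0_iff by metis
  then show ?thesis by (simp add: central_fps_def)
qed

text \<open>The value that the recursion for F k assigns to the constant sequence a, a coefficient
  of (B - 1) / 2 with B = \<open>central_fps a\<close>; at a = \<open>N1 m t\<close> it is
  \<open>N m t k\<close>.\<close>

definition limit_coeff :: "real \<Rightarrow> nat \<Rightarrow> real" where
  "limit_coeff a k = (if k = 0 then 0 else real ((2 * k) choose k) * a ^ k / 2)"

text \<open>The response of F k to a constant perturbation: X B^3 is the derivative of (B - 1) / 2
  with respect to a.\<close>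

definition even_symbol :: "real \<Rightarrow> nat \<Rightarrow> real" where
  "even_symbol a k = fps_nth (fps_X * central_fps a ^ 3) k"

text \<open>The response of F k to an alternating perturbation of the constant sequence a.\<close>

definition odd_symbol :: "real \<Rightarrow> nat \<Rightarrow> real" where
  "odd_symbol a k = fps_nth (fps_X * central_fps a) k"

lemma symbol_pos:
  assumes "a > 0" "k \<ge> 1"
  shows "even_symbol a k > 0" "odd_symbol a k > 0"
proof -
  have B: "fps_nth (central_fps a) j > 0" for j using assms by (simp add: central_fps_def)
  have mult: "fps_nth (f * g) j > 0" if "\<And>j. fps_nth f j > (0::real)" "\<And>j. fps_nth g j > 0" for f g j
    unfolding fps_mult_nth by (rule sum_pos) (auto intro: mult_pos_pos that)
  show "odd_symbol a k > 0" using assms B by (cases k) (auto simp: odd_symbol_def)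
  have "fps_nth (central_fps a ^ 3) j > 0" for j
    unfolding power3_eq_cube by (intro mult B)
  then show "even_symbol a k > 0" using assms by (cases k) (auto simp: even_symbol_def)
qed

text \<open>The recursion for F at a constant sequence and its linearisations in the constant and
  the alternating direction. With W = (B - 1) / 2, V = X B^3 and Z = X B they read W + W^2 = a X
  B^2, V B = X B^2 + 4 a X B V and Z B = X B^2, all consequences of B^2 = 1 + 4 a X B^2. In the
  alternating direction the shifted and unshifted perturbations cancel.\<close>

lemma symbol_recursions:
  fixes a :: real
  defines "c \<equiv> limit_coeff a" and "p \<equiv> even_symbol a" and "q \<equiv> odd_symbol a"
  shows "c (Suc (Suc l)) = a * (4 * c (Suc l)) + a * (\<Sum>i\<in>{1..l}. 4 * (c i * c (Suc l - i)))
      - (\<Sum>i\<in>{1..Suc l}. c i * c (Suc (Suc l) - i))"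
    and "p (Suc (Suc l)) = 4 * c (Suc l) + (\<Sum>i\<in>{1..l}. 4 * (c i * c (Suc l - i)))
      + 4 * a * p (Suc l) + 4 * a * (\<Sum>i\<in>{1..l}. c i * p (Suc l - i) + p i * c (Suc l - i))
      - (\<Sum>i\<in>{1..Suc l}. c i * p (Suc (Suc l) - i) + p i * c (Suc (Suc l) - i))"
    and "q (Suc (Suc l)) = 4 * c (Suc l) + (\<Sum>i\<in>{1..l}. 4 * (c i * c (Suc l - i)))
      - (\<Sum>i\<in>{1..Suc l}. c i * q (Suc (Suc l) - i) + q i * c (Suc (Suc l) - i))"
proof -
  let ?B = "central_fps a" and ?a = "fps_const a"
  define W where "W = Abs_fps c"
  define V where "V = fps_X * ?B ^ 3"
  define Z where "Z = fps_X * ?B"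
  have B: "?B = 1 + 2 * W"
    by (rule fps_ext) (auto simp: central_fps_def W_def c_def limit_coeff_def numeral_fps_const)
  have sq: "?B * ?B = 1 + 4 * ?a * fps_X * ?B * ?B"
    using central_fps_square[of a] by (simp add: algebra_simps numeral_fps_const)
  have nth: "fps_nth W k = c k" "fps_nth V k = p k" "fps_nth Z k = q k" for k
    by (auto simp: W_def V_def Z_def p_def q_def even_symbol_def odd_symbol_def)
  have z: "fps_nth W 0 = 0" "fps_nth V 0 = 0" "fps_nth Z 0 = 0"
    by (auto simp: W_def c_def limit_coeff_def V_def Z_def)
  have "4 * (W + W * W) = ?B * ?B - 1" unfolding B by (simp add: algebra_simps)
  also have "\<dots> = 4 * (fps_X * (?a * (?B * ?B)))" by (subst sq) (simp add: mult_ac)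
  also have "?B * ?B = 1 + 4 * W + 4 * (W * W)" unfolding B by (simp add: algebra_simps)
  finally have "W + W * W = fps_X * (?a * (1 + 4 * W + 4 * (W * W)))"
    by (subst (asm) mult_left_cancel) auto
  then have W: "W = fps_X * (?a * (1 + 4 * W + 4 * (W * W))) - W * W"
    by (simp only: eq_diff_eq)
  have "fps_nth W (Suc (Suc l)) = a * (4 * fps_nth W (Suc l) + 4 * fps_nth (W * W) (Suc l)) - fps_nth (W * W) (Suc (Suc l))"
    by (subst W) (simp add: numeral_fps_const)
  then show "c (Suc (Suc l)) = a * (4 * c (Suc l)) + a * (\<Sum>i\<in>{1..l}. 4 * (c i * c (Suc l - i)))
      - (\<Sum>i\<in>{1..Suc l}. c i * c (Suc (Suc l) - i))"
    unfolding fps_mult_nth_no_const[OF z(1) z(1)] nth by (simp add: sum_distrib_left distrib_left)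
  have "V * ?B = fps_X * (?B * ?B) * (?B * ?B)" by (simp add: V_def power3_eq_cube mult_ac)
  also have "\<dots> = fps_X * (?B * ?B) * (1 + 4 * ?a * fps_X * ?B * ?B)" by (rule arg_cong[OF sq])
  also have "\<dots> = fps_X * (?B * ?B) + 4 * ?a * fps_X * ?B * V"
    by (simp add: V_def power3_eq_cube algebra_simps)
  finally have "V * (1 + 2 * W) = fps_X * ((1 + 2 * W) * (1 + 2 * W)) + 4 * ?a * fps_X * (1 + 2 * W) * V"
    unfolding B .
  then have V: "V = fps_X * (1 + 4 * W + 4 * (W * W) + 4 * ?a * V + 4 * ?a * (W * V + V * W)) - (W * V + V * W)"
    by (simp add: algebra_simps)
  have "fps_nth V (Suc (Suc l)) = 4 * fps_nth W (Suc l) + 4 * fps_nth (W * W) (Suc l) + 4 * a * fps_nth V (Suc l)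
      + 4 * a * (fps_nth (W * V) (Suc l) + fps_nth (V * W) (Suc l)) - (fps_nth (W * V) (Suc (Suc l)) + fps_nth (V * W) (Suc (Suc l)))"
    by (subst V) (simp add: numeral_fps_const mult.assoc mult.commute[of V W])
  then show "p (Suc (Suc l)) = 4 * c (Suc l) + (\<Sum>i\<in>{1..l}. 4 * (c i * c (Suc l - i)))
      + 4 * a * p (Suc l) + 4 * a * (\<Sum>i\<in>{1..l}. c i * p (Suc l - i) + p i * c (Suc l - i))
      - (\<Sum>i\<in>{1..Suc l}. c i * p (Suc (Suc l) - i) + p i * c (Suc (Suc l) - i))"
    unfolding fps_mult_nth_no_const[OF z(1) z(1)] fps_mult_nth_no_const[OF z(1) z(2)]
      fps_mult_nth_no_const[OF z(2) z(1)] nth sum.distrib by (simp add: sum_distrib_left)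
  have "Z * (1 + 2 * W) = fps_X * ((1 + 2 * W) * (1 + 2 * W))" unfolding B[symmetric] by (simp add: Z_def mult_ac)
  then have Z: "Z = fps_X * (1 + 4 * W + 4 * (W * W)) - (W * Z + Z * W)" by (simp add: algebra_simps)
  have "fps_nth Z (Suc (Suc l)) = 4 * fps_nth W (Suc l) + 4 * fps_nth (W * W) (Suc l)
     - (fps_nth (W * Z) (Suc (Suc l)) + fps_nth (Z * W) (Suc (Suc l)))"
    by (subst Z) (simp add: numeral_fps_const mult.commute[of Z W])
  then show "q (Suc (Suc l)) = 4 * c (Suc l) + (\<Sum>i\<in>{1..l}. 4 * (c i * c (Suc l - i)))
      - (\<Sum>i\<in>{1..Suc l}. c i * q (Suc (Suc l) - i) + q i * c (Suc (Suc l) - i))"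
    unfolding fps_mult_nth_no_const[OF z(1) z(1)] fps_mult_nth_no_const[OF z(1) z(3)]
      fps_mult_nth_no_const[OF z(3) z(1)] nth sum.distrib by (simp add: sum_distrib_left)
qed

section \<open>First-order perturbation of formal series\<close>

definition reflect :: "real \<Rightarrow> real poly \<Rightarrow> real poly" where
  "reflect lam p = pcompose p [:2 * lam + 1, -1:]"

lemma poly_reflect [simp]: "poly (reflect lam p) x = poly p (2 * lam + 1 - x)"
  by (simp add: reflect_def poly_pcompose)

lemma poly_eqI_real: "(\<And>x. poly p x = poly q (x::real)) \<Longrightarrow> p = q"
  using poly_eq_poly_eq_iff by blast

text \<open>In effect a tangent vector d at the leading coefficient c, placed at order s; the rules
  below are those of differentiation.\<close>

definition first_diff :: "nat \<Rightarrow> 'a::comm_ring_1 fps \<Rightarrow> 'a fps \<Rightarrow> 'a \<Rightarrow> 'a \<Rightarrow> bool" where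
  "first_diff s f f' c d \<longleftrightarrow> (\<forall>i<s. fps_nth f i = fps_nth f' i) \<and> fps_nth f 0 = c \<and> fps_nth f' 0 = c
     \<and> fps_nth f s - fps_nth f' s = d"

lemma first_diff_add:
  "first_diff s f f' c d \<Longrightarrow> first_diff s h h' c' d' \<Longrightarrow> first_diff s (f + h) (f' + h') (c + c') (d + d')"
  by (auto simp: first_diff_def)

lemma first_diff_diff:
  "first_diff s f f' c d \<Longrightarrow> first_diff s h h' c' d' \<Longrightarrow> first_diff s (f - h) (f' - h') (c - c') (d - d')"
  by (auto simp: first_diff_def)

lemma first_diff_sum:
  "(\<And>i. i \<in> I \<Longrightarrow> first_diff s (f i) (f' i) (c i) (d i)) \<Longrightarrow>
    first_diff s (\<Sum>i\<in>I. f i) (\<Sum>i\<in>I. f' i) (\<Sum>i\<in>I. c i) (\<Sum>i\<in>I. d i)"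
  by (auto simp: first_diff_def fps_sum_nth sum_subtractf[symmetric] intro!: sum.cong)

lemma first_diff_mult:
  assumes f: "first_diff s f f' c d" and h: "first_diff s h h' c' d'" and s: "s \<ge> 1"
  shows "first_diff s (f * h) (f' * h') (c * c') (d * c' + c * d')"
proof -
  have low: "fps_nth (u * v) i = (if i = s then fps_nth u s * fps_nth v 0 else 0)"
    if "\<And>i. i < s \<Longrightarrow> fps_nth u i = 0" "i \<le> s" for u v :: "'a fps" and i
  proof -
    have "fps_nth (u * v) i = (\<Sum>j\<in>{0..i}. if j = s then fps_nth u s * fps_nth v 0 else 0)"
      unfolding fps_mult_nth by (intro sum.cong refl) (use that in auto)
    then show ?thesis using that(2) by auto
  qed
  have eq: "f * h - f' * h' = (f - f') * h + (h - h') * f'" by (simp add: algebra_simps)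
  have D: "fps_nth (f * h) i - fps_nth (f' * h') i = (if i = s then d * c' + c * d' else 0)" if "i \<le> s" for i
    using low[of "f - f'" i h] low[of "h - h'" i f'] f h that s
    unfolding fps_sub_nth[symmetric] eq fps_add_nth by (auto simp: first_diff_def mult.commute)
  show ?thesis unfolding first_diff_def
  proof (intro conjI allI impI)
    fix i assume "i < s"
    then show "fps_nth (f * h) i = fps_nth (f' * h') i" using D[of i] by simp
  next
    show "fps_nth (f * h) s - fps_nth (f' * h') s = d * c' + c * d'" using D[of s] by simp
  qed (use f h in \<open>auto simp: first_diff_def\<close>)
qed

lemma shift_fps_nth:
  assumes "m \<ge> 1"
  shows "fps_nth (shift_fps m lam \<sigma> k G) r = reflect lam (fps_nth G r) + (\<Sum>j = 1..r div m.
     smult ((((real k - real (r - m * j)) / real m) gchoose j) * \<sigma> ^ j) (reflect lam (fps_nth G (r - m * j))))"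
  unfolding shift_fps_def reflect_def by (simp add: sum.atLeast_Suc_atMost)

text \<open>Every binomial correction raises the order by at least m, so at order s it involves only
  coefficients on which both series agree. What remains is the reflection.\<close>

lemma first_diff_shift:
  assumes m: "m \<ge> 1" and s: "s \<ge> 1" and f: "first_diff s f f' c d"
  shows "first_diff s (shift_fps m lam \<sigma> k f) (shift_fps m lam \<sigma> k f') (reflect lam c) (reflect lam d)"
proof -
  have lt: "r - m * j < s" if "r \<le> s" "j \<in> {1..r div m}" for r j
  proof -
    have "m * j > 0" using m that by auto
    then show ?thesis using that s by linarith
  qed
  have "(\<Sum>j = 1..r div m. smult ((((real k - real (r - m * j)) / real m) gchoose j) * \<sigma> ^ j) (reflect lam (fps_nth f (r - m * j))))
     = (\<Sum>j = 1..r div m. smult ((((real k - real (r - m * j)) / real m) gchoose j) * \<sigma> ^ j) (reflect lam (fps_nth f' (r - m * j))))"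
    if "r \<le> s" for r
    using f lt[OF that] by (intro sum.cong refl) (auto simp: first_diff_def)
  then show ?thesis
    using f by (auto simp: first_diff_def shift_fps_nth[OF m] reflect_def pcompose_diff[symmetric])
qed

fun formal_F :: "nat \<Rightarrow> real \<Rightarrow> real poly fps \<Rightarrow> nat \<Rightarrow> real poly fps" where
  "formal_F m lam g 0 = 0"
| "formal_F m lam g (Suc 0) = g"
| "formal_F m lam g (Suc (Suc l)) =
     g * (shift_fps m lam (-1) (Suc l) (formal_F m lam g (Suc l)) + 2 * formal_F m lam g (Suc l)
        + shift_fps m lam 1 (Suc l) (formal_F m lam g (Suc l)))
     + g * (\<Sum>i\<in>{1..l}. (formal_F m lam g i + shift_fps m lam 1 i (formal_F m lam g i)) *
         (shift_fps m lam (-1) (Suc l - i) (formal_F m lam g (Suc l - i)) + formal_F m lam g (Suc l - i)))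
     - (\<Sum>i\<in>{1..Suc l}. formal_F m lam g i * formal_F m lam g (Suc (Suc l) - i))"

text \<open>To first order a perturbation \<open>d\<close> acts through its components that are even and odd under
  \<open>\<Delta> \<mapsto> 2\<lambda> + 1 - \<Delta>\<close>; the two multipliers are the values of the symbol of the linearised
  recursion at \<open>1\<close> and \<open>-1\<close>.\<close>

definition linearised :: "real \<Rightarrow> real \<Rightarrow> nat \<Rightarrow> real poly \<Rightarrow> real poly" where
  "linearised lam a k d = smult ((even_symbol a k + odd_symbol a k) / 2) d
     + smult ((even_symbol a k - odd_symbol a k) / 2) (reflect lam d)"

text \<open>By the product rule for \<open>first_diff\<close> the data at order s obey the recursion
  for F linearised at the constant a, and \<open>symbol_recursions\<close> solves it on each of the
  two components.\<close>

lemma first_diff_formal_F: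
  assumes m: "m \<ge> 1" and s: "s \<ge> 1" and g: "first_diff s g g' [:a:] d" and "k \<ge> 1"
  shows "first_diff s (formal_F m lam g k) (formal_F m lam g' k) [:limit_coeff a k:] (linearised lam a k d)"
  using \<open>k \<ge> 1\<close>
proof (induction k rule: less_induct)
  case (less k)
  consider "k = 1" | l where "k = Suc (Suc l)"
    using less.prems by (metis One_nat_def not0_implies_Suc not_one_le_zero)
  then show ?case
  proof cases
    case 1
    have "linearised lam a 1 d = d" "limit_coeff a 1 = a"
      by (auto simp: linearised_def even_symbol_def odd_symbol_def central_fps_def limit_coeff_def
          power3_eq_cube)
    then show ?thesis using 1 g by simp
  next
    case (2 l)
    let ?N = "\<lambda>i. [:limit_coeff a i:]" and ?L = "\<lambda>i. linearised lam a i d" and ?r = "reflect lam"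
    have IH: "first_diff s (formal_F m lam g i) (formal_F m lam g' i) (?N i) (?L i)"
      if "1 \<le> i" "i \<le> Suc l" for i using less.IH[of i] that 2 by auto
    have IHs: "first_diff s (shift_fps m lam \<sigma> i (formal_F m lam g i)) (shift_fps m lam \<sigma> i (formal_F m lam g' i))
      (?r (?N i)) (?r (?L i))" if "1 \<le> i" "i \<le> Suc l" for i \<sigma>
      by (rule first_diff_shift[OF m s IH[OF that]])
    have two: "first_diff s (2 :: real poly fps) 2 2 0" by (simp add: first_diff_def fps_numeral_nth)
    have fd: "first_diff s (formal_F m lam g k) (formal_F m lam g' k)
      ([:a:] * (?r (?N (Suc l)) + 2 * ?N (Suc l) + ?r (?N (Suc l)))
       + [:a:] * (\<Sum>i\<in>{1..l}. (?N i + ?r (?N i)) * (?r (?N (Suc l - i)) + ?N (Suc l - i)))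
       - (\<Sum>i\<in>{1..Suc l}. ?N i * ?N (Suc (Suc l) - i)))
      ((d * (?r (?N (Suc l)) + 2 * ?N (Suc l) + ?r (?N (Suc l)))
         + [:a:] * (?r (?L (Suc l)) + (0 * ?N (Suc l) + 2 * ?L (Suc l)) + ?r (?L (Suc l))))
       + (d * (\<Sum>i\<in>{1..l}. (?N i + ?r (?N i)) * (?r (?N (Suc l - i)) + ?N (Suc l - i)))
         + [:a:] * (\<Sum>i\<in>{1..l}. (?L i + ?r (?L i)) * (?r (?N (Suc l - i)) + ?N (Suc l - i))
             + (?N i + ?r (?N i)) * (?r (?L (Suc l - i)) + ?L (Suc l - i))))
       - (\<Sum>i\<in>{1..Suc l}. ?L i * ?N (Suc (Suc l) - i) + ?N i * ?L (Suc (Suc l) - i)))"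
      unfolding 2 formal_F.simps
      by (intro first_diff_add first_diff_diff first_diff_mult[OF _ _ s] first_diff_sum g two IH IHs) auto
    have ceq: "[:a:] * (?r (?N (Suc l)) + 2 * ?N (Suc l) + ?r (?N (Suc l)))
       + [:a:] * (\<Sum>i\<in>{1..l}. (?N i + ?r (?N i)) * (?r (?N (Suc l - i)) + ?N (Suc l - i)))
       - (\<Sum>i\<in>{1..Suc l}. ?N i * ?N (Suc (Suc l) - i)) = ?N k"
    proof (rule poly_eqI_real)
      fix x
      have A: "(\<Sum>i\<in>{1..l}. (limit_coeff a i + limit_coeff a i) * (limit_coeff a (Suc l - i) + limit_coeff a (Suc l - i)))
          = (\<Sum>i\<in>{1..l}. 4 * (limit_coeff a i * limit_coeff a (Suc l - i)))"
        by (intro sum.cong refl) simp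
      show "poly ([:a:] * (?r (?N (Suc l)) + 2 * ?N (Suc l) + ?r (?N (Suc l)))
       + [:a:] * (\<Sum>i\<in>{1..l}. (?N i + ?r (?N i)) * (?r (?N (Suc l - i)) + ?N (Suc l - i)))
       - (\<Sum>i\<in>{1..Suc l}. ?N i * ?N (Suc (Suc l) - i))) x = poly (?N k) x"
        unfolding 2 by (simp only: poly_add poly_mult poly_diff poly_sum poly_reflect poly_pCons poly_0
            poly_numeral mult_zero_right add_0_right A symbol_recursions(1)[of a l]) simp
    qed
    have deq: "(d * (?r (?N (Suc l)) + 2 * ?N (Suc l) + ?r (?N (Suc l)))
         + [:a:] * (?r (?L (Suc l)) + (0 * ?N (Suc l) + 2 * ?L (Suc l)) + ?r (?L (Suc l))))
       + (d * (\<Sum>i\<in>{1..l}. (?N i + ?r (?N i)) * (?r (?N (Suc l - i)) + ?N (Suc l - i)))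
         + [:a:] * (\<Sum>i\<in>{1..l}. (?L i + ?r (?L i)) * (?r (?N (Suc l - i)) + ?N (Suc l - i))
             + (?N i + ?r (?N i)) * (?r (?L (Suc l - i)) + ?L (Suc l - i))))
       - (\<Sum>i\<in>{1..Suc l}. ?L i * ?N (Suc (Suc l) - i) + ?N i * ?L (Suc (Suc l) - i)) = ?L k" (is "?lhs = _")
    proof (rule poly_eqI_real)
      fix x
      \<comment> \<open>e and f are the components of d at x: the reflection fixes e and changes the
        sign of f.\<close>
      define e where "e = (poly d x + poly d (2 * lam + 1 - x)) / 2"
      define f where "f = (poly d x - poly d (2 * lam + 1 - x)) / 2"
      have dx: "poly d x = e + f" by (simp add: e_def f_def field_simps)
      let ?p = "even_symbol a" and ?q = "odd_symbol a" and ?n = "limit_coeff a"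
      have L: "poly (?L i) x = ?p i * e + ?q i * f" for i
        by (simp add: linearised_def e_def f_def field_simps)
      have rL: "poly (?L i) (2 * lam + 1 - x) = ?p i * e - ?q i * f" for i
        by (simp add: linearised_def e_def f_def field_simps)
      have A: "(\<Sum>i\<in>{1..l}. (?n i + ?n i) * (?n (Suc l - i) + ?n (Suc l - i)))
          = (\<Sum>i\<in>{1..l}. 4 * (?n i * ?n (Suc l - i)))"
        by (intro sum.cong refl) simp
      have B: "(\<Sum>i\<in>{1..l}. (?p i * e + ?q i * f + (?p i * e - ?q i * f)) * (?n (Suc l - i) + ?n (Suc l - i))
          + (?n i + ?n i) * (?p (Suc l - i) * e - ?q (Suc l - i) * f + (?p (Suc l - i) * e + ?q (Suc l - i) * f)))
          = e * (4 * (\<Sum>i\<in>{1..l}. ?n i * ?p (Suc l - i) + ?p i * ?n (Suc l - i)))"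
        unfolding sum_distrib_left by (intro sum.cong refl) (simp add: algebra_simps)
      have C: "(\<Sum>i\<in>{1..Suc l}. (?p i * e + ?q i * f) * ?n (Suc (Suc l) - i) + ?n i * (?p (Suc (Suc l) - i) * e + ?q (Suc (Suc l) - i) * f))
          = e * (\<Sum>i\<in>{1..Suc l}. ?n i * ?p (Suc (Suc l) - i) + ?p i * ?n (Suc (Suc l) - i))
          + f * (\<Sum>i\<in>{1..Suc l}. ?n i * ?q (Suc (Suc l) - i) + ?q i * ?n (Suc (Suc l) - i))"
        unfolding sum_distrib_left sum.distrib[symmetric] by (intro sum.cong refl) (simp add: algebra_simps)
      have pN: "poly (?N i) y = ?n i" for i y by simp
      have "poly ?lhs x = e * ((4 * ?n (Suc l) + (\<Sum>i\<in>{1..l}. 4 * (?n i * ?n (Suc l - i)))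
      + 4 * a * ?p (Suc l) + 4 * a * (\<Sum>i\<in>{1..l}. ?n i * ?p (Suc l - i) + ?p i * ?n (Suc l - i))
      - (\<Sum>i\<in>{1..Suc l}. ?n i * ?p (Suc (Suc l) - i) + ?p i * ?n (Suc (Suc l) - i))))
      + f * (4 * ?n (Suc l) + (\<Sum>i\<in>{1..l}. 4 * (?n i * ?n (Suc l - i)))
      - (\<Sum>i\<in>{1..Suc l}. ?n i * ?q (Suc (Suc l) - i) + ?q i * ?n (Suc (Suc l) - i)))"
        unfolding poly_add poly_mult poly_diff poly_sum poly_reflect L rL dx pN A B C poly_numeral
          poly_0 poly_pCons mult_zero_right add_0_right
        by (simp add: algebra_simps del: sum.atLeast_Suc_atMost sum.cl_ivl_Suc)
      also have "\<dots> = poly (?L k) x"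
        unfolding L 2 symbol_recursions(2)[of a l] symbol_recursions(3)[of a l] by simp
      finally show "poly ?lhs x = poly (?L k) x" .
    qed
    show ?thesis by (rule fd[unfolded ceq deq])
  qed
qed

section \<open>The leading constants\<close>

lemma Gamma_half_plus_nat: "Gamma (real n + 1 / 2) * 4 ^ n * fact n = fact (2 * n) * Gamma (1 / 2 :: real)"
proof (induction n)
  case (Suc n)
  have "Gamma (real (Suc n) + 1 / 2) = (real n + 1 / 2) * Gamma (real n + 1 / 2)"
    using Gamma_plus1[of "real n + 1 / 2"] nonpos_Ints_nonpos[of "real n + 1 / 2"]
    by (force simp: algebra_simps)
  then have "Gamma (real (Suc n) + 1 / 2) * 4 ^ Suc n * fact (Suc n)
      = (2 * real n + 1) * (2 * real n + 2) * (Gamma (real n + 1 / 2) * 4 ^ n * fact n)"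
    by (simp add: algebra_simps)
  then show ?case unfolding Suc.IH by (simp add: algebra_simps)
qed simp

lemma N1_pos: "m \<ge> 1 \<Longrightarrow> t m > 0 \<Longrightarrow> N1 m t > 0"
proof -
  assume "m \<ge> 1" "t m > 0"
  then have "Gamma (1 / 2 :: real) > 0" "Gamma (real m) > 0" "Gamma (real m + 1 / 2) > 0"
    by (auto intro!: Gamma_real_pos simp del: Gamma_one_half_real)
  with \<open>t m > 0\<close> have "Gamma (1 / 2) * Gamma (real m) / (t m * Gamma (real m + 1 / 2)) > 0"
    by (intro divide_pos_pos mult_pos_pos)
  then show ?thesis unfolding N1_def by (intro mult_pos_pos) auto
qed

text \<open>The leading order of the hierarchy, 2 m t_m N_m = 1; this is where the Gamma quotient in
  \<open>N1\<close> comes from.\<close>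

lemma N1_power:
  assumes "m \<ge> 1" "t m > 0"
  shows "real m * t m * real ((2 * m) choose m) * N1 m t ^ m = 1"
proof -
  have G: "Gamma (real m + 1 / 2) > 0" "Gamma (1 / 2 :: real) > 0" "Gamma (real m) > 0"
    using assms by (auto intro!: Gamma_real_pos simp del: Gamma_one_half_real)
  have fm: "real m * Gamma (real m) = fact m"
    using Gamma_fact[of m, where 'a = real] Gamma_plus1[of "real m"] nonpos_Ints_nonpos[of "real m"] assms
    by (force simp: add.commute)
  have bin: "real ((2 * m) choose m) = fact (2 * m) / (fact m * fact m)"
    by (subst binomial_fact) auto
  define X where "X = Gamma (1 / 2) * Gamma (real m) / (t m * Gamma (real m + 1 / 2))"
  have "X > 0" unfolding X_def using G assms by (intro divide_pos_pos mult_pos_pos)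
  then have "(X powr (1 / real m)) ^ m = X" using assms by (simp add: powr_power)
  then have "N1 m t ^ m = (1 / 4) ^ m * X" unfolding N1_def X_def[symmetric] power_mult_distrib by simp
  then have "real m * t m * real ((2 * m) choose m) * N1 m t ^ m
      = real ((2 * m) choose m) * (real m * Gamma (real m)) * Gamma (1 / 2) / (4 ^ m * Gamma (real m + 1 / 2))"
    using assms G by (simp add: X_def power_one_over)
  also have "\<dots> = (fact (2 * m) * Gamma (1 / 2)) / (Gamma (real m + 1 / 2) * 4 ^ m * fact m)"
    unfolding fm bin by (simp add: field_simps)
  also have "\<dots> = 1" unfolding Gamma_half_plus_nat[symmetric]
    using less_imp_neq[OF G(1), symmetric] by simp
  finally show ?thesis .
qed

lemma N_eq_limit_coeff: "k \<ge> 1 \<Longrightarrow> N m t k = limit_coeff (N1 m t) k"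
  by (simp add: N_def limit_coeff_def)

lemma N_pos: "m \<ge> 1 \<Longrightarrow> t m > 0 \<Longrightarrow> N m t k > 0"
  unfolding N_def using N1_pos[of m t] by simp

lemma limit_coeff_normalised:
  assumes "m \<ge> 1" "t m > 0"
  shows "2 * real m * t m * limit_coeff (N1 m t) m = 1"
  using N1_power[of m t, OF assms] assms by (simp add: limit_coeff_def)

text \<open>Divides the even component by \<open>even_symbol a k\<close> and the odd one by
  \<open>odd_symbol a k\<close>.\<close>

definition inv_linearised :: "real \<Rightarrow> real \<Rightarrow> nat \<Rightarrow> real poly \<Rightarrow> real poly" where
  "inv_linearised lam a k c = smult ((even_symbol a k + odd_symbol a k) / (2 * even_symbol a k * odd_symbol a k)) c
     - smult ((even_symbol a k - odd_symbol a k) / (2 * even_symbol a k * odd_symbol a k)) (reflect lam c)"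

lemma inv_linearised:
  assumes "a > 0" "k \<ge> 1"
  shows "linearised lam a k (inv_linearised lam a k c) = c" "inv_linearised lam a k (linearised lam a k d) = d"
  using symbol_pos[OF assms]
  by (auto intro!: poly_eqI_real simp: linearised_def inv_linearised_def field_simps)

section \<open>Solving the formal hierarchy order by order\<close>

definition formal_hierarchy :: "nat \<Rightarrow> (nat \<Rightarrow> real) \<Rightarrow> real \<Rightarrow> real poly fps \<Rightarrow> real poly fps" where
  "formal_hierarchy m t lam g
     = (\<Sum>k=1..m. fps_const [:2 * real k * t k:] * fps_X ^ (m - k) * formal_F m lam g k)"

lemma formal_hierarchy_term_nth:
  "fps_nth (fps_const c * fps_X ^ j * G) s = (if s < j then 0 else c * fps_nth G (s - j))"
  for G :: "real poly fps"
  by (simp add: mult.assoc fps_X_power_mult_nth)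

text \<open>The term of index k carries X^(m - k), so for k < m it sees only coefficients below
  order s. A change at order s enters through F m alone, and linearly.\<close>

lemma formal_hierarchy_diff:
  assumes m: "m \<ge> 1" and s: "s \<ge> 1" and g: "first_diff s g g' [:a:] d"
  shows "fps_nth (formal_hierarchy m t lam g) s - fps_nth (formal_hierarchy m t lam g') s
    = smult (2 * real m * t m) (linearised lam a m d)"
proof -
  have fd: "first_diff s (formal_F m lam g k) (formal_F m lam g' k) [:limit_coeff a k:] (linearised lam a k d)"
    if "k \<in> {1..m}" for k using that by (intro first_diff_formal_F[OF m s g]) auto
  have "fps_nth (formal_hierarchy m t lam g) s - fps_nth (formal_hierarchy m t lam g') s
    = (\<Sum>k=1..m. if k = m then smult (2 * real m * t m) (linearised lam a m d) else 0)"
    unfolding formal_hierarchy_def fps_sum_nth sum_subtractf[symmetric] formal_hierarchy_term_nth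
  proof (intro sum.cong refl)
    fix k assume k: "k \<in> {1..m}"
    show "(if s < m - k then 0 else [:2 * real k * t k:] * fps_nth (formal_F m lam g k) (s - (m - k)))
      - (if s < m - k then 0 else [:2 * real k * t k:] * fps_nth (formal_F m lam g' k) (s - (m - k)))
      = (if k = m then smult (2 * real m * t m) (linearised lam a m d) else 0)"
    proof (cases "k = m")
      case True
      then show ?thesis using fd[OF k] by (simp add: first_diff_def smult_diff_right[symmetric])
    next
      case False
      then have "s - (m - k) < s" using k s by auto
      then show ?thesis using fd[OF k] False by (auto simp: first_diff_def)
    qed
  qed
  then show ?thesis using m by simp
qed

lemma formal_hierarchy_0:
  assumes m: "m \<ge> 1" and tm: "t m > 0" and g: "fps_nth g 0 = [:N1 m t:]"
  shows "fps_nth (formal_hierarchy m t lam g) 0 = 1"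
proof -
  have "first_diff 1 g g [:N1 m t:] 0" using g by (simp add: first_diff_def)
  from first_diff_formal_F[OF m _ this m]
  have "fps_nth (formal_F m lam g m) 0 = [:limit_coeff (N1 m t) m:]" by (simp add: first_diff_def)
  moreover have "fps_nth (formal_hierarchy m t lam g) 0
     = (\<Sum>k=1..m. if k = m then [:2 * real m * t m:] * fps_nth (formal_F m lam g m) 0 else 0)"
    unfolding formal_hierarchy_def fps_sum_nth formal_hierarchy_term_nth by (intro sum.cong refl) auto
  ultimately show ?thesis using m limit_coeff_normalised[of m t, OF m tm]
    by (simp add: one_pCons mult.commute)
qed

text \<open>At the first order where two solutions could differ, the difference lies in the kernel
  of the invertible operator \<open>linearised\<close>.\<close>

lemma formal_hierarchy_unique:
  assumes m: "m \<ge> 1" and tm: "t m > 0" and a: "a > 0"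
    and g: "fps_nth g 0 = [:a:]" "fps_nth g' 0 = [:a:]"
    and eq: "formal_hierarchy m t lam g = formal_hierarchy m t lam g'"
  shows "g = g'"
proof (rule fps_ext)
  fix s show "fps_nth g s = fps_nth g' s"
  proof (induction s rule: less_induct)
    case (less s)
    show ?case
    proof (cases "s = 0")
      case False
      let ?d = "fps_nth g s - fps_nth g' s"
      have "first_diff s g g' [:a:] ?d" using less g by (auto simp: first_diff_def)
      from formal_hierarchy_diff[OF m _ this, of t lam] False eq
      have "smult (2 * real m * t m) (linearised lam a m ?d) = 0" by simp
      then have "linearised lam a m ?d = 0" using m tm by simp
      then have "?d = inv_linearised lam a m 0" using inv_linearised(2)[OF a m, of lam ?d] by simp
      then show ?thesis by (simp add: inv_linearised_def reflect_def)
    qed (use g in simp)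
  qed
qed

text \<open>At order s >= 1 the hierarchy is affine in the new coefficient, with linear part 2 m t_m
  times \<open>linearised\<close>. Evaluating it at the series cut off below s supplies the
  remaining terms of that equation.\<close>

function formal_coeff :: "nat \<Rightarrow> (nat \<Rightarrow> real) \<Rightarrow> real \<Rightarrow> nat \<Rightarrow> real poly" where
  "formal_coeff m t lam s = (if s = 0 then [:N1 m t:] else
     inv_linearised lam (N1 m t) m (smult (1 / (2 * real m * t m))
       (fps_nth (1 + fps_const [:0, 1:] * fps_X ^ m) s
        - fps_nth (formal_hierarchy m t lam (Abs_fps (\<lambda>i. if i < s then formal_coeff m t lam i else 0))) s)))"
  by auto
termination by (relation "Wellfounded.measure (\<lambda>(m, t, lam, s). s)") auto

declare formal_coeff.simps [simp del]

lemma formal_hierarchy_exists: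
  assumes m: "m \<ge> 1" and tm: "t m > 0"
  shows "formal_hierarchy m t lam (Abs_fps (formal_coeff m t lam)) = 1 + fps_const [:0, 1:] * fps_X ^ m"
proof (rule fps_ext)
  fix s
  let ?g = "Abs_fps (formal_coeff m t lam)" and ?g' = "Abs_fps (\<lambda>i. if i < s then formal_coeff m t lam i else 0)"
  have g0: "formal_coeff m t lam 0 = [:N1 m t:]" by (simp add: formal_coeff.simps)
  show "fps_nth (formal_hierarchy m t lam ?g) s = fps_nth (1 + fps_const [:0, 1:] * fps_X ^ m) s"
  proof (cases "s = 0")
    case True
    then show ?thesis using formal_hierarchy_0[of m t ?g, OF m tm] m g0 by simp
  next
    case False
    have "first_diff s ?g ?g' [:N1 m t:] (formal_coeff m t lam s)"
      using False g0 by (auto simp: first_diff_def)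
    from formal_hierarchy_diff[OF m _ this, of t lam] False
    have "fps_nth (formal_hierarchy m t lam ?g) s - fps_nth (formal_hierarchy m t lam ?g') s
      = smult (2 * real m * t m) (linearised lam (N1 m t) m (formal_coeff m t lam s))" by simp
    also have "\<dots> = fps_nth (1 + fps_const [:0, 1:] * fps_X ^ m) s - fps_nth (formal_hierarchy m t lam ?g') s"
      using False m tm by (subst formal_coeff.simps) (simp add: inv_linearised(1)[OF N1_pos[of m t, OF m tm] m])
    finally show ?thesis by simp
  qed
qed

section \<open>The coefficients below order m\<close>

definition const_agree :: "nat \<Rightarrow> real poly fps \<Rightarrow> real poly fps \<Rightarrow> bool" where
  "const_agree r f f' \<longleftrightarrow> (\<forall>i\<le>r. fps_nth f i = fps_nth f' i \<and> degree (fps_nth f i) = 0 \<and> degree (fps_nth f' i) = 0)"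

lemma degree_0_sum: "(\<And>i. i \<in> I \<Longrightarrow> degree (p i) = 0) \<Longrightarrow> degree (\<Sum>i\<in>I. p i) = 0"
  using degree_sum_le[of I p 0] by (cases "finite I") auto

lemma const_agree_add: "const_agree r f f' \<Longrightarrow> const_agree r h h' \<Longrightarrow> const_agree r (f + h) (f' + h')"
  using degree_add_le[of _ 0] by (auto simp: const_agree_def)

lemma const_agree_diff: "const_agree r f f' \<Longrightarrow> const_agree r h h' \<Longrightarrow> const_agree r (f - h) (f' - h')"
  using degree_diff_le[of _ 0] by (auto simp: const_agree_def)

lemma const_agree_sum:
  "(\<And>i. i \<in> I \<Longrightarrow> const_agree r (f i) (f' i)) \<Longrightarrow> const_agree r (\<Sum>i\<in>I. f i) (\<Sum>i\<in>I. f' i)"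
  by (auto simp: const_agree_def fps_sum_nth intro!: sum.cong degree_0_sum)

lemma const_agree_mult:
  assumes "const_agree r f f'" "const_agree r h h'"
  shows "const_agree r (f * h) (f' * h')"
proof -
  have "degree (p * q) = 0" if "degree p = 0" "degree q = 0" for p q :: "real poly"
    using degree_mult_le[of p q] that by simp
  then show ?thesis using assms
    by (auto simp: const_agree_def fps_mult_nth intro!: sum.cong degree_0_sum)
qed

lemma reflect_const: "degree p = 0 \<Longrightarrow> reflect lam p = p"
  by (auto simp: reflect_def elim: degree_eq_zeroE)

text \<open>Below order m there are no binomial corrections, and reflection fixes constants, so the
  shift and with it \<lambda> are invisible.\<close>

lemma const_agree_shift:
  assumes "r < m" "const_agree r f f'"
  shows "const_agree r (shift_fps m lam \<sigma> k f) (shift_fps m lam' \<sigma> k f')"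
  using assms by (auto simp: const_agree_def shift_fps_nth reflect_const)

lemma const_agree_formal_F:
  assumes r: "r < m" and g: "const_agree r g g'"
  shows "const_agree r (formal_F m lam g k) (formal_F m lam' g' k)"
proof (induction k rule: less_induct)
  case (less k)
  consider "k = 0" | "k = 1" | l where "k = Suc (Suc l)"
    by (metis One_nat_def not0_implies_Suc)
  then show ?case
  proof cases
    case (3 l)
    have IH: "const_agree r (formal_F m lam g i) (formal_F m lam' g' i)" if "i \<le> Suc l" for i
      using less[of i] that 3 by auto
    have two: "const_agree r (2 :: real poly fps) 2" by (auto simp: const_agree_def fps_numeral_nth)
    show ?thesis unfolding 3 formal_F.simps
      by (intro const_agree_add const_agree_diff const_agree_mult const_agree_sum const_agree_shift[OF r] g two IH) auto
  qed (use g in \<open>auto simp: const_agree_def\<close>)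
qed

text \<open>For 0 < s < m the right-hand side 1 + \<Delta> X^m has no coefficient of order s, and on
  constants \<open>inv_linearised\<close> is multiplication by a number that does not involve
  \<lambda>.\<close>

lemma formal_coeff_const:
  assumes m: "m \<ge> 1" and s: "s < m"
  shows "formal_coeff m t lam s = formal_coeff m t lam' s \<and> degree (formal_coeff m t lam s) = 0"
  using s
proof (induction s rule: less_induct)
  case (less s)
  show ?case
  proof (cases "s = 0")
    case True
    then show ?thesis by (simp add: formal_coeff.simps)
  next
    case False
    let ?g = "\<lambda>lam. Abs_fps (\<lambda>i. if i < s then formal_coeff m t lam i else 0)"
    let ?c = "\<lambda>lam. smult (1 / (2 * real m * t m)) (fps_nth (1 + fps_const [:0, 1:] * fps_X ^ m) s
        - fps_nth (formal_hierarchy m t lam (?g lam)) s)"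
    have "const_agree s (?g lam) (?g lam')"
      unfolding const_agree_def
    proof (intro allI impI)
      fix i
      show "fps_nth (?g lam) i = fps_nth (?g lam') i \<and> degree (fps_nth (?g lam) i) = 0
          \<and> degree (fps_nth (?g lam') i) = 0"
        using less.IH[of i] less.prems by (cases "i < s") auto
    qed
    then have "const_agree s (formal_hierarchy m t lam (?g lam)) (formal_hierarchy m t lam' (?g lam'))"
      unfolding formal_hierarchy_def
      by (intro const_agree_sum const_agree_mult const_agree_formal_F less.prems)
        (auto simp: const_agree_def fps_X_power_nth)
    then have c: "?c lam = ?c lam'" "degree (?c lam) = 0"
      using less.prems False by (auto simp: const_agree_def)
    have inv: "inv_linearised l (N1 m t) m c = smult ((even_symbol (N1 m t) m + odd_symbol (N1 m t) m)
        / (2 * even_symbol (N1 m t) m * odd_symbol (N1 m t) m)) c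
     - smult ((even_symbol (N1 m t) m - odd_symbol (N1 m t) m) / (2 * even_symbol (N1 m t) m * odd_symbol (N1 m t) m)) c"
      if "degree c = 0" for c l
      using that by (simp add: inv_linearised_def reflect_const)
    have 1: "formal_coeff m t l s = inv_linearised l (N1 m t) m (?c l)" for l
      using False by (subst formal_coeff.simps) simp
    define c where "c = ?c lam"
    have e: "formal_coeff m t lam s = inv_linearised lam (N1 m t) m c"
      "formal_coeff m t lam' s = inv_linearised lam' (N1 m t) m c"
      unfolding c_def 1 by (rule refl, simp only: c(1))
    have dc: "degree c = 0" using c(2) by (simp only: c_def)
    have deg: "degree (smult x c - smult y c) = 0" if "degree c = 0" for x y and c :: "real poly"
      using that degree_diff_le[of "smult x c" 0 "smult y c"] by simp
    show ?thesis unfolding e inv[OF dc] using deg[OF dc] by simp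
  qed
qed

section \<open>Asymptotic expansions\<close>

definition zeta :: "nat \<Rightarrow> nat \<Rightarrow> real" where
  "zeta m n = real n powr (- (1 / real m))"

text \<open>The coefficients are polynomials in \<Delta>, but only their values at 0 and 2 \<lambda>
  + 1 enter. They are therefore bounded along n, while uniqueness of the polynomials themselves
  belongs to the formal equations.\<close>

definition has_expansion :: "nat \<Rightarrow> real \<Rightarrow> nat \<Rightarrow> (nat \<Rightarrow> real) \<Rightarrow> real poly fps \<Rightarrow> bool" where
  "has_expansion m lam S u G \<longleftrightarrow>
     (\<lambda>n. u n - (\<Sum>s\<le>S. poly (fps_nth G s) (Delta lam n) * zeta m n ^ s)) \<in> O(\<lambda>n. zeta m n ^ Suc S)"

lemma zeta_pos: "n \<ge> 1 \<Longrightarrow> zeta m n > 0" and zeta_le_1: "zeta m n \<le> 1" and zeta_nonneg: "zeta m n \<ge> 0"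
proof -
  show "n \<ge> 1 \<Longrightarrow> zeta m n > 0" "zeta m n \<ge> 0" by (auto simp: zeta_def)
  show "zeta m n \<le> 1"
    using powr_mono[of "- (1 / real m)" 0 "real n"] by (cases "n = 0") (auto simp: zeta_def)
qed

lemma zeta_power: "m \<ge> 1 \<Longrightarrow> n \<ge> 1 \<Longrightarrow> zeta m n ^ m = 1 / real n"
  unfolding zeta_def by (subst powr_power) (auto simp: powr_minus_divide)

lemma zeta_power_bigo: "i \<le> j \<Longrightarrow> (\<lambda>n. zeta m n ^ j) \<in> O(\<lambda>n. zeta m n ^ i)"
  by (intro bigoI[where c = 1] always_eventually allI)
    (simp add: zeta_nonneg power_decreasing zeta_le_1)

lemma zeta_bigo_1: "(\<lambda>n. zeta m n ^ j) \<in> O(\<lambda>n. 1)"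
  using zeta_power_bigo[of 0 j m] by simp

lemma Delta_even: "even n \<Longrightarrow> Delta lam n = 0" and Delta_odd: "odd n \<Longrightarrow> Delta lam n = 2 * lam + 1"
  by (simp_all add: Delta_def)

lemma Delta_Suc: "Delta lam (Suc n) = 2 * lam + 1 - Delta lam n"
  by (cases "even n") (simp_all add: Delta_even Delta_odd)

lemma poly_Delta_bigo: "(\<lambda>n. poly p (Delta lam n)) \<in> O(\<lambda>n. 1)"
proof (intro bigoI[where c = "\<bar>poly p 0\<bar> + \<bar>poly p (2 * lam + 1)\<bar>"] always_eventually allI)
  fix n show "norm (poly p (Delta lam n)) \<le> (\<bar>poly p 0\<bar> + \<bar>poly p (2 * lam + 1)\<bar>) * norm (1::real)"
    by (cases "even n") (auto simp: Delta_even Delta_odd)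
qed

lemma truncation_bigo: "(\<lambda>n. \<Sum>s\<le>S. poly (fps_nth G s) (Delta lam n) * zeta m n ^ s) \<in> O(\<lambda>n. 1)"
  by (intro big_sum_in_bigo) (use landau_o.big.mult[OF poly_Delta_bigo zeta_bigo_1] in simp)

lemma has_expansion_bounded: "has_expansion m lam S u G \<Longrightarrow> u \<in> O(\<lambda>n. 1)"
proof -
  let ?T = "\<lambda>n. \<Sum>s\<le>S. poly (fps_nth G s) (Delta lam n) * zeta m n ^ s"
  assume "has_expansion m lam S u G"
  then have "(\<lambda>n. u n - ?T n) \<in> O(\<lambda>n. 1)"
    unfolding has_expansion_def by (rule landau_o.big.trans[OF _ zeta_bigo_1])
  from sum_in_bigo(1)[OF this truncation_bigo[of G lam m S]] show ?thesis by simp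
qed

lemma has_expansion_cong:
  assumes "has_expansion m lam S u G" "eventually (\<lambda>n. u n = v n) sequentially"
    "\<And>s. s \<le> S \<Longrightarrow> fps_nth G s = fps_nth H s"
  shows "has_expansion m lam S v H"
proof -
  have "eventually (\<lambda>n. u n - (\<Sum>s\<le>S. poly (fps_nth G s) (Delta lam n) * zeta m n ^ s)
      = v n - (\<Sum>s\<le>S. poly (fps_nth H s) (Delta lam n) * zeta m n ^ s)) sequentially"
    using assms(2) by eventually_elim (simp add: assms(3))
  from landau_o.big.in_cong[OF this] assms(1) show ?thesis by (simp only: has_expansion_def)
qed

lemma has_expansion_truncation:
  "has_expansion m lam S (\<lambda>n. \<Sum>s\<le>S. poly (fps_nth G s) (Delta lam n) * zeta m n ^ s) G"
  by (simp add: has_expansion_def)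

lemma has_expansion_add:
  "has_expansion m lam S u G \<Longrightarrow> has_expansion m lam S v H \<Longrightarrow> has_expansion m lam S (\<lambda>n. u n + v n) (G + H)"
  unfolding has_expansion_def by (drule (1) sum_in_bigo(1)) (simp add: algebra_simps sum.distrib)

lemma has_expansion_diff:
  "has_expansion m lam S u G \<Longrightarrow> has_expansion m lam S v H \<Longrightarrow> has_expansion m lam S (\<lambda>n. u n - v n) (G - H)"
  unfolding has_expansion_def by (drule (1) sum_in_bigo(2)) (simp add: algebra_simps sum_subtractf)

lemma has_expansion_const: "has_expansion m lam S (\<lambda>n. poly c (Delta lam n)) (fps_const c)"
proof -
  have "(\<Sum>s\<le>S. poly (fps_nth (fps_const c) s) (Delta lam n) * zeta m n ^ s)
    = (\<Sum>s\<le>S. if s = 0 then poly c (Delta lam n) else 0)" for n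
    by (intro sum.cong refl) auto
  then show ?thesis by (simp add: has_expansion_def)
qed

lemma has_expansion_0: "has_expansion m lam S (\<lambda>n. 0) 0"
  using has_expansion_const[of m lam S 0] by simp

lemma has_expansion_sum:
  "finite I \<Longrightarrow> (\<And>i. i \<in> I \<Longrightarrow> has_expansion m lam S (u i) (G i)) \<Longrightarrow>
    has_expansion m lam S (\<lambda>n. \<Sum>i\<in>I. u i n) (\<Sum>i\<in>I. G i)"
  by (induction I rule: finite_induct) (auto intro: has_expansion_0 has_expansion_add)

lemma has_expansion_zeta: "has_expansion m lam S (\<lambda>n. zeta m n) fps_X"
proof (cases "S = 0")
  case True
  then show ?thesis by (simp add: has_expansion_def)
next
  case False
  have "(\<Sum>s\<le>S. poly (fps_nth fps_X s) (Delta lam n) * zeta m n ^ s)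
    = (\<Sum>s\<le>S. if s = 1 then zeta m n else 0)" for n
    by (intro sum.cong refl) auto
  then show ?thesis using False by (simp add: has_expansion_def)
qed

lemma has_expansion_mult:
  assumes u: "has_expansion m lam S u G" and v: "has_expansion m lam S v H"
  shows "has_expansion m lam S (\<lambda>n. u n * v n) (G * H)"
proof -
  let ?z = "zeta m" and ?D = "Delta lam"
  define T where "T = (\<lambda>G n. \<Sum>s\<le>S. poly (fps_nth G s) (?D n) * ?z n ^ s)"
  define c where "c = (\<lambda>i j n. poly (fps_nth G i) (?D n) * poly (fps_nth H j) (?D n))"
  have Tb: "T G \<in> O(\<lambda>n. 1)" for G unfolding T_def by (rule truncation_bigo)
  have ur: "(\<lambda>n. u n - T G n) \<in> O(\<lambda>n. ?z n ^ Suc S)" and vr: "(\<lambda>n. v n - T H n) \<in> O(\<lambda>n. ?z n ^ Suc S)"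
    using u v by (auto simp: has_expansion_def T_def)
  have "(\<lambda>n. (u n - T G n) * v n) \<in> O(\<lambda>n. ?z n ^ Suc S)"
    using landau_o.big.mult[OF ur has_expansion_bounded[OF v]] by simp
  moreover have "(\<lambda>n. T G n * (v n - T H n)) \<in> O(\<lambda>n. ?z n ^ Suc S)"
    using landau_o.big.mult[OF Tb vr] by simp
  moreover have "(\<lambda>n. T G n * T H n - T (G * H) n) \<in> O(\<lambda>n. ?z n ^ Suc S)"
  proof -
    let ?A = "{(i, j). i + j \<le> S}" and ?B = "({..S} \<times> {..S}) \<inter> {(i, j). i + j > S}"
    have fin: "finite ?A" by (rule finite_subset[of _ "{..S} \<times> {..S}"]) auto
    have "T G n * T H n - T (G * H) n = (\<Sum>(i, j)\<in>?B. c i j n * ?z n ^ (i + j))" for n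
    proof -
      have "T G n * T H n = (\<Sum>(i, j)\<in>{..S} \<times> {..S}. c i j n * ?z n ^ (i + j))"
        unfolding T_def sum_product sum.cartesian_product c_def
        by (intro sum.cong refl) (auto simp: power_add mult_ac)
      also have "{..S} \<times> {..S} = ?A \<union> ?B" by auto
      also have "(\<Sum>(i, j)\<in>?A \<union> ?B. c i j n * ?z n ^ (i + j))
          = (\<Sum>(i, j)\<in>?A. c i j n * ?z n ^ (i + j)) + (\<Sum>(i, j)\<in>?B. c i j n * ?z n ^ (i + j))"
        by (rule sum.union_disjoint) (use fin in auto)
      also have "(\<Sum>(i, j)\<in>?A. c i j n * ?z n ^ (i + j)) = T (G * H) n"
        unfolding sum.triangle_reindex_eq T_def
        by (intro sum.cong refl)
          (auto simp: fps_mult_nth poly_sum sum_distrib_right c_def atLeast0AtMost intro!: sum.cong)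
      finally show ?thesis by simp
    qed
    moreover have "(\<lambda>n. \<Sum>(i, j)\<in>?B. c i j n * ?z n ^ (i + j)) \<in> O(\<lambda>n. ?z n ^ Suc S)"
    proof (intro big_sum_in_bigo)
      fix x assume x: "x \<in> ?B"
      obtain i j where ij: "x = (i, j)" by (cases x)
      have "(\<lambda>n. c i j n) \<in> O(\<lambda>n. 1)" unfolding c_def
        using landau_o.big.mult[OF poly_Delta_bigo poly_Delta_bigo] by simp
      from landau_o.big.mult[OF this zeta_power_bigo[of "Suc S" "i + j" m]] x ij
      show "(\<lambda>n. case x of (i, j) \<Rightarrow> c i j n * ?z n ^ (i + j)) \<in> O(\<lambda>n. ?z n ^ Suc S)" by simp
    qed
    ultimately show ?thesis by simp
  qed
  ultimately have "(\<lambda>n. (u n - T G n) * v n + T G n * (v n - T H n) + (T G n * T H n - T (G * H) n))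
      \<in> O(\<lambda>n. ?z n ^ Suc S)"
    by (intro sum_in_bigo(1))
  then show ?thesis unfolding has_expansion_def T_def by (simp add: algebra_simps)
qed

lemma has_expansion_zeta_power: "has_expansion m lam S (\<lambda>n. zeta m n ^ j) (fps_X ^ j)"
proof (induction j)
  case 0
  then show ?case using has_expansion_const[of m lam S 1] by simp
next
  case (Suc j)
  then show ?case using has_expansion_mult[OF has_expansion_zeta Suc] by simp
qed

section \<open>The shift of n and its binomial series\<close>

lemma powr_taylor_bound:
  fixes \<alpha> :: real
  shows "\<exists>M. \<forall>x. \<bar>x\<bar> \<le> 1 / 2 \<longrightarrow> \<bar>(1 + x) powr \<alpha> - (\<Sum>j\<le>J. (\<alpha> gchoose j) * x ^ j)\<bar> \<le> M * \<bar>x\<bar> ^ Suc J"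
proof (intro exI allI impI)
  let ?M = "\<Sum>j. \<bar>\<alpha> gchoose (j + Suc J)\<bar> * (1 / 2) ^ j"
  fix x :: real assume x: "\<bar>x\<bar> \<le> 1 / 2"
  \<comment> \<open>Convergence at 3 / 4 gives absolute convergence at 1 / 2, which bounds the tail
    uniformly for |x| <= 1 / 2.\<close>
  have "summable (\<lambda>j. (\<alpha> gchoose j) * (3 / 4) ^ j)"
    using gen_binomial_real[of "3 / 4" \<alpha>] by (auto simp: sums_iff)
  then have "summable (\<lambda>j. norm ((\<alpha> gchoose j) * (1 / 2) ^ j))"
    by (rule powser_insidea) auto
  then have "summable (\<lambda>j. \<bar>\<alpha> gchoose (j + Suc J)\<bar> * (1 / 2) ^ (j + Suc J))"
    by (subst summable_iff_shift[of "\<lambda>j. \<bar>\<alpha> gchoose j\<bar> * (1 / 2) ^ j" "Suc J"]) (simp add: abs_mult)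
  then have "summable (\<lambda>j. 2 ^ Suc J * (\<bar>\<alpha> gchoose (j + Suc J)\<bar> * (1 / 2) ^ (j + Suc J)))"
    by (rule summable_mult)
  then have s: "summable (\<lambda>j. \<bar>\<alpha> gchoose (j + Suc J)\<bar> * (1 / 2) ^ j)"
    by (simp add: power_add power_one_over field_simps)
  let ?f = "\<lambda>j. (\<alpha> gchoose j) * x ^ j"
  have f: "?f sums (1 + x) powr \<alpha>" using x by (intro gen_binomial_real) auto
  have "(1 + x) powr \<alpha> - (\<Sum>j\<le>J. ?f j) = (\<Sum>j. ?f (j + Suc J))"
    using suminf_split_initial_segment[of ?f "Suc J"] f by (auto simp: sums_iff lessThan_Suc_atMost)
  also have "\<dots> = (\<Sum>j. x ^ Suc J * ((\<alpha> gchoose (j + Suc J)) * x ^ j))"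
    by (simp add: power_add mult_ac)
  also have "\<bar>\<dots>\<bar> \<le> (\<Sum>j. \<bar>x\<bar> ^ Suc J * (\<bar>\<alpha> gchoose (j + Suc J)\<bar> * (1 / 2) ^ j))"
    unfolding real_norm_def[symmetric]
  proof (rule norm_suminf_le)
    fix j
    have "\<bar>x\<bar> ^ j \<le> (1 / 2) ^ j" using x by (intro power_mono) auto
    then have "\<bar>\<alpha> gchoose (j + Suc J)\<bar> * \<bar>x\<bar> ^ j \<le> \<bar>\<alpha> gchoose (j + Suc J)\<bar> * (1 / 2) ^ j"
      by (intro mult_left_mono) auto
    then have "\<bar>x\<bar> ^ Suc J * (\<bar>\<alpha> gchoose (j + Suc J)\<bar> * \<bar>x\<bar> ^ j)
        \<le> \<bar>x\<bar> ^ Suc J * (\<bar>\<alpha> gchoose (j + Suc J)\<bar> * (1 / 2) ^ j)"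
      by (rule mult_left_mono) auto
    then show "norm (x ^ Suc J * ((\<alpha> gchoose (j + Suc J)) * x ^ j))
        \<le> norm x ^ Suc J * (norm (\<alpha> gchoose (j + Suc J)) * (1 / 2) ^ j)"
      unfolding real_norm_def abs_mult power_abs .
  next
    show "summable (\<lambda>j. norm x ^ Suc J * (norm (\<alpha> gchoose (j + Suc J)) * (1 / 2) ^ j))"
      using summable_mult[OF s] by (simp only: real_norm_def)
  qed
  also have "\<dots> = \<bar>x\<bar> ^ Suc J * ?M" by (rule suminf_mult[OF s])
  finally show "\<bar>(1 + x) powr \<alpha> - (\<Sum>j\<le>J. ?f j)\<bar> \<le> ?M * \<bar>x\<bar> ^ Suc J" by (simp add: mult.commute)
qed

text \<open>The series of (1 + \<sigma> / n)^\<alpha> in z, where 1 / n = z^m.\<close>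

definition binomial_fps :: "nat \<Rightarrow> real \<Rightarrow> real \<Rightarrow> real poly fps" where
  "binomial_fps m \<sigma> \<alpha> = Abs_fps (\<lambda>i. if m dvd i then [:(\<alpha> gchoose (i div m)) * \<sigma> ^ (i div m):] else 0)"

lemma has_expansion_binomial:
  assumes m: "m \<ge> 1" and \<sigma>: "\<bar>\<sigma>\<bar> \<le> 1"
  shows "has_expansion m lam S (\<lambda>n. (1 + \<sigma> / real n) powr \<alpha>) (binomial_fps m \<sigma> \<alpha>)"
proof -
  \<comment> \<open>The power n^(-J) = z^(m J) is the last one of order at most S.\<close>
  define J where "J = S div m"
  obtain M where M: "\<And>x. \<bar>x\<bar> \<le> 1 / 2 \<Longrightarrow>
      \<bar>(1 + x) powr \<alpha> - (\<Sum>j\<le>J. (\<alpha> gchoose j) * x ^ j)\<bar> \<le> M * \<bar>x\<bar> ^ Suc J"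
    using powr_taylor_bound[of \<alpha> J] by blast
  have J: "Suc S \<le> m * Suc J" using m dividend_less_times_div[of m S] by (simp add: J_def)
  have T: "(\<Sum>s\<le>S. poly (fps_nth (binomial_fps m \<sigma> \<alpha>) s) (Delta lam n) * zeta m n ^ s)
      = (\<Sum>j\<le>J. (\<alpha> gchoose j) * (\<sigma> / real n) ^ j)" if n: "n \<ge> 1" for n
  proof -
    have "(\<Sum>j\<le>J. (\<alpha> gchoose j) * (\<sigma> / real n) ^ j)
        = (\<Sum>j\<le>J. poly (fps_nth (binomial_fps m \<sigma> \<alpha>) (m * j)) (Delta lam n) * zeta m n ^ (m * j))"
      using m by (intro sum.cong refl)
        (simp add: binomial_fps_def power_mult zeta_power[OF m n] power_divide)
    also have "\<dots> = (\<Sum>s\<in>(*) m ` {..J}. poly (fps_nth (binomial_fps m \<sigma> \<alpha>) s) (Delta lam n) * zeta m n ^ s)"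
      using m by (subst sum.reindex) (auto simp: inj_on_def)
    also have "\<dots> = (\<Sum>s\<le>S. poly (fps_nth (binomial_fps m \<sigma> \<alpha>) s) (Delta lam n) * zeta m n ^ s)"
    proof (rule sum.mono_neutral_left)
      show "(*) m ` {..J} \<subseteq> {..S}"
      proof
        fix s assume "s \<in> (*) m ` {..J}"
        then obtain j where j: "s = m * j" "j \<le> S div m" by (auto simp: J_def)
        have "m * j \<le> m * (S div m)" using j by simp
        also have "\<dots> \<le> S" by simp
        finally show "s \<in> {..S}" using j by simp
      qed
      show "\<forall>s\<in>{..S} - (*) m ` {..J}. poly (fps_nth (binomial_fps m \<sigma> \<alpha>) s) (Delta lam n) * zeta m n ^ s = 0"
      proof
        fix s assume s: "s \<in> {..S} - (*) m ` {..J}"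
        have "\<not> m dvd s"
        proof
          assume "m dvd s"
          then have "s = m * (s div m)" "s div m \<le> J" using s by (auto simp: J_def div_le_mono)
          then show False using s by blast
        qed
        then show "poly (fps_nth (binomial_fps m \<sigma> \<alpha>) s) (Delta lam n) * zeta m n ^ s = 0"
          by (simp add: binomial_fps_def)
      qed
    qed auto
    finally show ?thesis by simp
  qed
  have M0: "M \<ge> 0"
  proof -
    have "0 \<le> M * \<bar>1 / 2\<bar> ^ Suc J" using M[of "1 / 2"] by (rule order_trans[OF abs_ge_zero]) simp
    moreover have "\<bar>1 / 2 :: real\<bar> ^ Suc J > 0" by simp
    ultimately show ?thesis using mult_neg_pos[of M] by (meson not_le)
  qed
  show ?thesis unfolding has_expansion_def
  proof (intro bigoI[where c = M] eventually_mono[OF eventually_ge_at_top[of 2]])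
    fix n :: nat assume n: "2 \<le> n"
    have "\<bar>\<sigma> / real n\<bar> \<le> 1 / real n" using \<sigma> n by (simp add: divide_simps)
    moreover have "1 / real n \<le> 1 / 2" using n by (simp add: divide_simps)
    ultimately have x: "\<bar>\<sigma> / real n\<bar> \<le> 1 / 2" by linarith
    have x': "\<bar>\<sigma> / real n\<bar> ^ Suc J \<le> (1 / real n) ^ Suc J"
      by (rule power_mono) (fact | simp)+
    have "\<bar>(1 + \<sigma> / real n) powr \<alpha> - (\<Sum>s\<le>S. poly (fps_nth (binomial_fps m \<sigma> \<alpha>) s) (Delta lam n) * zeta m n ^ s)\<bar>
        \<le> M * \<bar>\<sigma> / real n\<bar> ^ Suc J"
      using M[OF x] T[of n] n by simp
    also have "\<dots> \<le> M * (1 / real n) ^ Suc J" using x' M0 by (rule mult_left_mono)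
    also have "(1 / real n) ^ Suc J = zeta m n ^ (m * Suc J)"
      using zeta_power[OF m, of n] n by (simp only: power_mult)
    also have "M * \<dots> \<le> M * zeta m n ^ Suc S"
      using J by (intro mult_left_mono M0 power_decreasing zeta_nonneg zeta_le_1)
    finally show "norm ((1 + \<sigma> / real n) powr \<alpha> - (\<Sum>s\<le>S. poly (fps_nth (binomial_fps m \<sigma> \<alpha>) s) (Delta lam n) * zeta m n ^ s))
        \<le> M * norm (zeta m n ^ Suc S)" by (simp add: zeta_nonneg)
  qed
qed

text \<open>Groups the shift by the source order s: the coefficient at z^s contributes a binomial
  series with exponent (k - s) / m. The comparison stops at order S because the sum over s is cut
  there.\<close>

lemma shift_fps_binomial:
  assumes m: "m \<ge> 1" and r: "r \<le> S"
  shows "fps_nth (shift_fps m lam \<sigma> k G) r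
    = fps_nth (\<Sum>s\<le>S. fps_const (reflect lam (fps_nth G s)) * fps_X ^ s * binomial_fps m \<sigma> ((real k - real s) / real m)) r"
proof -
  define f where "f = (\<lambda>s. if r < s then 0 else reflect lam (fps_nth G s) * fps_nth (binomial_fps m \<sigma> ((real k - real s) / real m)) (r - s))"
  have le: "m * j \<le> r" if "j \<le> r div m" for j
  proof -
    have "m * j \<le> m * (r div m)" using that by simp
    also have "\<dots> \<le> r" by simp
    finally show ?thesis .
  qed
  have "fps_nth (shift_fps m lam \<sigma> k G) r = (\<Sum>j = 0..r div m. f (r - m * j))"
    unfolding shift_fps_def fps_nth_Abs_fps
    using m le by (intro sum.cong refl) (auto simp: f_def binomial_fps_def reflect_def)
  also have "\<dots> = (\<Sum>s\<in>(\<lambda>j. r - m * j) ` {0..r div m}. f s)"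
  proof (subst sum.reindex)
    show "inj_on (\<lambda>j. r - m * j) {0..r div m}"
    proof (rule inj_onI)
      fix i j assume "i \<in> {0..r div m}" "j \<in> {0..r div m}" "r - m * i = r - m * j"
      then have "m * i = m * j" using le[of i] le[of j] by (metis atLeastAtMost_iff diff_diff_cancel)
      then show "i = j" using m by simp
    qed
  qed simp
  also have "\<dots> = (\<Sum>s\<le>S. f s)"
  proof (rule sum.mono_neutral_left)
    show "\<forall>s\<in>{..S} - (\<lambda>j. r - m * j) ` {0..r div m}. f s = 0"
    proof
      fix s assume s: "s \<in> {..S} - (\<lambda>j. r - m * j) ` {0..r div m}"
      show "f s = 0"
      proof (cases "r < s")
        case False
        have "\<not> m dvd r - s"
        proof
          assume "m dvd r - s"
          then have "s = r - m * ((r - s) div m)" "(r - s) div m \<le> r div m"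
            using False by (auto simp: div_le_mono)
          then show False using s by (metis DiffD2 atLeastAtMost_iff imageI le0)
        qed
        then show ?thesis by (simp add: f_def binomial_fps_def)
      qed (simp add: f_def)
    qed
  qed (use r in auto)
  also have "\<dots> = fps_nth (\<Sum>s\<le>S. fps_const (reflect lam (fps_nth G s)) * fps_X ^ s * binomial_fps m \<sigma> ((real k - real s) / real m)) r"
    unfolding fps_sum_nth formal_hierarchy_term_nth f_def ..
  finally show ?thesis .
qed

text \<open>With w = 1 + \<sigma> / n one has z(n + \<sigma>) = z(n) w^(-1/m). Multiplying by
  w^(k/m) therefore turns the prefactor z(n + \<sigma>)^k into z(n)^k and each z(n + \<sigma>)^s
  into z(n)^s w^((k - s)/m). The map h is a shift only eventually because n - 1 is truncated at
  0.\<close>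

lemma has_expansion_shift:
  assumes m: "m \<ge> 1" and \<sigma>: "\<sigma> = 1 \<or> \<sigma> = - 1"
    and h: "eventually (\<lambda>n. real (h n) = real n + \<sigma>) sequentially"
    and f: "has_expansion m lam S (\<lambda>n. f n * zeta m n ^ k) G"
  shows "has_expansion m lam S (\<lambda>n. f (h n) * zeta m n ^ k) (shift_fps m lam \<sigma> k G)"
proof -
  let ?z = "zeta m" and ?D = "Delta lam"
  define w where "w = (\<lambda>n. 1 + \<sigma> / real n)"
  define r where "r = (\<lambda>n. f n * ?z n ^ k - (\<Sum>s\<le>S. poly (fps_nth G s) (?D n) * ?z n ^ s))"
  define v where "v = (\<lambda>n. \<Sum>s\<le>S. poly (reflect lam (fps_nth G s)) (?D n) * ?z n ^ s * w n powr ((real k - real s) / real m))"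
  have \<sigma>1: "\<bar>\<sigma>\<bar> \<le> 1" using \<sigma> by auto
  have ev: "eventually (\<lambda>n. n \<ge> 2 \<and> w n > 0 \<and> ?z (h n) = ?z n * w n powr (- (1 / real m))
      \<and> ?D (h n) = 2 * lam + 1 - ?D n) sequentially"
    using h eventually_ge_at_top[of 2]
  proof eventually_elim
    case (elim n)
    have w: "w n > 0" using elim \<sigma> by (auto simp: w_def field_simps)
    have "real (h n) = real n * w n" using elim by (simp add: w_def field_simps)
    then have "?z (h n) = ?z n * w n powr (- (1 / real m))" using w by (simp add: zeta_def powr_mult)
    moreover have "h n = Suc n \<or> n = Suc (h n)" using elim \<sigma> by auto
    then have "?D (h n) = 2 * lam + 1 - ?D n" using Delta_Suc[of lam n] Delta_Suc[of lam "h n"] by auto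
    ultimately show ?case using elim w by simp
  qed
  \<comment> \<open>This carries the remainder estimate from n to h n.\<close>
  have hlim: "filterlim h at_top sequentially"
  proof (rule filterlim_at_top_mono[OF filterlim_minus_const_nat_at_top[of 1]])
    show "eventually (\<lambda>n. n - 1 \<le> h n) sequentially"
      using h by eventually_elim (use \<sigma> in auto)
  qed
  have wb: "(\<lambda>n. w n powr \<alpha>) \<in> O(\<lambda>n. 1)" for \<alpha>
    unfolding w_def by (rule has_expansion_bounded[OF has_expansion_binomial[OF m \<sigma>1]])
  have "(\<lambda>n. ?z (h n)) \<in> O(\<lambda>n. ?z n)"
  proof -
    have "(\<lambda>n. ?z n * w n powr (- (1 / real m))) \<in> O(\<lambda>n. ?z n * 1)"
      by (intro landau_o.big.mult wb) simp
    moreover have "eventually (\<lambda>n. ?z (h n) = ?z n * w n powr (- (1 / real m))) sequentially"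
      using ev by eventually_elim simp
    ultimately show ?thesis using landau_o.big.in_cong by fastforce
  qed
  then have zh: "(\<lambda>n. ?z (h n) ^ Suc S) \<in> O(\<lambda>n. ?z n ^ Suc S)" by (rule landau_o.big_power)
  have "r \<in> O(\<lambda>n. ?z n ^ Suc S)" using f by (simp add: has_expansion_def r_def)
  then have "(\<lambda>n. r (h n)) \<in> O(\<lambda>n. ?z (h n) ^ Suc S)" by (rule landau_o.big.compose[OF _ hlim])
  from landau_o.big.mult[OF landau_o.big.trans[OF this zh] wb[of "real k / real m"]]
  have "(\<lambda>n. r (h n) * w n powr (real k / real m)) \<in> O(\<lambda>n. ?z n ^ Suc S)" by simp
  then have r: "has_expansion m lam S (\<lambda>n. r (h n) * w n powr (real k / real m)) 0"
    by (simp add: has_expansion_def)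
  have v: "has_expansion m lam S v
     (\<Sum>s\<le>S. fps_const (reflect lam (fps_nth G s)) * fps_X ^ s * binomial_fps m \<sigma> ((real k - real s) / real m))"
    unfolding v_def w_def
    by (intro has_expansion_sum has_expansion_mult has_expansion_const has_expansion_zeta_power
        has_expansion_binomial m \<sigma>1) simp
  show ?thesis
  proof (rule has_expansion_cong[OF has_expansion_add[OF v r]])
    show "eventually (\<lambda>n. v n + r (h n) * w n powr (real k / real m) = f (h n) * ?z n ^ k) sequentially"
      using ev
    proof eventually_elim
      case (elim n)
      then have w: "w n > 0" and z: "?z (h n) = ?z n * w n powr (- (1 / real m))"
        and D: "?D (h n) = 2 * lam + 1 - ?D n" by auto
      have pw: "?z (h n) ^ s = ?z n ^ s * w n powr (- (real s / real m))" for s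
        unfolding z power_mult_distrib using w by (simp add: powr_power)
      have "(\<Sum>s\<le>S. poly (fps_nth G s) (?D (h n)) * ?z (h n) ^ s) * w n powr (real k / real m) = v n"
        unfolding v_def sum_distrib_right
      proof (intro sum.cong refl)
        fix s
        have "w n powr (- (real s / real m)) * w n powr (real k / real m) = w n powr ((real k - real s) / real m)"
          using w by (simp add: powr_add[symmetric] diff_divide_distrib)
        then show "poly (fps_nth G s) (?D (h n)) * ?z (h n) ^ s * w n powr (real k / real m)
          = poly (reflect lam (fps_nth G s)) (?D n) * ?z n ^ s * w n powr ((real k - real s) / real m)"
          unfolding pw poly_reflect D by (simp only: mult.assoc)
      qed
      moreover have "f (h n) * ?z (h n) ^ k * w n powr (real k / real m) = f (h n) * ?z n ^ k"
      proof -
        have "w n powr (- (real k / real m)) * w n powr (real k / real m) = 1"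
          using w by (simp add: powr_add[symmetric])
        then show ?thesis unfolding pw by (simp only: mult.assoc mult_1_right)
      qed
      ultimately show ?case by (simp add: r_def left_diff_distrib)
    qed
  next
    fix s assume "s \<le> S"
    from shift_fps_binomial[OF m this, of lam \<sigma> k G]
    show "fps_nth ((\<Sum>s\<le>S. fps_const (reflect lam (fps_nth G s)) * fps_X ^ s
        * binomial_fps m \<sigma> ((real k - real s) / real m)) + 0) s = fps_nth (shift_fps m lam \<sigma> k G) s"
      by simp
  qed
qed

text \<open>The recursion is homogeneous: in each summand the indices add up to k, so the power z^k
  distributes over the factors.\<close>

theorem has_expansion_F:
  assumes m: "m \<ge> 1" and g: "has_expansion m lam S (\<lambda>n. \<beta> n * zeta m n) g"
  shows "has_expansion m lam S (\<lambda>n. F \<beta> k n * zeta m n ^ k) (formal_F m lam g k)"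
proof (induction k rule: less_induct)
  case (less k)
  consider "k = 0" | "k = 1" | l where "k = Suc (Suc l)"
    by (metis One_nat_def not0_implies_Suc)
  then show ?case
  proof cases
    case (3 l)
    let ?z = "zeta m"
    have IH: "has_expansion m lam S (\<lambda>n. F \<beta> i n * ?z n ^ i) (formal_F m lam g i)" if "i \<le> Suc l" for i
      using less[of i] that 3 by simp
    have up: "has_expansion m lam S (\<lambda>n. F \<beta> i (n + 1) * ?z n ^ i) (shift_fps m lam 1 i (formal_F m lam g i))"
      if "i \<le> Suc l" for i
      by (rule has_expansion_shift[OF m _ _ IH[OF that], where h = "\<lambda>n. n + 1"]) auto
    have down: "has_expansion m lam S (\<lambda>n. F \<beta> i (n - 1) * ?z n ^ i) (shift_fps m lam (-1) i (formal_F m lam g i))"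
      if "i \<le> Suc l" for i
      by (rule has_expansion_shift[OF m _ _ IH[OF that], where h = "\<lambda>n. n - 1"])
        (auto intro: eventually_mono[OF eventually_ge_at_top[of 1]] simp: of_nat_diff)
    have two: "has_expansion m lam S (\<lambda>n. 2) 2"
      using has_expansion_const[of m lam S 2] by (simp add: numeral_fps_const)
    have "has_expansion m lam S (\<lambda>n. \<beta> n * ?z n * (F \<beta> (Suc l) (n - 1) * ?z n ^ Suc l + 2 * (F \<beta> (Suc l) n * ?z n ^ Suc l)
          + F \<beta> (Suc l) (n + 1) * ?z n ^ Suc l)
        + \<beta> n * ?z n * (\<Sum>i\<in>{1..l}. (F \<beta> i n * ?z n ^ i + F \<beta> i (n + 1) * ?z n ^ i) *
            (F \<beta> (Suc l - i) (n - 1) * ?z n ^ (Suc l - i) + F \<beta> (Suc l - i) n * ?z n ^ (Suc l - i)))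
        - (\<Sum>i\<in>{1..Suc l}. F \<beta> i n * ?z n ^ i * (F \<beta> (Suc (Suc l) - i) n * ?z n ^ (Suc (Suc l) - i))))
      (formal_F m lam g k)"
      unfolding 3 formal_F.simps
      by (intro has_expansion_diff has_expansion_add has_expansion_mult has_expansion_sum g IH up down two) auto
    moreover have "\<beta> n * ?z n * (F \<beta> (Suc l) (n - 1) * ?z n ^ Suc l + 2 * (F \<beta> (Suc l) n * ?z n ^ Suc l)
          + F \<beta> (Suc l) (n + 1) * ?z n ^ Suc l)
        + \<beta> n * ?z n * (\<Sum>i\<in>{1..l}. (F \<beta> i n * ?z n ^ i + F \<beta> i (n + 1) * ?z n ^ i) *
            (F \<beta> (Suc l - i) (n - 1) * ?z n ^ (Suc l - i) + F \<beta> (Suc l - i) n * ?z n ^ (Suc l - i)))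
        - (\<Sum>i\<in>{1..Suc l}. F \<beta> i n * ?z n ^ i * (F \<beta> (Suc (Suc l) - i) n * ?z n ^ (Suc (Suc l) - i)))
        = F \<beta> k n * ?z n ^ k" for n
    proof -
      have A: "(\<Sum>i\<in>{1..l}. (F \<beta> i n * ?z n ^ i + F \<beta> i (n + 1) * ?z n ^ i) *
            (F \<beta> (Suc l - i) (n - 1) * ?z n ^ (Suc l - i) + F \<beta> (Suc l - i) n * ?z n ^ (Suc l - i)))
          = (\<Sum>i\<in>{1..l}. (F \<beta> i n + F \<beta> i (n + 1)) * (F \<beta> (Suc l - i) (n - 1) + F \<beta> (Suc l - i) n)) * ?z n ^ Suc l"
        unfolding sum_distrib_right
      proof (intro sum.cong refl)
        fix i assume "i \<in> {1..l}"
        then have z: "?z n ^ Suc l = ?z n ^ i * ?z n ^ (Suc l - i)" by (simp add: power_add[symmetric] del: power_Suc)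
        show "(F \<beta> i n * ?z n ^ i + F \<beta> i (n + 1) * ?z n ^ i) *
            (F \<beta> (Suc l - i) (n - 1) * ?z n ^ (Suc l - i) + F \<beta> (Suc l - i) n * ?z n ^ (Suc l - i))
          = (F \<beta> i n + F \<beta> i (n + 1)) * (F \<beta> (Suc l - i) (n - 1) + F \<beta> (Suc l - i) n) * ?z n ^ Suc l"
          unfolding z distrib_right[symmetric] by (simp only: mult_ac)
      qed
      have B: "(\<Sum>i\<in>{1..Suc l}. F \<beta> i n * ?z n ^ i * (F \<beta> (Suc (Suc l) - i) n * ?z n ^ (Suc (Suc l) - i)))
          = (\<Sum>i\<in>{1..Suc l}. F \<beta> i n * F \<beta> (Suc (Suc l) - i) n) * ?z n ^ Suc (Suc l)"
        unfolding sum_distrib_right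
      proof (intro sum.cong refl)
        fix i assume "i \<in> {1..Suc l}"
        then have "?z n ^ Suc (Suc l) = ?z n ^ i * ?z n ^ (Suc (Suc l) - i)"
          by (simp add: power_add[symmetric] del: power_Suc)
        then show "F \<beta> i n * ?z n ^ i * (F \<beta> (Suc (Suc l) - i) n * ?z n ^ (Suc (Suc l) - i))
          = F \<beta> i n * F \<beta> (Suc (Suc l) - i) n * ?z n ^ Suc (Suc l)"
          by (simp only: mult_ac)
      qed
      have C: "?z n ^ Suc (Suc l) = ?z n * ?z n ^ Suc l" by simp
      show ?thesis unfolding A B unfolding C 3 F.simps(3)[of \<beta> l n] F.simps(2)
        by (simp only: One_nat_def F.simps(2)) (simp only: algebra_simps)
    qed
    ultimately show ?thesis by simp
  qed (use g in \<open>auto simp: has_expansion_0\<close>)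
qed

theorem has_expansion_hierarchy:
  assumes m: "m \<ge> 1" and g: "has_expansion m lam S (\<lambda>n. \<beta> n * zeta m n) g"
  shows "has_expansion m lam S (\<lambda>n. hierarchy m t \<beta> n * zeta m n ^ m) (formal_hierarchy m t lam g)"
proof -
  have "has_expansion m lam S (\<lambda>n. \<Sum>k=1..m. poly [:2 * real k * t k:] (Delta lam n) * zeta m n ^ (m - k) * (F \<beta> k n * zeta m n ^ k))
      (formal_hierarchy m t lam g)"
    unfolding formal_hierarchy_def
    by (intro has_expansion_sum has_expansion_mult has_expansion_const has_expansion_zeta_power has_expansion_F m g) simp
  moreover have "(\<Sum>k=1..m. poly [:2 * real k * t k:] (Delta lam n) * zeta m n ^ (m - k) * (F \<beta> k n * zeta m n ^ k))
      = hierarchy m t \<beta> n * zeta m n ^ m" for n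
    unfolding hierarchy_def sum_distrib_right
  proof (intro sum.cong refl)
    fix k assume "k \<in> {1..m}"
    then have "zeta m n ^ m = zeta m n ^ (m - k) * zeta m n ^ k" by (simp add: power_add[symmetric])
    then show "poly [:2 * real k * t k:] (Delta lam n) * zeta m n ^ (m - k) * (F \<beta> k n * zeta m n ^ k)
      = 2 * real k * t k * F \<beta> k n * zeta m n ^ m" by simp
  qed
  ultimately show ?thesis by simp
qed

section \<open>Orthogonality and the string equation\<close>

lemma abs_power_le_top_power:
  fixes \<eta> :: real
  assumes i: "i < 2 * m" and \<eta>: "\<eta> > 0"
  shows "\<exists>C\<ge>0. \<forall>x. \<bar>x\<bar> ^ i \<le> C + \<eta> * x ^ (2 * m)"
proof -
  \<comment> \<open>Beyond R one has 1 <= \<eta> |x|, which pays for raising the exponent from 2 m -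
    1 to 2 m.\<close>
  define R where "R = max 1 (1 / \<eta>)"
  have R: "R \<ge> 1" "1 \<le> \<eta> * R" using \<eta> by (auto simp: R_def max_def field_simps)
  show ?thesis
  proof (intro exI conjI allI)
    show "R ^ i \<ge> 0" using R by simp
    fix x :: real
    have top: "x ^ (2 * m) = \<bar>x\<bar> * \<bar>x\<bar> ^ (2 * m - 1)"
      using i by (metis bot_nat_0.extremum_strict even_mult_iff even_numeral gr_zeroI power_even_abs power_eq_if)
    show "\<bar>x\<bar> ^ i \<le> R ^ i + \<eta> * x ^ (2 * m)"
    proof (cases "\<bar>x\<bar> \<le> R")
      case True
      then have "\<bar>x\<bar> ^ i \<le> R ^ i" by (intro power_mono) auto
      moreover have "0 \<le> \<eta> * x ^ (2 * m)" using \<eta> by simp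
      ultimately show ?thesis by linarith
    next
      case False
      have "\<bar>x\<bar> ^ i \<le> \<bar>x\<bar> ^ (2 * m - 1)" using False R i by (intro power_increasing) auto
      also have "\<dots> \<le> (\<eta> * \<bar>x\<bar>) * \<bar>x\<bar> ^ (2 * m - 1)"
      proof -
        have "\<eta> * R \<le> \<eta> * \<bar>x\<bar>" using False \<eta> by (intro mult_left_mono) auto
        then have "1 \<le> \<eta> * \<bar>x\<bar>" using R(2) by linarith
        from mult_right_mono[OF this, of "\<bar>x\<bar> ^ (2 * m - 1)"] show ?thesis by simp
      qed
      also have "\<dots> = \<eta> * x ^ (2 * m)" using top by (simp only: mult.assoc)
      finally show ?thesis using R by (intro add_increasing) auto
    qed
  qed
qed

lemma sum_abs_power_le_top_power:
  fixes \<eta> :: real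
  assumes "finite I" and "\<And>k. k \<in> I \<Longrightarrow> e k < 2 * m" and \<eta>: "\<eta> > 0"
  shows "\<exists>C\<ge>0. \<forall>x. (\<Sum>k\<in>I. \<bar>c k\<bar> * \<bar>x\<bar> ^ e k) \<le> C + \<eta> * x ^ (2 * m)"
  using assms
proof (induction I arbitrary: \<eta> rule: finite_induct)
  case empty
  then show ?case by (intro exI[of _ 0]) auto
next
  case (insert k I)
  have "\<eta> / 2 / (\<bar>c k\<bar> + 1) > 0" using insert by simp
  from abs_power_le_top_power[OF _ this, of "e k" m] insert obtain C1
    where C1: "C1 \<ge> 0" "\<And>x. \<bar>x\<bar> ^ e k \<le> C1 + \<eta> / 2 / (\<bar>c k\<bar> + 1) * x ^ (2 * m)" by auto
  obtain C2 where C2: "C2 \<ge> 0" "\<And>x. (\<Sum>k\<in>I. \<bar>c k\<bar> * \<bar>x\<bar> ^ e k) \<le> C2 + \<eta> / 2 * x ^ (2 * m)"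
    using insert.IH[of "\<eta> / 2"] insert.prems by auto
  show ?case
  proof (intro exI[of _ "\<bar>c k\<bar> * C1 + C2"] conjI allI)
    show "\<bar>c k\<bar> * C1 + C2 \<ge> 0" using C1 C2 by simp
    fix x :: real
    have "\<bar>c k\<bar> * \<bar>x\<bar> ^ e k \<le> \<bar>c k\<bar> * (C1 + \<eta> / 2 / (\<bar>c k\<bar> + 1) * x ^ (2 * m))"
      by (intro mult_left_mono C1) auto
    also have "\<dots> = \<bar>c k\<bar> * C1 + (\<bar>c k\<bar> / (\<bar>c k\<bar> + 1)) * (\<eta> / 2 * x ^ (2 * m))"
      by (simp add: field_simps)
    also have "\<dots> \<le> \<bar>c k\<bar> * C1 + 1 * (\<eta> / 2 * x ^ (2 * m))"
      using insert.prems by (intro add_left_mono mult_right_mono) auto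
    finally show "(\<Sum>k\<in>insert k I. \<bar>c k\<bar> * \<bar>x\<bar> ^ e k) \<le> \<bar>c k\<bar> * C1 + C2 + \<eta> * x ^ (2 * m)"
      using C2(2)[of x] insert.hyps by simp
  qed
qed

lemma integrable_abs_powr_exp:
  assumes s: "s > (0::real)"
  shows "integrable lborel (\<lambda>x. \<bar>x\<bar> powr (s - 1) * exp (- \<bar>x\<bar>))"
proof -
  define g where "g = (\<lambda>x::real. indicator {0..} x * x powr (s - 1) / exp x)"
  have g: "integrable lborel g"
    by (rule integrableI_nn_integral_finite[where x = "Gamma s"])
      (use Gamma_conv_nn_integral_real[OF s] in \<open>auto simp: g_def\<close>)
  have "integrable lborel (\<lambda>x. g x + g (0 + (-1) * x))"
    by (intro Bochner_Integration.integrable_add g lborel_integrable_real_affine) auto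
  moreover have "g x + g (0 + (-1) * x) = \<bar>x\<bar> powr (s - 1) * exp (- \<bar>x\<bar>)" for x
    by (auto simp: g_def indicator_def exp_minus field_simps)
  ultimately show ?thesis by simp
qed

locale freud_weight =
  fixes m :: nat and t :: "nat \<Rightarrow> real" and lam :: real
  assumes m: "m \<ge> 1" and tm: "t m > 0" and lam: "lam > -1"
begin

abbreviation "w \<equiv> weight m t lam"

definition V :: "real \<Rightarrow> real" where "V x = (\<Sum>k=1..m. t k * x ^ (2 * k))"

text \<open>The polynomial x V'(x); the factor x removes the pole of w' / w at the origin.\<close>

definition xV' :: "real poly" where "xV' = (\<Sum>k=1..m. monom (2 * real k * t k) (2 * k))"

lemma poly_xV': "poly xV' x = (\<Sum>k=1..m. 2 * real k * t k * x ^ (2 * k))"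
  by (simp add: xV'_def poly_sum poly_monom)

lemma w_eq: "w x = \<bar>x\<bar> powr (2 * lam + 1) * exp (- V x)"
  by (simp add: weight_def V_def)

lemma w_nonneg: "w x \<ge> 0" and w_pos: "x \<noteq> 0 \<Longrightarrow> w x > 0" and w_uminus: "w (- x) = w x"
  by (auto simp: weight_def)

lemma split_top: "(\<Sum>k=1..m. f k) = f m + (\<Sum>k\<in>{1..<m}. f k)" for f :: "nat \<Rightarrow> real"
proof -
  have "{1..m} = insert m {1..<m}" using m by auto
  then show ?thesis by simp
qed

lemma lower_terms_le:
  fixes \<eta> :: real
  assumes "\<eta> > 0"
  shows "\<exists>C\<ge>0. \<forall>x. \<bar>\<Sum>k\<in>{1..<m}. c k * x ^ (2 * k)\<bar> \<le> C + \<eta> * x ^ (2 * m)"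
proof -
  obtain C where C: "C \<ge> 0" "\<And>x. (\<Sum>k\<in>{1..<m}. \<bar>c k\<bar> * \<bar>x\<bar> ^ (2 * k)) \<le> C + \<eta> * x ^ (2 * m)"
    using sum_abs_power_le_top_power[of "{1..<m}" "\<lambda>k. 2 * k" m \<eta> c] assms by auto
  have "\<bar>\<Sum>k\<in>{1..<m}. c k * x ^ (2 * k)\<bar> \<le> (\<Sum>k\<in>{1..<m}. \<bar>c k\<bar> * \<bar>x\<bar> ^ (2 * k))" for x
    by (rule order_trans[OF sum_abs]) (simp add: abs_mult power_abs)
  then show ?thesis using C by (meson order_trans)
qed

lemma V_lower_bound: "\<exists>C. \<forall>x. \<bar>x\<bar> \<le> C + V x"
proof -
  obtain C1 where C1: "\<And>x. \<bar>\<Sum>k\<in>{1..<m}. t k * x ^ (2 * k)\<bar> \<le> C1 + t m / 2 * x ^ (2 * m)"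
    using lower_terms_le[of "t m / 2" t] tm by auto
  obtain C2 where C2: "\<And>x. \<bar>x\<bar> ^ 1 \<le> C2 + t m / 2 * x ^ (2 * m)"
    using abs_power_le_top_power[of 1 m "t m / 2"] tm m by auto
  have "\<bar>x\<bar> \<le> C1 + C2 + V x" for x
  proof -
    have "V x = t m * x ^ (2 * m) + (\<Sum>k\<in>{1..<m}. t k * x ^ (2 * k))"
      unfolding V_def by (rule split_top)
    then show ?thesis using C1[of x] C2[of x] by (simp add: abs_le_iff)
  qed
  then show ?thesis by blast
qed

text \<open>Half of the leading term 2 m t_m x^(2 m) dominates the lower terms up to a constant,
  whatever their signs.\<close>

lemma xV'_lower_bound: "\<exists>C\<ge>0. \<forall>x. real m * t m * x ^ (2 * m) \<le> C + poly xV' x"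
proof -
  obtain C where C: "C \<ge> 0" "\<And>x. \<bar>\<Sum>k\<in>{1..<m}. (2 * real k * t k) * x ^ (2 * k)\<bar> \<le> C + real m * t m * x ^ (2 * m)"
    using lower_terms_le[of "real m * t m" "\<lambda>k. 2 * real k * t k"] tm m by auto
  have "real m * t m * x ^ (2 * m) \<le> C + poly xV' x" for x
    using C(2)[of x] split_top[of "\<lambda>k. 2 * real k * t k * x ^ (2 * k)"]
    by (simp add: poly_xV' abs_le_iff)
  then show ?thesis using C(1) by blast
qed

lemma w_measurable [measurable]: "w \<in> borel_measurable borel"
  unfolding weight_def by measurable

lemma integrable_power_w: "integrable lborel (\<lambda>x. x ^ j * w x)"
proof -
  obtain C where C: "\<And>x. \<bar>x\<bar> \<le> C + V x" using V_lower_bound by blast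
  let ?s = "real j + 2 * lam + 2"
  have s: "?s > 0" using lam by simp
  show ?thesis
  proof (rule Bochner_Integration.integrable_bound)
    show "integrable lborel (\<lambda>x. exp C * (\<bar>x\<bar> powr (?s - 1) * exp (- \<bar>x\<bar>)))"
      by (intro integrable_mult_right integrable_abs_powr_exp s)
    show "AE x in lborel. norm (x ^ j * w x) \<le> norm (exp C * (\<bar>x\<bar> powr (?s - 1) * exp (- \<bar>x\<bar>)))"
    proof (rule AE_I2)
      fix x :: real
      show "norm (x ^ j * w x) \<le> norm (exp C * (\<bar>x\<bar> powr (?s - 1) * exp (- \<bar>x\<bar>)))"
      proof (cases "x = 0")
        case False
        have e: "exp (- V x) \<le> exp C * exp (- \<bar>x\<bar>)" using C[of x] by (simp add: exp_add[symmetric])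
        have "norm (x ^ j * w x) = \<bar>x\<bar> powr (?s - 1) * exp (- V x)"
          using False by (simp add: w_eq abs_mult power_abs powr_add powr_realpow mult_ac)
        also have "\<dots> \<le> \<bar>x\<bar> powr (?s - 1) * (exp C * exp (- \<bar>x\<bar>))" by (intro mult_left_mono e) auto
        finally show ?thesis by (simp add: mult_ac)
      qed (simp add: w_eq)
    qed
  qed measurable
qed

section \<open>Moments and integration by parts\<close>

definition mom :: "real poly \<Rightarrow> real" where
  "mom p = (LINT x|lborel. poly p x * w x)"

lemma integrable_poly_w: "integrable lborel (\<lambda>x. poly p x * w x)"
proof -
  have "poly p x * w x = (\<Sum>i\<le>degree p. coeff p i * (x ^ i * w x))" for x
    by (simp add: poly_altdef sum_distrib_right mult.assoc)
  then show ?thesis by (simp add: integrable_power_w)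
qed

lemma mom_add: "mom (p + q) = mom p + mom q"
  unfolding mom_def by (simp add: distrib_right integrable_poly_w)

lemma mom_diff: "mom (p - q) = mom p - mom q"
  unfolding mom_def by (simp add: left_diff_distrib integrable_poly_w)

lemma mom_smult: "mom (smult c p) = c * mom p"
  unfolding mom_def by (simp add: mult.assoc)

lemma mom_0 [simp]: "mom 0 = 0" by (simp add: mom_def)

lemma mom_sum: "mom (\<Sum>i\<in>I. f i) = (\<Sum>i\<in>I. mom (f i))"
  by (induction I rule: infinite_finite_induct) (auto simp: mom_add)

lemma mom_mono: "(\<And>x. poly p x \<le> poly q x) \<Longrightarrow> mom p \<le> mom q"
  unfolding mom_def by (intro integral_mono integrable_poly_w mult_right_mono w_nonneg)

text \<open>The weight is positive off 0 and p has finitely many zeros, so a vanishing integral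
  would make the whole line a null set.\<close>

lemma mom_square_pos:
  assumes "p \<noteq> 0"
  shows "mom (p * p) > 0"
proof -
  have nn: "AE x in lborel. 0 \<le> poly (p * p) x * w x" by (simp add: w_nonneg)
  have "mom (p * p) \<noteq> 0"
  proof
    assume "mom (p * p) = 0"
    then have "AE x in lborel. poly (p * p) x * w x = 0"
      using integral_nonneg_eq_0_iff_AE[OF integrable_poly_w nn] by (simp add: mom_def)
    moreover have "AE x in lborel. x \<notin> insert 0 {x. poly p x = 0}"
      by (intro AE_not_in finite_imp_null_set_lborel) (simp add: poly_roots_finite assms)
    ultimately have "AE x in (lborel :: real measure). False"
      by eventually_elim (use w_pos in fastforce)
    then have "emeasure lborel (space lborel :: real set) = 0"
      using ae_filter_eq_bot_iff trivial_limit_def by blast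
    then show False by simp
  qed
  moreover have "mom (p * p) \<ge> 0" unfolding mom_def by (intro integral_nonneg_AE nn)
  ultimately show ?thesis by linarith
qed

lemma powr_exp_tendsto_0: "((\<lambda>x::real. x powr a * exp (- x)) \<longlongrightarrow> 0) at_top"
  by real_asymp

text \<open>Away from the origin \<open>ibp p\<close> times w is the derivative of x p w.\<close>

definition ibp :: "real poly \<Rightarrow> real poly" where
  "ibp p = [:0, 1:] * pderiv p + smult (2 * lam + 2) p - xV' * p"

text \<open>The half lines are treated separately because w may be singular at 0. As \<lambda> > -1,
  the factor x^(2 \<lambda> + 2) makes the boundary term vanish there; at infinity the exponential
  does.\<close>

lemma ibp_half_line: "(LINT x|lborel. indicator {0<..} x * (poly (ibp p) x * w x)) = 0"
proof -
  define G where "G = (\<lambda>x. poly p x * (x powr (2 * lam + 2) * exp (- V x)))"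
  have "(LBINT x=ereal 0..\<infinity>. poly (ibp p) x * w x) = 0 - 0"
  proof (rule interval_integral_FTC_integrable[where F = G])
    fix x assume "ereal 0 < ereal x" "ereal x < \<infinity>"
    then have x: "x > 0" by simp
    define s where "s = (\<Sum>k=1..m. t k * (real (2 * k) * x ^ (2 * k - 1)))"
    have Vd: "(V has_real_derivative s) (at x)"
      unfolding V_def s_def by (auto intro!: derivative_eq_intros sum.cong)
    have xV: "x * s = poly xV' x"
      unfolding s_def poly_xV' sum_distrib_left
    proof (intro sum.cong refl)
      fix k assume "k \<in> {1..m}"
      then have "x ^ (2 * k) = x * x ^ (2 * k - 1)" by (metis One_nat_def Suc_pred atLeastAtMost_iff mult_pos_pos not_gr_zero not_one_le_zero power_Suc zero_less_numeral)
      then show "x * (t k * (real (2 * k) * x ^ (2 * k - 1))) = 2 * real k * t k * x ^ (2 * k)" by simp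
    qed
    have pw: "x powr (2 * lam + 2) = x * x powr (2 * lam + 1)"
      using x powr_add[of x 1 "2 * lam + 1"] by (simp add: add.commute)
    have "(G has_real_derivative poly (pderiv p) x * (x powr (2 * lam + 2) * exp (- V x))
       + poly p x * ((2 * lam + 2) * x powr (2 * lam + 2 - 1) * exp (- V x)
          + x powr (2 * lam + 2) * (exp (- V x) * - s))) (at x)"
      unfolding G_def using x by (auto intro!: derivative_eq_intros Vd poly_DERIV)
    also have "poly (pderiv p) x * (x powr (2 * lam + 2) * exp (- V x))
       + poly p x * ((2 * lam + 2) * x powr (2 * lam + 2 - 1) * exp (- V x)
          + x powr (2 * lam + 2) * (exp (- V x) * - s))
      = poly (ibp p) x * w x"
      using x unfolding pw ibp_def w_eq by (simp add: xV[symmetric] algebra_simps)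
    finally show "(G has_vector_derivative poly (ibp p) x * w x) (at x)"
      by (simp add: has_real_derivative_iff_has_vector_derivative)
    have "isCont (\<lambda>x. poly (ibp p) x * (\<bar>x\<bar> powr (2 * lam + 1) * exp (- V x))) x"
      using x unfolding V_def by (intro continuous_intros) auto
    then show "isCont (\<lambda>x. poly (ibp p) x * w x) x" by (simp add: w_eq)
  next
    show "set_integrable lborel (einterval (ereal 0) \<infinity>) (\<lambda>x. poly (ibp p) x * w x)"
      unfolding set_integrable_def by (rule integrable_mult_indicator) (auto simp: integrable_poly_w)
  next
    have "((\<lambda>x. poly p x * (x powr (2 * lam + 2) * exp (- V x))) \<longlongrightarrow> poly p 0 * (0 * exp (- V 0))) (at_right 0)"
    proof (intro tendsto_mult tendsto_zero_powrI)
      show "(poly p \<longlongrightarrow> poly p 0) (at_right 0)"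
        using poly_isCont[where p = p and x = 0] unfolding isCont_def by (rule tendsto_mono[OF at_le[OF subset_UNIV]])
      show "((\<lambda>x. exp (- V x)) \<longlongrightarrow> exp (- V 0)) (at_right 0)"
        unfolding V_def by (intro tendsto_intros)
    qed (use lam in \<open>auto intro!: tendsto_intros simp: eventually_at_right_less eventually_at_filter\<close>)
    then show "((G \<circ> real_of_ereal) \<longlongrightarrow> 0) (at_right (ereal 0))"
      by (simp add: ereal_tendsto_simps G_def)
  next
    obtain C where C: "\<And>x. \<bar>x\<bar> \<le> C + V x" using V_lower_bound by blast
    have "((\<lambda>x. \<Sum>i\<le>degree p. exp C * \<bar>coeff p i\<bar> * (x powr (real i + 2 * lam + 2) * exp (- x))) \<longlongrightarrow> 0) at_top"
      by (intro tendsto_null_sum tendsto_mult_right_zero powr_exp_tendsto_0)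
    then have "(G \<longlongrightarrow> 0) at_top"
    proof (rule Lim_null_comparison[rotated])
      show "eventually (\<lambda>x. norm (G x) \<le> (\<Sum>i\<le>degree p. exp C * \<bar>coeff p i\<bar> * (x powr (real i + 2 * lam + 2) * exp (- x)))) at_top"
        using eventually_gt_at_top[of 0]
      proof eventually_elim
        case (elim x)
        have e: "exp (- V x) \<le> exp C * exp (- x)" using C[of x] elim by (simp add: exp_add[symmetric])
        have "norm (G x) = \<bar>\<Sum>i\<le>degree p. coeff p i * x ^ i\<bar> * (x powr (2 * lam + 2) * exp (- V x))"
          by (simp add: G_def abs_mult poly_altdef)
        also have "\<dots> \<le> (\<Sum>i\<le>degree p. \<bar>coeff p i\<bar> * x ^ i) * (x powr (2 * lam + 2) * (exp C * exp (- x)))"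
          using e elim by (intro mult_mono order_trans[OF sum_abs] sum_mono mult_left_mono sum_nonneg)
            (auto simp: abs_mult)
        also have "\<dots> = (\<Sum>i\<le>degree p. exp C * \<bar>coeff p i\<bar> * (x powr (real i + 2 * lam + 2) * exp (- x)))"
          unfolding sum_distrib_right using elim
          by (intro sum.cong refl) (simp add: powr_add powr_realpow mult_ac)
        finally show ?case .
      qed
    qed
    then show "((G \<circ> real_of_ereal) \<longlongrightarrow> 0) (at_left \<infinity>)" by (simp add: ereal_tendsto_simps)
  qed simp
  moreover have "einterval (ereal 0) \<infinity> = {0<..}" by (auto simp: einterval_def)
  ultimately show ?thesis
    by (simp add: interval_lebesgue_integral_def set_lebesgue_integral_def)
qed

text \<open>The functions x V' and w are even, and the map from p to x p' commutes with x -> - x, so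
  the negative half line reduces to the positive one.\<close>

theorem mom_ibp: "mom (ibp p) = 0"
proof -
  let ?q = "pcompose p [:0, -1:]"
  have dq: "poly (pderiv ?q) x = - poly (pderiv p) (- x)" for x
    by (simp add: pderiv_pcompose poly_pcompose pderiv_pCons)
  have "poly xV' (- x) = poly xV' x" for x by (simp add: poly_xV')
  then have refl: "poly (ibp ?q) x = poly (ibp p) (- x)" for x
    by (simp add: ibp_def dq poly_pcompose)
  define f where "f = (\<lambda>x. poly (ibp p) x * w x)"
  have f: "integrable lborel f" unfolding f_def by (rule integrable_poly_w)
  have i: "integrable lborel (\<lambda>x. indicator A x * f x)" if "A \<in> sets borel" for A :: "real set"
    using integrable_mult_indicator[OF _ f, of A] that by simp
  have "AE x in lborel. x \<notin> {0::real}" by (intro AE_not_in finite_imp_null_set_lborel) simp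
  then have "AE x in lborel. f x = indicator {0<..} x * f x + indicator {..<0} x * f x"
    by eventually_elim (auto simp: indicator_def)
  then have "mom (ibp p) = (LINT x|lborel. indicator {0<..} x * f x + indicator {..<0} x * f x)"
    unfolding mom_def f_def[symmetric] using f i[of "{0<..}"] i[of "{..<0}"]
    by (intro integral_cong_AE) auto
  also have "\<dots> = (LINT x|lborel. indicator {0<..} x * f x) + (LINT x|lborel. indicator {..<0} x * f x)"
    by (intro Bochner_Integration.integral_add i) auto
  also have "(LINT x|lborel. indicator {..<0} x * f x)
      = (LINT x|lborel. indicator {..<0} (0 + (-1) * x) * f (0 + (-1) * x))"
    by (subst lborel_integral_real_affine[of "-1" _ 0]) auto
  also have "\<dots> = (LINT x|lborel. indicator {0<..} x * (poly (ibp ?q) x * w x))"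
    by (intro Bochner_Integration.integral_cong refl) (auto simp: indicator_def f_def refl w_uminus)
  also have "\<dots> = 0" by (rule ibp_half_line)
  also have "(LINT x|lborel. indicator {0<..} x * f x) = 0" unfolding f_def by (rule ibp_half_line)
  finally show ?thesis by simp
qed

end

section \<open>Recurrence coefficients and the string equation\<close>

locale freud_recurrence = freud_weight +
  fixes P :: "nat \<Rightarrow> real poly" and \<beta> :: "nat \<Rightarrow> real"
  assumes orth: "monic_orthogonal w P" and three: "three_term P \<beta>"
begin

abbreviation "X \<equiv> [:0, 1:] :: real poly"

definition h :: "nat \<Rightarrow> real" where "h n = mom (P n * P n)"

lemma degree_P: "degree (P n) = n" and coeff_P: "coeff (P n) n = 1"
  using orth unfolding monic_orthogonal_def by metis+

lemma P_nonzero: "P n \<noteq> 0" using coeff_P[of n] by auto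

lemma h_pos: "h n > 0" unfolding h_def by (rule mom_square_pos[OF P_nonzero])

lemma mom_orth: "i \<noteq> j \<Longrightarrow> mom (P i * P j) = 0"
  using orth by (simp add: monic_orthogonal_def mom_def mult.assoc)

lemma \<beta>_0: "\<beta> 0 = 0" using three by (simp add: three_term_def)

lemma X_mult_P: "X * P n = P (Suc n) + smult (\<beta> n) (if n = 0 then 0 else P (n - 1))"
  using three unfolding three_term_def by blast

text \<open>The bound on q is by vanishing coefficients instead of \<open>degree\<close>, so that n
  = 0 means q = 0 and can start the induction.\<close>

lemma mom_P_lower: "(\<And>i. i \<ge> n \<Longrightarrow> coeff q i = 0) \<Longrightarrow> k \<ge> n \<Longrightarrow> mom (P k * q) = 0"
proof (induction n arbitrary: q)
  case 0
  then have "q = 0" by (intro poly_eqI) auto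
  then show ?case by simp
next
  case (Suc n)
  define q' where "q' = q - smult (coeff q n) (P n)"
  have "coeff q' i = 0" if "i \<ge> n" for i
    using that Suc.prems(1)[of i] coeff_P[of n] coeff_eq_0[of "P n" i] degree_P[of n]
    by (cases "i = n") (auto simp: q'_def)
  then have "mom (P k * q') = 0" using Suc.prems by (intro Suc.IH) auto
  moreover have "P k * q = P k * q' + smult (coeff q n) (P k * P n)"
    by (simp add: q'_def algebra_simps)
  ultimately show ?case using mom_orth[of k n] Suc.prems(2) by (simp add: mom_add mom_smult)
qed

lemma mom_P_monic:
  assumes "\<And>i. i > n \<Longrightarrow> coeff q i = 0"
  shows "mom (P n * q) = coeff q n * h n"
proof -
  have "mom (P n * (q - smult (coeff q n) (P n))) = 0"
  proof (rule mom_P_lower[of n])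
    fix i assume "i \<ge> n"
    then show "coeff (q - smult (coeff q n) (P n)) i = 0"
      using assms[of i] coeff_P[of n] coeff_eq_0[of "P n" i] degree_P[of n] by (cases "i = n") auto
  qed simp
  then show ?thesis by (simp add: h_def algebra_simps mom_diff mom_smult)
qed

text \<open>The pairing of x P_n with P_(n+1) is computed in two ways: by the leading coefficient
  and by the three-term recurrence.\<close>

lemma h_Suc: "h (Suc n) = \<beta> (Suc n) * h n"
proof -
  have "mom (P (Suc n) * (X * P n)) = coeff (X * P n) (Suc n) * h (Suc n)"
    using degree_P[of n] by (intro mom_P_monic) (auto simp: coeff_pCons split: nat.splits intro: coeff_eq_0)
  then have 1: "mom (P (Suc n) * (X * P n)) = h (Suc n)" by (simp add: coeff_P)
  have "P (Suc n) * (X * P n) = (X * P (Suc n)) * P n" by (simp add: mult_ac)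
  also have "\<dots> = P (Suc (Suc n)) * P n + smult (\<beta> (Suc n)) (P n * P n)"
    unfolding X_mult_P by (simp add: algebra_simps)
  finally have "mom (P (Suc n) * (X * P n)) = \<beta> (Suc n) * h n"
    using mom_orth[of "Suc (Suc n)" n] by (simp add: mom_add mom_smult h_def)
  then show ?thesis using 1 by simp
qed

lemma \<beta>_pos: "n \<ge> 1 \<Longrightarrow> \<beta> n > 0"
  using h_Suc[of "n - 1"] h_pos[of n] h_pos[of "n - 1"] by (auto simp: zero_less_mult_iff)

lemma \<beta>_nonneg: "\<beta> n \<ge> 0"
  using \<beta>_pos[of n] \<beta>_0 by (cases n) auto

definition a :: "nat \<Rightarrow> real" where "a n = sqrt (\<beta> n)"

lemma a_0: "a 0 = 0" by (simp add: a_def \<beta>_0)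

lemma sqrt_h_Suc: "sqrt (h (Suc n)) = a (Suc n) * sqrt (h n)"
  by (simp add: h_Suc a_def real_sqrt_mult)

text \<open>In the orthonormal basis P_n / sqrt (h n), multiplication by x is the Jacobi
  matrix.\<close>

lemma mom_power_P: "mom (X ^ j * (P n * P i)) = sqrt (h n) * sqrt (h i) * jacobi_pow a j n i"
proof (induction j arbitrary: n)
  case 0
  then show ?case using mom_orth[of n i] h_pos[of n] by (auto simp: h_def)
next
  case (Suc j)
  have eq: "X ^ Suc j * (P n * P i) = X ^ j * ((X * P n) * P i)" by (simp add: mult_ac)
  show ?case
  proof (cases n)
    case 0
    have "X ^ Suc j * (P n * P i) = X ^ j * (P (Suc n) * P i)"
      unfolding eq X_mult_P using 0 by simp
    then show ?thesis using 0 Suc[of "Suc n"] a_0 sqrt_h_Suc[of 0] by simp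
  next
    case (Suc n')
    have "X ^ Suc j * (P n * P i) = X ^ j * (P (Suc n) * P i) + smult (\<beta> n) (X ^ j * (P n' * P i))"
      unfolding eq X_mult_P using Suc by (simp add: algebra_simps)
    then have "mom (X ^ Suc j * (P n * P i)) = sqrt (h (Suc n)) * sqrt (h i) * jacobi_pow a j (Suc n) i
        + \<beta> n * (sqrt (h n') * sqrt (h i) * jacobi_pow a j n' i)"
      by (simp only: mom_add mom_smult Suc.IH)
    also have "\<beta> n = a n * a n" using \<beta>_nonneg[of n] by (simp add: a_def)
    also have "a n * a n * (sqrt (h n') * sqrt (h i) * jacobi_pow a j n' i)
        = sqrt (h n) * sqrt (h i) * (a n * jacobi_pow a j n' i)"
      using sqrt_h_Suc[of n'] Suc by simp
    finally show ?thesis using Suc sqrt_h_Suc[of n] by (simp add: algebra_simps)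
  qed
qed

lemma F_eq_mom:
  assumes "k \<ge> 1" "n \<ge> 1"
  shows "mom (X ^ (2 * k - 1) * (P n * P (n - 1))) = h (n - 1) * F \<beta> k n"
proof -
  have "F \<beta> k n = a n * jacobi_pow a (2 * k - 1) n (n - 1)"
    using F_eq_jacobi_pow[where \<beta> = \<beta>, OF \<beta>_0 \<beta>_nonneg assms(1), of n] by (simp add: a_def[abs_def])
  moreover have "sqrt (h n) = a n * sqrt (h (n - 1))" using sqrt_h_Suc[of "n - 1"] assms by simp
  ultimately show ?thesis unfolding mom_power_P using h_pos[of "n - 1"] by simp
qed

lemma F_sum_eq_mom:
  assumes "k \<ge> 1"
  shows "mom (X ^ (2 * k) * (P n * P n)) = h n * (F \<beta> k n + F \<beta> k (Suc n))"
proof -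
  have F: "F \<beta> k n = a n * jacobi_pow a (2 * k - 1) n (n - 1)" for n
    using F_eq_jacobi_pow[where \<beta> = \<beta>, OF \<beta>_0 \<beta>_nonneg assms, of n] by (simp add: a_def[abs_def])
  show ?thesis
    unfolding mom_power_P jacobi_pow_diag[where a = a, OF a_0 assms] F
    using h_pos[of n] by simp
qed

lemma poly_P_uminus: "poly (P n) (- x) = (- 1) ^ n * poly (P n) x"
proof (induction n rule: less_induct)
  case (less n)
  have rec: "poly (P (Suc j)) y = y * poly (P j) y - \<beta> j * (if j = 0 then 0 else poly (P (j - 1)) y)" for j y
    using arg_cong[OF X_mult_P[of j], of "\<lambda>p. poly p y"] by (auto split: if_splits)
  show ?case
  proof (cases n)
    case 0
    have "P 0 = [:coeff (P 0) 0:]" using degree_P[of 0] by (metis degree_0_id)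
    then have "P 0 = 1" using coeff_P[of 0] by (simp add: one_pCons)
    then show ?thesis using 0 by simp
  next
    case (Suc j)
    show ?thesis
    proof (cases j)
      case 0
      then show ?thesis using rec[of j] less[of j] Suc by simp
    next
      case (Suc i)
      then have r: "poly (P n) y = y * poly (P j) y - \<beta> j * poly (P i) y" for y
        using rec[of j y] \<open>n = Suc j\<close> by simp
      show ?thesis unfolding r[of "- x"] r[of x]
        using less[of j] less[of i] Suc \<open>n = Suc j\<close> by (simp add: algebra_simps)
    qed
  qed
qed

lemma P_odd_factor:
  assumes "odd n"
  shows "\<exists>Q. P n = X * Q"
proof -
  have "poly (P n) 0 = 0" using poly_P_uminus[of n 0] assms by simp
  then have "X dvd P n" by (simp add: poly_eq_0_iff_dvd)
  then show ?thesis by (auto elim: dvdE)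
qed

text \<open>Integration by parts is applied to p = P_n P_(n-1) / x, a polynomial because one factor
  is odd. The derivative of P_n P_(n-1) gives n h_(n-1), the potential gives h_(n-1) times the
  hierarchy, and (2 \<lambda> + 1) p gives \<Delta>_n h_(n-1).\<close>

theorem string_equation:
  assumes n: "n \<ge> 1"
  shows "hierarchy m t \<beta> n = real n + Delta lam n"
proof -
  define R where "R = P n * P (n - 1)"
  have cX: "coeff (X * Q) (Suc i) = coeff Q i" for Q i by simp
  have Q: "coeff Q i = coeff (P k) (Suc i)" if "P k = X * Q" for Q i k
    using cX[of Q i] that by simp
  have zero: "coeff (P k) i = 0" if "i > k" for i k using that degree_P[of k] by (intro coeff_eq_0) simp
  \<comment> \<open>For odd n the quotient P_n / x is monic of degree n - 1 and pairs with P_(n-1)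
    to h_(n-1). For even n the quotient P_(n-1) / x has degree below n and pairs with P_n to
    0.\<close>
  obtain p where p: "R = X * p" "(2 * lam + 1) * mom p = Delta lam n * h (n - 1)"
  proof (cases "odd n")
    case True
    then obtain Q where PQ: "P n = X * Q" using P_odd_factor by blast
    have "mom (P (n - 1) * Q) = coeff Q (n - 1) * h (n - 1)"
      by (rule mom_P_monic) (use n in \<open>auto simp: Q[OF PQ] zero\<close>)
    also have "coeff Q (n - 1) = 1" using n coeff_P[of n] by (simp add: Q[OF PQ])
    finally have mQ: "mom (P (n - 1) * Q) = h (n - 1)" by simp
    show ?thesis
    proof (rule that)
      show "R = X * (P (n - 1) * Q)" by (simp only: R_def PQ mult_ac)
      show "(2 * lam + 1) * mom (P (n - 1) * Q) = Delta lam n * h (n - 1)"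
        using True mQ by (simp add: Delta_odd)
    qed
  next
    case False
    then obtain Q where PQ: "P (n - 1) = X * Q" using P_odd_factor[of "n - 1"] n by auto
    have mQ: "mom (P n * Q) = 0"
      by (rule mom_P_lower[of n]) (auto simp: Q[OF PQ] zero)
    show ?thesis
    proof (rule that)
      show "R = X * (P n * Q)" by (simp only: R_def PQ mult_ac)
      show "(2 * lam + 1) * mom (P n * Q) = Delta lam n * h (n - 1)"
        using False mQ by (simp add: Delta_even)
    qed
  qed
  have "pderiv R = p + X * pderiv p" unfolding p(1) by (simp add: pderiv_pCons)
  \<comment> \<open>One of the 2 \<lambda> + 2 copies of p completes \<open>X * pderiv p\<close> to
    the derivative of \<open>X * p\<close>.\<close>
  moreover have "smult (2 * lam + 2) p = p + smult (2 * lam + 1) p"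
    by (rule poly_eqI) (simp add: algebra_simps)
  ultimately have "ibp p = pderiv R + smult (2 * lam + 1) p - xV' * p"
    by (simp add: ibp_def)
  then have ibp: "mom (pderiv R) + Delta lam n * h (n - 1) = mom (xV' * p)"
    using mom_ibp[of p] p(2) by (simp add: mom_add mom_diff mom_smult)
  have "mom (P (n - 1) * pderiv (P n)) = coeff (pderiv (P n)) (n - 1) * h (n - 1)"
    by (rule mom_P_monic) (use n in \<open>auto simp: coeff_pderiv zero\<close>)
  also have "coeff (pderiv (P n)) (n - 1) = real n" using n coeff_P[of n] by (simp add: coeff_pderiv)
  finally have 1: "mom (P (n - 1) * pderiv (P n)) = real n * h (n - 1)" .
  have 2: "mom (P n * pderiv (P (n - 1))) = 0"
    by (rule mom_P_lower[of n]) (auto simp: coeff_pderiv zero)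
  have dR: "mom (pderiv R) = real n * h (n - 1)"
    unfolding R_def pderiv_mult using 1 2 by (simp add: mom_add mult.commute)
  have "xV' * p = (\<Sum>k=1..m. smult (2 * real k * t k) (X ^ (2 * k - 1) * R))"
    unfolding xV'_def sum_distrib_right
  proof (intro sum.cong refl)
    fix k assume "k \<in> {1..m}"
    then have "X ^ (2 * k) = X ^ (2 * k - 1) * X"
      by (metis One_nat_def atLeastAtMost_iff mult_is_0 not_less_eq_eq power_minus_mult zero_less_iff_neq_zero zero_neq_numeral le0)
    then show "monom (2 * real k * t k) (2 * k) * p = smult (2 * real k * t k) (X ^ (2 * k - 1) * R)"
      unfolding p(1) monom_altdef by (simp only: mult_smult_left mult.assoc)
  qed
  then have "mom (xV' * p) = (\<Sum>k=1..m. 2 * real k * t k * mom (X ^ (2 * k - 1) * (P n * P (n - 1))))"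
    by (simp only: mom_sum mom_smult R_def)
  also have "\<dots> = (\<Sum>k=1..m. 2 * real k * t k * (h (n - 1) * F \<beta> k n))"
    by (intro sum.cong refl) (subst F_eq_mom[OF _ n], auto)
  also have "\<dots> = h (n - 1) * hierarchy m t \<beta> n"
    by (simp add: hierarchy_def sum_distrib_left mult_ac)
  finally have "h (n - 1) * hierarchy m t \<beta> n = h (n - 1) * (real n + Delta lam n)"
    using ibp dR by (simp add: algebra_simps)
  then show ?thesis using h_pos[of "n - 1"] by simp
qed

text \<open>The string equation at n and n + 1 evaluates the moment of x V' P_n^2 exactly, and x V'
  dominates x^(2 m); this bounds the top moment by a multiple of (n + 1) h_n. Lower moments follow
  by interpolation, and nonnegativity of F separates F_n from F_(n+1). The case k = 1 is the upper
  bound for \<beta>.\<close>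

lemma F_le_rscale: "\<exists>K\<ge>0. \<forall>n\<ge>1. \<forall>k\<in>{1..m}. F \<beta> k n \<le> K * rscale m n ^ k"
proof -
  obtain C where C: "C \<ge> 0" "\<And>x. real m * t m * x ^ (2 * m) \<le> C + poly xV' x"
    using xV'_lower_bound by blast
  define K where "K = (\<bar>2 * lam\<bar> + 3 + C) / (real m * t m)"
  have mt: "real m * t m > 0" using m tm by simp
  have K: "K \<ge> 0" using mt C by (simp add: K_def)
  have Fnn: "F \<beta> k n \<ge> 0" for k n by (rule F_nonneg[where \<beta> = \<beta>, OF \<beta>_0 \<beta>_nonneg])
  have "F \<beta> k n \<le> (1 + K) * rscale m n ^ k" if n: "n \<ge> 1" and k: "k \<in> {1..m}" for n k
  proof -
    let ?s = "rscale m n"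
    have s: "?s > 0" by (rule rscale_pos)
    have xV: "mom (xV' * (P n * P n)) = h n * (2 * real n + 2 * lam + 2)"
    proof -
      have "mom (xV' * (P n * P n)) = (\<Sum>k=1..m. 2 * real k * t k * (h n * (F \<beta> k n + F \<beta> k (Suc n))))"
        unfolding xV'_def sum_distrib_right mom_sum
        by (intro sum.cong refl) (simp add: monom_altdef mom_smult F_sum_eq_mom)
      also have "\<dots> = h n * (hierarchy m t \<beta> n + hierarchy m t \<beta> (Suc n))"
        unfolding hierarchy_def sum.distrib[symmetric] sum_distrib_left
        by (intro sum.cong refl) (simp add: algebra_simps)
      also have "\<dots> = h n * (2 * real n + 2 * lam + 2)"
        using n by (simp add: string_equation Delta_Suc)
      finally show ?thesis .
    qed
    have "real m * t m * mom (X ^ (2 * m) * (P n * P n)) = mom (smult (real m * t m) (X ^ (2 * m) * (P n * P n)))"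
      by (rule mom_smult[symmetric])
    also have "\<dots> \<le> mom (smult C (P n * P n) + xV' * (P n * P n))"
    proof (rule mom_mono)
      fix x
      have "real m * t m * x ^ (2 * m) * (poly (P n) x)\<^sup>2 \<le> (C + poly xV' x) * (poly (P n) x)\<^sup>2"
        by (intro mult_right_mono C) auto
      then show "poly (smult (real m * t m) (X ^ (2 * m) * (P n * P n))) x \<le> poly (smult C (P n * P n) + xV' * (P n * P n)) x"
        by (simp add: power2_eq_square algebra_simps)
    qed
    also have "\<dots> = h n * (C + (2 * real n + 2 * lam + 2))"
      by (simp only: mom_add mom_smult xV h_def[symmetric]) (simp add: algebra_simps)
    also have "\<dots> \<le> h n * ((\<bar>2 * lam\<bar> + 3 + C) * real (Suc n))"
    proof (intro mult_left_mono less_imp_le[OF h_pos])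
      have "\<bar>2 * lam\<bar> * 1 \<le> \<bar>2 * lam\<bar> * real (Suc n)" "C * 1 \<le> C * real (Suc n)"
        using C by (intro mult_left_mono; simp)+
      then have "C + (2 * real n + 2 * lam + 2) \<le> C * real (Suc n) + 3 * real (Suc n) + \<bar>2 * lam\<bar> * real (Suc n)"
        by simp
      then show "C + (2 * real n + 2 * lam + 2) \<le> (\<bar>2 * lam\<bar> + 3 + C) * real (Suc n)"
        by (simp add: algebra_simps)
    qed
    finally have "mom (X ^ (2 * m) * (P n * P n)) \<le> h n * (K * real (Suc n))"
      using mt by (simp add: K_def field_simps)
    then have top: "mom (X ^ (2 * m) * (P n * P n)) \<le> h n * (K * ?s ^ m)"
      by (simp only: rscale_power[OF m])
    have "mom (X ^ (2 * k) * (P n * P n)) \<le> mom (smult (?s ^ k) (P n * P n) + smult (?s ^ k / ?s ^ m) (X ^ (2 * m) * (P n * P n)))"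
    proof (rule mom_mono)
      fix x :: real
      \<comment> \<open>In this scale y^k <= 1 + y^m is the interpolation between the norm and the
        top moment.\<close>
      define y where "y = x\<^sup>2 / ?s"
      have y: "y \<ge> 0" using s by (simp add: y_def)
      have "y ^ k \<le> 1 + y ^ m"
      proof (cases "y \<le> 1")
        case True
        then have "y ^ k \<le> 1" using y by (simp add: power_le_one)
        moreover have "0 \<le> y ^ m" using y by simp
        ultimately show ?thesis by linarith
      next
        case False
        then have "y ^ k \<le> y ^ m" using k by (intro power_increasing) auto
        then show ?thesis by simp
      qed
      then have main: "?s ^ k * y ^ k * (poly (P n) x)\<^sup>2 \<le> ?s ^ k * (1 + y ^ m) * (poly (P n) x)\<^sup>2"
        using s by (intro mult_right_mono mult_left_mono) auto
      have yp: "y ^ j = x ^ (2 * j) / ?s ^ j" for j by (simp only: y_def power_divide power_mult)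
      have e1: "?s ^ k * y ^ k = x ^ (2 * k)" using s unfolding yp by simp
      have e2: "?s ^ k * (1 + y ^ m) = ?s ^ k + ?s ^ k / ?s ^ m * x ^ (2 * m)"
        unfolding yp by (simp add: distrib_left)
      have "poly (X ^ (2 * k) * (P n * P n)) x = x ^ (2 * k) * (poly (P n) x)\<^sup>2"
        by (simp add: power2_eq_square)
      also have "\<dots> \<le> (?s ^ k + ?s ^ k / ?s ^ m * x ^ (2 * m)) * (poly (P n) x)\<^sup>2"
        using main unfolding e1 e2 .
      also have "\<dots> = poly (smult (?s ^ k) (P n * P n) + smult (?s ^ k / ?s ^ m) (X ^ (2 * m) * (P n * P n))) x"
        by (simp add: power2_eq_square distrib_right)
      finally show "poly (X ^ (2 * k) * (P n * P n)) x \<le> poly (smult (?s ^ k) (P n * P n) + smult (?s ^ k / ?s ^ m) (X ^ (2 * m) * (P n * P n))) x" .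
    qed
    also have "\<dots> = ?s ^ k * h n + ?s ^ k / ?s ^ m * mom (X ^ (2 * m) * (P n * P n))"
      by (simp add: mom_add mom_smult h_def)
    also have "\<dots> \<le> ?s ^ k * h n + ?s ^ k / ?s ^ m * (h n * (K * ?s ^ m))"
      using s by (intro add_left_mono mult_left_mono top) auto
    also have "\<dots> = h n * ((1 + K) * ?s ^ k)" using s by (simp add: field_simps)
    finally have "h n * (F \<beta> k n + F \<beta> k (Suc n)) \<le> h n * ((1 + K) * ?s ^ k)"
      using k by (simp add: F_sum_eq_mom)
    then have "F \<beta> k n + F \<beta> k (Suc n) \<le> (1 + K) * ?s ^ k" using h_pos[of n] by simp
    then show ?thesis using Fnn[of k "Suc n"] by linarith
  qed
  then show ?thesis using K by (intro exI[of _ "1 + K"]) auto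
qed

end

text \<open>Every term of the recursion that is not subtracted has a factor \<beta> n. Keeping it
  gives a bound that can be read backwards, as a lower bound for \<beta> n.\<close>

lemma F_le_mult_first:
  fixes r :: "nat \<Rightarrow> real"
  assumes r: "\<And>n. r n \<ge> 0" "\<And>n. r n \<le> r (Suc n)" "\<And>n. r (Suc n) \<le> 2 * r n" and "C \<ge> 0" and "k \<ge> 1"
  shows "\<exists>D\<ge>0. \<forall>\<beta> n. \<beta> 0 = 0 \<longrightarrow> (\<forall>n. 0 \<le> \<beta> n \<and> \<beta> n \<le> C * r n) \<longrightarrow> F \<beta> k n \<le> \<beta> n * (D * r n ^ (k - 1))"
proof (cases "k = 1")
  case True
  then show ?thesis by (intro exI[of _ 1]) auto
next
  case False
  then obtain l where k: "k = Suc (Suc l)" using \<open>k \<ge> 1\<close> by (metis One_nat_def not0_implies_Suc not_one_le_zero)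
  have "\<forall>i. \<exists>D\<ge>0. \<forall>\<beta> n. \<beta> 0 = 0 \<longrightarrow> (\<forall>n. 0 \<le> \<beta> n \<and> \<beta> n \<le> C * r n) \<longrightarrow> F \<beta> i n \<le> D * r n ^ i"
    by (intro allI F_upper_bound r \<open>C \<ge> 0\<close>)
  then obtain D where D: "\<And>i. D i \<ge> 0"
    "\<And>i \<beta> n. \<beta> 0 = 0 \<Longrightarrow> (\<forall>n. 0 \<le> \<beta> n \<and> \<beta> n \<le> C * r n) \<Longrightarrow> F \<beta> i n \<le> D i * r n ^ i"
    by metis
  show ?thesis
  proof (intro exI conjI allI impI)
    show "step_const D l \<ge> 0" by (rule step_const_nonneg[OF D(1)])
    fix \<beta> :: "nat \<Rightarrow> real" and n
    assume \<beta>: "\<beta> 0 = 0" "\<forall>n. 0 \<le> \<beta> n \<and> \<beta> n \<le> C * r n"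
    have "F \<beta> (Suc (Suc l)) n \<le> \<beta> n * (step_const D l * r n ^ Suc l)"
      by (rule F_step_bound[where r = r]) (use r D \<beta> in auto)
    then show "F \<beta> k n \<le> \<beta> n * (step_const D l * r n ^ (k - 1))" by (simp add: k)
  qed
qed

lemma zeta_tendsto_0: "m \<ge> 1 \<Longrightarrow> (zeta m \<longlongrightarrow> 0) sequentially"
  unfolding zeta_def by (rule tendsto_neg_powr) (auto intro: filterlim_real_sequentially)

lemma zeta_power_eq: "n \<ge> 1 \<Longrightarrow> zeta m n ^ j = real n powr (- (real j / real m))"
  unfolding zeta_def by (subst powr_power) auto

text \<open>After division by z^s the coefficient of order s stands against terms that tend to 0;
  the coefficients therefore vanish one after another.\<close>

lemma zeta_expansion_unique:
  assumes m: "m \<ge> 1" and O: "(\<lambda>n. \<Sum>s\<le>S. e s * zeta m n ^ s) \<in> O(\<lambda>n. zeta m n ^ Suc S)" and s: "s \<le> S"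
  shows "e s = 0"
  using s
proof (induction s rule: less_induct)
  case (less s)
  let ?z = "zeta m"
  have eq: "(\<Sum>i\<le>S. e i * ?z n ^ i) = e s * ?z n ^ s + (\<Sum>i\<in>{Suc s..S}. e i * ?z n ^ i)" for n
  proof -
    have "(\<Sum>i\<le>S. e i * ?z n ^ i) = (\<Sum>i\<in>insert s {Suc s..S}. e i * ?z n ^ i)"
      by (rule sum.mono_neutral_right) (use less in auto)
    then show ?thesis by simp
  qed
  have "(\<lambda>n. \<Sum>i\<in>{Suc s..S}. e i * ?z n ^ i) \<in> O(\<lambda>n. ?z n ^ Suc s)"
  proof (intro big_sum_in_bigo)
    fix i assume "i \<in> {Suc s..S}"
    then have "(\<lambda>n. ?z n ^ i) \<in> O(\<lambda>n. ?z n ^ Suc s)" by (intro zeta_power_bigo) auto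
    then show "(\<lambda>n. e i * ?z n ^ i) \<in> O(\<lambda>n. ?z n ^ Suc s)"
      by (cases "e i = 0") (simp_all add: landau_o.big.cmult_in_iff del: power_Suc)
  qed
  moreover have "(\<lambda>n. \<Sum>i\<le>S. e i * ?z n ^ i) \<in> O(\<lambda>n. ?z n ^ Suc s)"
    by (rule landau_o.big.trans[OF O zeta_power_bigo]) (use less in auto)
  ultimately have "(\<lambda>n. e s * ?z n ^ s) \<in> O(\<lambda>n. ?z n ^ Suc s)"
    using sum_in_bigo(2) unfolding eq by fastforce
  then obtain C where "eventually (\<lambda>n. norm (e s * ?z n ^ s) \<le> C * norm (?z n ^ Suc s)) sequentially"
    by (rule landau_o.bigE)
  then have "eventually (\<lambda>n. \<bar>e s\<bar> \<le> C * ?z n) sequentially"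
    using eventually_ge_at_top[of 1]
  proof eventually_elim
    case (elim n)
    have "?z n > 0" using elim zeta_pos by auto
    then have p: "?z n ^ s > 0" by simp
    have "\<bar>e s\<bar> * ?z n ^ s \<le> C * ?z n * ?z n ^ s"
      using elim \<open>?z n > 0\<close> by (simp add: abs_mult power_abs mult_ac)
    then show ?case using p by (simp only: mult_le_cancel_right_pos)
  qed
  moreover have "((\<lambda>n. C * ?z n) \<longlongrightarrow> C * 0) sequentially"
    by (intro tendsto_mult zeta_tendsto_0 m) simp
  ultimately have "\<bar>e s\<bar> \<le> C * 0"
    by (intro tendsto_lowerbound[where f = "\<lambda>n. C * ?z n"]) auto
  then show ?case by simp
qed

context freud_recurrence
begin

text \<open>By the string equation the leading term is at least (s - G) s^(m - 1) with s =
  \<open>rscale m n\<close>, while F m n is at most \<beta> n D s^(m - 1). Division gives a bound of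
  order s once s >= 2 G; the finitely many other n are covered by positivity.\<close>

lemma rscale_le_\<beta>: "\<exists>c>0. \<forall>n\<ge>1. c * rscale m n \<le> \<beta> n"
proof -
  obtain K where K: "K \<ge> 0" "\<And>n k. n \<ge> 1 \<Longrightarrow> k \<in> {1..m} \<Longrightarrow> F \<beta> k n \<le> K * rscale m n ^ k"
    using F_le_rscale by blast
  have \<beta>K: "0 \<le> \<beta> n \<and> \<beta> n \<le> K * rscale m n" for n
  proof (cases "n = 0")
    case True
    then show ?thesis using K(1) less_imp_le[OF rscale_pos[of m 0]] by (simp add: \<beta>_0)
  next
    case False
    then show ?thesis using K(2)[of n 1] m \<beta>_nonneg by simp
  qed
  have "\<exists>D\<ge>0. \<forall>\<beta> n. \<beta> 0 = 0 \<longrightarrow> (\<forall>n. 0 \<le> \<beta> n \<and> \<beta> n \<le> K * rscale m n) \<longrightarrow>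
      F \<beta> m n \<le> \<beta> n * (D * rscale m n ^ (m - 1))"
    by (rule F_le_mult_first) (use m K in \<open>auto intro: less_imp_le[OF rscale_pos] rscale_mono rscale_Suc_le\<close>)
  then obtain D where D: "D \<ge> 0" "\<And>n. F \<beta> m n \<le> \<beta> n * (D * rscale m n ^ (m - 1))"
    using \<beta>_0 \<beta>K by blast
  define G where "G = 1 + \<bar>2 * lam + 1\<bar> + (\<Sum>k\<in>{1..<m}. 2 * real k * \<bar>t k\<bar> * K)"
  define c1 where "c1 = 1 / (4 * real m * t m * (D + 1))"
  have c1: "c1 > 0" using m tm D by (simp add: c1_def)
  have large: "c1 * rscale m n \<le> \<beta> n" if n: "n \<ge> 1" and s: "rscale m n \<ge> 2 * G" for n
  proof -
    let ?s = "rscale m n"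
    have s1: "?s \<ge> 1" by (rule rscale_ge_1)
    have top: "1 \<le> ?s ^ (m - 1)" using s1 by (rule one_le_power)
    have "\<bar>\<Sum>k\<in>{1..<m}. 2 * real k * t k * F \<beta> k n\<bar> \<le> (\<Sum>k\<in>{1..<m}. 2 * real k * \<bar>t k\<bar> * K * ?s ^ (m - 1))"
    proof (intro order_trans[OF sum_abs] sum_mono)
      fix k assume k: "k \<in> {1..<m}"
      have "F \<beta> k n \<le> K * ?s ^ k" using K(2)[OF n, of k] k by simp
      also have "\<dots> \<le> K * ?s ^ (m - 1)" using k s1 K by (intro mult_left_mono power_increasing) auto
      finally have "2 * real k * \<bar>t k\<bar> * F \<beta> k n \<le> 2 * real k * \<bar>t k\<bar> * (K * ?s ^ (m - 1))"
        by (intro mult_left_mono) auto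
      moreover have "F \<beta> k n \<ge> 0" by (rule F_nonneg[where \<beta> = \<beta>, OF \<beta>_0 \<beta>_nonneg])
      ultimately show "\<bar>2 * real k * t k * F \<beta> k n\<bar> \<le> 2 * real k * \<bar>t k\<bar> * K * ?s ^ (m - 1)"
        by (simp add: abs_mult mult.assoc)
    qed
    then have low: "(\<Sum>k\<in>{1..<m}. 2 * real k * t k * F \<beta> k n)
        \<le> (\<Sum>k\<in>{1..<m}. 2 * real k * \<bar>t k\<bar> * K) * ?s ^ (m - 1)"
      by (simp add: sum_distrib_right abs_le_iff)
    have "hierarchy m t \<beta> n = 2 * real m * t m * F \<beta> m n + (\<Sum>k\<in>{1..<m}. 2 * real k * t k * F \<beta> k n)"
      unfolding hierarchy_def by (rule split_top)
    then have "2 * real m * t m * F \<beta> m n = real n + Delta lam n - (\<Sum>k\<in>{1..<m}. 2 * real k * t k * F \<beta> k n)"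
      using string_equation[OF n] by simp
    moreover have "real n = ?s ^ m - 1" using rscale_power[OF m, of n] by simp
    moreover have "Delta lam n \<ge> - \<bar>2 * lam + 1\<bar>" by (cases "even n") (auto simp: Delta_even Delta_odd)
    moreover have "(1 + \<bar>2 * lam + 1\<bar>) * 1 \<le> (1 + \<bar>2 * lam + 1\<bar>) * ?s ^ (m - 1)"
      using top by (intro mult_left_mono) auto
    ultimately have "2 * real m * t m * F \<beta> m n \<ge> ?s ^ m - G * ?s ^ (m - 1)"
      using low by (simp add: G_def algebra_simps)
    also have "?s ^ m - G * ?s ^ (m - 1) = (?s - G) * ?s ^ (m - 1)"
      using m by (simp add: left_diff_distrib power_eq_if)
    finally have "(?s - G) * ?s ^ (m - 1) \<le> 2 * real m * t m * F \<beta> m n" .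
    also have "\<dots> \<le> 2 * real m * t m * (\<beta> n * (D * ?s ^ (m - 1)))"
      using tm D(2) by (intro mult_left_mono) auto
    also have "\<dots> = (2 * real m * t m * \<beta> n * D) * ?s ^ (m - 1)" by (simp add: mult_ac)
    finally have "?s - G \<le> 2 * real m * t m * \<beta> n * D"
      using top by (subst (asm) mult_le_cancel_right_pos) auto
    also have "\<dots> \<le> 2 * real m * t m * \<beta> n * (D + 1)"
      using tm \<beta>_nonneg[of n] by (intro mult_left_mono) auto
    finally have "?s / 2 \<le> 2 * real m * t m * \<beta> n * (D + 1)" using s by linarith
    then have "?s \<le> \<beta> n * (4 * real m * t m * (D + 1))" by (simp add: algebra_simps)
    moreover have "4 * real m * t m * (D + 1) > 0" using m tm D by simp
    ultimately have "?s / (4 * real m * t m * (D + 1)) \<le> \<beta> n" by (subst pos_divide_le_eq)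
    then show ?thesis by (simp add: c1_def)
  qed
  obtain n0 :: nat where n0: "(2 * G) ^ m \<le> real n0" using real_arch_simple by blast
  \<comment> \<open>\<open>insert 1\<close> keeps the set nonempty when n0 = 0.\<close>
  define c2 where "c2 = Min (insert 1 ((\<lambda>n. \<beta> n / rscale m n) ` {1..n0}))"
  have c2: "c2 > 0" unfolding c2_def by (subst Min_gr_iff) (auto intro!: divide_pos_pos \<beta>_pos rscale_pos)
  show ?thesis
  proof (intro exI[of _ "min c1 c2"] conjI allI impI)
    show "min c1 c2 > 0" using c1 c2 by simp
    fix n :: nat assume n: "n \<ge> 1"
    show "min c1 c2 * rscale m n \<le> \<beta> n"
    proof (cases "rscale m n \<ge> 2 * G")
      case True
      have "min c1 c2 * rscale m n \<le> c1 * rscale m n" using rscale_pos[of m n] by (intro mult_right_mono) auto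
      then show ?thesis using large[OF n True] by linarith
    next
      case False
      then have "rscale m n ^ m \<le> (2 * G) ^ m" by (intro power_mono less_imp_le[OF rscale_pos]) auto
      then have "n \<in> {1..n0}" using n0 n rscale_power[OF m, of n] by simp
      then have "c2 \<le> \<beta> n / rscale m n" unfolding c2_def by (intro Min_le) auto
      then have "c2 * rscale m n \<le> \<beta> n" using rscale_pos[of m n] by (simp add: field_simps)
      moreover have "min c1 c2 * rscale m n \<le> c2 * rscale m n" using rscale_pos[of m n] by (intro mult_right_mono) auto
      ultimately show ?thesis by linarith
    qed
  qed
qed

abbreviation "formal_\<beta> \<equiv> Abs_fps (formal_coeff m t lam)"

text \<open>The truncation of order S, divided by z, solves the hierarchy up to O(n^(1 - q)) with q
  = (S + 1) / m. \<open>approximate_solution_close\<close> turns this into an error O(n^(-q)) for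
  the logarithms, and exponentiating gives a relative error of order z^(S + 1).\<close>

theorem has_expansion_\<beta>: "has_expansion m lam S (\<lambda>n. \<beta> n * zeta m n) formal_\<beta>"
proof -
  let ?z = "zeta m"
  define T where "T = (\<lambda>n. \<Sum>s\<le>S. poly (fps_nth formal_\<beta> s) (Delta lam n) * ?z n ^ s)"
  define y where "y = (\<lambda>n. T n / ?z n)"
  define q where "q = real (Suc S) / real m"
  have q: "q > 0" using m by (simp add: q_def)
  have a0: "N1 m t > 0" by (rule N1_pos[where t = t and m = m, OF m tm])
  have yT: "eventually (\<lambda>n. y n * ?z n = T n) sequentially"
    using eventually_ge_at_top[of 1] by eventually_elim (simp add: y_def less_imp_neq[OF zeta_pos, symmetric])
  have y: "has_expansion m lam S (\<lambda>n. y n * ?z n) formal_\<beta>"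
    by (rule has_expansion_cong[OF has_expansion_truncation[of m lam S formal_\<beta>]])
      (use yT in \<open>auto simp: T_def elim: eventually_mono\<close>)
  have "has_expansion m lam S (\<lambda>n. 1 + poly [:0, 1:] (Delta lam n) * ?z n ^ m) (1 + fps_const [:0, 1:] * fps_X ^ m)"
    using has_expansion_add[OF has_expansion_const[of m lam S 1]
        has_expansion_mult[OF has_expansion_const[of m lam S "[:0, 1:]"] has_expansion_zeta_power[of m lam S m]]]
    by (simp only: poly_1 fps_const_1_eq_1)
  then have \<beta>H: "has_expansion m lam S (\<lambda>n. hierarchy m t \<beta> n * ?z n ^ m) (1 + fps_const [:0, 1:] * fps_X ^ m)"
  proof (rule has_expansion_cong)
    show "eventually (\<lambda>n. 1 + poly [:0, 1:] (Delta lam n) * ?z n ^ m = hierarchy m t \<beta> n * ?z n ^ m) sequentially"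
      using eventually_ge_at_top[of 1]
      by eventually_elim (simp add: string_equation zeta_power[OF m] add_divide_distrib)
  qed simp
  from has_expansion_diff[OF \<beta>H has_expansion_hierarchy[OF m y, of t]]
  have "has_expansion m lam S (\<lambda>n. hierarchy m t \<beta> n * ?z n ^ m - hierarchy m t y n * ?z n ^ m) 0"
    unfolding formal_hierarchy_exists[where t = t and m = m, OF m tm] by simp
  then have "(\<lambda>n. (hierarchy m t \<beta> n - hierarchy m t y n) * ?z n ^ m) \<in> O(\<lambda>n. ?z n ^ Suc S)"
    by (simp add: has_expansion_def left_diff_distrib)
  then obtain M where M: "M > 0" "eventually (\<lambda>n. norm ((hierarchy m t \<beta> n - hierarchy m t y n) * ?z n ^ m)
      \<le> M * norm (?z n ^ Suc S)) sequentially" by (rule landau_o.bigE)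
  have res: "eventually (\<lambda>n. \<bar>hierarchy m t \<beta> n - hierarchy m t y n\<bar>
      \<le> M * 2 powr \<bar>1 - q\<bar> * real (Suc n) powr (1 - q)) sequentially"
    using M(2) eventually_ge_at_top[of 1]
  proof eventually_elim
    case (elim n)
    have zm: "?z n ^ m = 1 / real n" by (rule zeta_power[OF m elim(2)])
    have zS: "?z n ^ Suc S = real n powr (- q)" unfolding q_def by (rule zeta_power_eq[OF elim(2)])
    have "\<bar>hierarchy m t \<beta> n - hierarchy m t y n\<bar> / real n \<le> M * real n powr (- q)"
      using elim(1) unfolding zm zS by (simp add: abs_mult)
    then have "\<bar>hierarchy m t \<beta> n - hierarchy m t y n\<bar> \<le> M * (real n powr (- q) * real n)"
      using elim by (simp add: field_simps)
    also have "real n powr (- q) * real n = real n powr (1 - q)"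
      using elim powr_add[of "real n" "- q" 1] by simp
    also have "M * real n powr (1 - q) \<le> M * (real (Suc n) powr (1 - q) * 2 powr \<bar>1 - q\<bar>)"
      using M(1) elim by (intro mult_left_mono powr_ratio_bound) auto
    finally show ?case by (simp add: mult_ac)
  qed
  \<comment> \<open>The leading coefficient is the positive constant \<open>N1 m t\<close>, so y has
    the order of growth that the comparison requires.\<close>
  have T0: "T \<longlonglongrightarrow> N1 m t"
  proof -
    have "(\<lambda>n. \<Sum>s\<in>{1..S}. poly (fps_nth formal_\<beta> s) (Delta lam n) * ?z n ^ s) \<in> O(\<lambda>n. 1 * ?z n ^ 1)"
      by (intro big_sum_in_bigo landau_o.big.mult poly_Delta_bigo zeta_power_bigo) auto
    then obtain C where C: "eventually (\<lambda>n. norm (\<Sum>s\<in>{1..S}. poly (fps_nth formal_\<beta> s) (Delta lam n) * ?z n ^ s)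
        \<le> C * norm (1 * ?z n ^ 1)) sequentially" by (rule landau_o.bigE)
    have "(\<lambda>n. \<Sum>s\<in>{1..S}. poly (fps_nth formal_\<beta> s) (Delta lam n) * ?z n ^ s) \<longlonglongrightarrow> 0"
    proof (rule Lim_null_comparison)
      show "eventually (\<lambda>n. norm (\<Sum>s\<in>{1..S}. poly (fps_nth formal_\<beta> s) (Delta lam n) * ?z n ^ s) \<le> C * ?z n) sequentially"
        using C by eventually_elim (simp add: zeta_nonneg)
      show "(\<lambda>n. C * ?z n) \<longlonglongrightarrow> 0" by (intro tendsto_mult_right_zero zeta_tendsto_0 m)
    qed
    from tendsto_add[OF tendsto_const[of "N1 m t"] this]
    have "(\<lambda>n. N1 m t + (\<Sum>s\<in>{1..S}. poly (fps_nth formal_\<beta> s) (Delta lam n) * ?z n ^ s)) \<longlonglongrightarrow> N1 m t" by simp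
    moreover have "T n = N1 m t + (\<Sum>s\<in>{1..S}. poly (fps_nth formal_\<beta> s) (Delta lam n) * ?z n ^ s)" for n
    proof -
      have "{..S} = insert 0 {1..S}" by auto
      then show ?thesis by (simp add: T_def formal_coeff.simps[of m t lam 0])
    qed
    ultimately show ?thesis by presburger
  qed
  have ev: "eventually (\<lambda>n. N1 m t / 2 < T n \<and> T n < 2 * N1 m t) sequentially"
    using order_tendstoD[OF T0, of "N1 m t / 2"] order_tendstoD[OF T0, of "2 * N1 m t"] a0
    by (auto intro: eventually_conj)
  \<comment> \<open>\<open>rscale\<close> is built from n + 1 and \<open>zeta\<close> from n, so
    they are reciprocal only up to a factor 2.\<close>
  have rz: "1 \<le> rscale m n * ?z n \<and> rscale m n * ?z n \<le> 2" if n: "n \<ge> 1" for n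
  proof -
    have rn: "?z n * real n powr (1 / real m) = 1" using n by (simp add: zeta_def powr_add[symmetric])
    have "real n powr (1 / real m) \<le> rscale m n" unfolding rscale_def by (intro powr_mono2) auto
    from mult_left_mono[OF this zeta_nonneg[of m n]] have 1: "1 \<le> rscale m n * ?z n" using rn by (simp add: mult.commute)
    have "rscale m n \<le> 2 * rscale m (n - 1)" using rscale_Suc_le[OF m, of "n - 1"] n by simp
    also have "rscale m (n - 1) = real n powr (1 / real m)" using n by (simp add: rscale_def)
    finally have "rscale m n * ?z n \<le> 2 * real n powr (1 / real m) * ?z n"
      by (intro mult_right_mono zeta_nonneg)
    also have "\<dots> = 2" using rn by (simp add: mult_ac)
    finally show ?thesis using 1 by simp
  qed
  obtain c0 where c0: "c0 > 0" "\<And>n. n \<ge> 1 \<Longrightarrow> c0 * rscale m n \<le> \<beta> n" using rscale_le_\<beta> by blast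
  obtain K where K: "K \<ge> 0" "\<And>n k. n \<ge> 1 \<Longrightarrow> k \<in> {1..m} \<Longrightarrow> F \<beta> k n \<le> K * rscale m n ^ k"
    using F_le_rscale by blast
  define c where "c = min c0 (N1 m t / 4)"
  define C where "C = max K (2 * N1 m t)"
  have cC: "c > 0" "C \<ge> 0" using c0 K a0 by (auto simp: c_def C_def)
  have xb: "c * rscale m n \<le> \<beta> n \<and> \<beta> n \<le> C * rscale m n" if n: "n \<ge> 1" for n
  proof -
    have "c * rscale m n \<le> c0 * rscale m n" "K * rscale m n \<le> C * rscale m n"
      using less_imp_le[OF rscale_pos[of m n]] by (auto simp: c_def C_def intro!: mult_right_mono)
    then show ?thesis using c0(2)[OF n] K(2)[OF n, of 1] m by simp
  qed
  have yb: "eventually (\<lambda>n. c * rscale m n \<le> y n \<and> y n \<le> C * rscale m n) sequentially"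
    using ev eventually_ge_at_top[of 1]
  proof eventually_elim
    case (elim n)
    have z: "?z n > 0" using elim zeta_pos by auto
    have "c * (rscale m n * ?z n) \<le> N1 m t / 4 * 2"
      using rz[of n] elim a0 cC by (intro mult_mono) (auto simp: c_def)
    then have 1: "c * rscale m n * ?z n \<le> T n" using elim by (simp add: mult.assoc)
    have "2 * N1 m t * 1 \<le> C * (rscale m n * ?z n)"
      using rz[of n] elim a0 cC by (intro mult_mono) (auto simp: C_def)
    then have "T n \<le> C * rscale m n * ?z n" using elim by (simp add: mult.assoc)
    then show ?case using 1 z by (simp add: y_def field_simps)
  qed
  obtain L where L: "eventually (\<lambda>n. \<bar>ln (\<beta> n) - ln (y n)\<bar> \<le> L * real (Suc n) powr (- q)) sequentially"
    using approximate_solution_close[where t = t and m = m and x = \<beta>, OF m tm cC \<beta>_0 xb yb res] by blast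
  have "eventually (\<lambda>n. norm (\<beta> n * ?z n - T n) \<le> 2 * N1 m t * (exp \<bar>L\<bar> * \<bar>L\<bar>) * norm (?z n ^ Suc S)) sequentially"
    using L ev eventually_ge_at_top[of 1]
  proof eventually_elim
    case (elim n)
    define d where "d = ln (\<beta> n) - ln (y n)"
    have z: "?z n > 0" using elim zeta_pos by auto
    have T: "T n > 0" using elim a0 by linarith
    have yp: "y n > 0" using z T by (simp add: y_def)
    have bp: "\<beta> n > 0" using elim \<beta>_pos by auto
    have "\<beta> n = y n * exp d" using yp bp by (simp add: d_def exp_diff)
    then have bT: "\<beta> n * ?z n - T n = T n * (exp d - 1)" using z by (simp add: y_def algebra_simps)
    have "real (Suc n) powr (- q) \<le> 1" using q powr_mono[of "- q" 0 "real (Suc n)"] by simp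
    moreover have d: "\<bar>d\<bar> \<le> \<bar>L\<bar> * real (Suc n) powr (- q)"
      using elim by (auto simp: d_def intro: order_trans mult_right_mono)
    ultimately have dL: "\<bar>d\<bar> \<le> \<bar>L\<bar>"
      using mult_left_mono[of "real (Suc n) powr (- q)" 1 "\<bar>L\<bar>"] by simp
    have "\<bar>exp d - 1\<bar> \<le> exp \<bar>d\<bar> * \<bar>d\<bar>"
    proof (cases "d \<ge> 0")
      case True
      have "exp d * (1 - d) \<le> exp d * exp (- d)" using exp_ge_add_one_self[of "- d"] by (intro mult_left_mono) auto
      then show ?thesis using True by (simp add: exp_minus algebra_simps)
    next
      case False
      have "1 - exp d \<le> - d" using exp_ge_add_one_self[of d] by linarith
      also have "\<dots> \<le> exp \<bar>d\<bar> * \<bar>d\<bar>" using False mult_right_mono[of 1 "exp \<bar>d\<bar>" "\<bar>d\<bar>"] by simp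
      finally show ?thesis using False by simp
    qed
    also have "\<dots> \<le> exp \<bar>L\<bar> * (\<bar>L\<bar> * real (Suc n) powr (- q))" using dL d by (intro mult_mono) auto
    also have "\<dots> \<le> exp \<bar>L\<bar> * (\<bar>L\<bar> * ?z n ^ Suc S)"
    proof -
      have "real (Suc n) powr (- q) \<le> real n powr (- q)" using elim q by (intro powr_mono2') auto
      also have "\<dots> = ?z n ^ Suc S" unfolding q_def using elim(3) by (rule zeta_power_eq[symmetric])
      finally show ?thesis by (intro mult_left_mono) auto
    qed
    finally have e: "\<bar>exp d - 1\<bar> \<le> exp \<bar>L\<bar> * (\<bar>L\<bar> * ?z n ^ Suc S)" .
    have "norm (\<beta> n * ?z n - T n) = T n * \<bar>exp d - 1\<bar>" unfolding bT using T by (simp add: abs_mult)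
    also have "\<dots> \<le> 2 * N1 m t * (exp \<bar>L\<bar> * (\<bar>L\<bar> * ?z n ^ Suc S))"
      using e elim T by (intro mult_mono) auto
    finally show ?case using z by (simp add: mult_ac)
  qed
  then show ?thesis unfolding has_expansion_def T_def by (rule bigoI)
qed

end

section \<open>The expansion of the recurrence coefficients\<close>

text \<open>The recursion determines G k for k <= m from G 1, so a formal solution amounts to one
  series subject to one equation.\<close>

lemma formal_solution_iff:
  fixes t :: "nat \<Rightarrow> real" and a :: "nat \<Rightarrow> nat \<Rightarrow> real" and b :: "nat \<Rightarrow> nat \<Rightarrow> real poly"
  assumes m: "m \<ge> 1"
  defines "G \<equiv> ansatz m t a b"
  shows "formal_solution m t lam a b \<longleftrightarrow> (\<forall>k\<in>{1..m}. G k = formal_F m lam (G 1) k) \<and>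
    formal_hierarchy m t lam (G 1) = 1 + fps_const [:0, 1:] * fps_X ^ m"
proof -
  define rec where "rec = (\<lambda>k. G 1 * (shift_fps m lam (-1) (k - 1) (G (k - 1)) + 2 * G (k - 1) + shift_fps m lam 1 (k - 1) (G (k - 1)))
     + G 1 * (\<Sum>i\<in>{1..k - 2}. (G i + shift_fps m lam 1 i (G i))
         * (shift_fps m lam (-1) (k - 1 - i) (G (k - 1 - i)) + G (k - 1 - i)))
     - (\<Sum>i\<in>{1..k - 1}. G i * G (k - i)))"
  have step: "formal_F m lam (G 1) k = rec k"
    if k: "k \<ge> 2" and IH: "\<And>i. 1 \<le> i \<Longrightarrow> i < k \<Longrightarrow> G i = formal_F m lam (G 1) i" for k
  proof -
    obtain l where l: "k = Suc (Suc l)" using k by (metis Suc_le_D numeral_2_eq_2 Suc_le_mono)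
    have 1: "formal_F m lam (G 1) i = G i" if "i \<in> {1..Suc l}" for i using IH[of i] that l by auto
    have 2: "formal_F m lam (G 1) (Suc (Suc l) - i) = G (Suc (Suc l) - i)" if "i \<in> {1..Suc l}" for i
      by (rule 1) (use that in auto)
    show ?thesis unfolding l rec_def formal_F.simps
      by (intro arg_cong2[where f = "(-)"] arg_cong2[where f = "(+)"] arg_cong2[where f = "(*)"] sum.cong refl)
        (use 1 2 in auto)
  qed
  have eq: "(\<forall>k\<in>{2..m}. G k = rec k) \<longleftrightarrow> (\<forall>k\<in>{1..m}. G k = formal_F m lam (G 1) k)"
  proof
    assume A: "\<forall>k\<in>{2..m}. G k = rec k"
    have "1 \<le> k \<Longrightarrow> k \<le> m \<Longrightarrow> G k = formal_F m lam (G 1) k" for k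
    proof (induction k rule: less_induct)
      case (less k)
      show ?case
      proof (cases "k = 1")
        case False
        then have k: "k \<ge> 2" "k \<in> {2..m}" using less.prems by auto
        have "formal_F m lam (G 1) k = rec k"
        proof (rule step[OF k(1)])
          fix i assume "1 \<le> i" "i < k"
          with less.prems show "G i = formal_F m lam (G 1) i" by (intro less.IH) linarith+
        qed
        with A k(2) show ?thesis by (metis (no_types))
      qed simp
    qed
    then show "\<forall>k\<in>{1..m}. G k = formal_F m lam (G 1) k" by (intro ballI) (metis atLeastAtMost_iff)
  next
    assume B: "\<forall>k\<in>{1..m}. G k = formal_F m lam (G 1) k"
    show "\<forall>k\<in>{2..m}. G k = rec k"
    proof
      fix k assume k: "k \<in> {2..m}"
      have "formal_F m lam (G 1) k = rec k"
      proof (rule step)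
        fix i assume "1 \<le> i" "i < k"
        then have "i \<in> {1..m}" using k by auto
        with B show "G i = formal_F m lam (G 1) i" by (rule bspec)
      qed (use k in auto)
      moreover have "k \<in> {1..m}" using k by auto
      ultimately show "G k = rec k" using B by (metis (no_types))
    qed
  qed
  have hier: "(\<Sum>k=1..m. fps_const [:2 * real k * t k:] * fps_X ^ (m - k) * G k) = formal_hierarchy m t lam (G 1)"
    if "\<forall>k\<in>{1..m}. G k = formal_F m lam (G 1) k"
    unfolding formal_hierarchy_def by (intro sum.cong refl arg_cong2[where f = "(*)"] bspec[OF that])
  have "formal_solution m t lam a b \<longleftrightarrow> (\<forall>k\<in>{2..m}. G k = rec k) \<and>
      (\<Sum>k=1..m. fps_const [:2 * real k * t k:] * fps_X ^ (m - k) * G k) = 1 + fps_const [:0, 1:] * fps_X ^ m"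
    unfolding formal_solution_def Let_def G_def[symmetric] rec_def ..
  also have "\<dots> \<longleftrightarrow> (\<forall>k\<in>{1..m}. G k = formal_F m lam (G 1) k) \<and>
      formal_hierarchy m t lam (G 1) = 1 + fps_const [:0, 1:] * fps_X ^ m"
    by (rule conj_cong[OF eq]) (subst hier, assumption, rule refl)
  finally show ?thesis .
qed

lemma formal_F_nth_0:
  assumes "m \<ge> 1" "k \<ge> 1" "fps_nth g 0 = [:x:]"
  shows "fps_nth (formal_F m lam g k) 0 = [:limit_coeff x k:]"
proof -
  have "first_diff 1 g g [:x:] 0" using assms(3) by (simp add: first_diff_def)
  from first_diff_formal_F[OF assms(1) _ this assms(2)] show ?thesis by (simp add: first_diff_def)
qed

text \<open>Below order m the formal coefficients are constants, so both expansions of \<beta> are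
  in powers of z alone and their coefficients can be compared.\<close>

lemma (in freud_recurrence) beta_expansion_unique:
  assumes "beta_expansion m t \<beta> d" and s: "s \<in> {1..m - 1}"
  shows "formal_coeff m t lam s = [:N1 m t * d s:]"
proof -
  let ?z = "zeta m"
  define e where "e = (\<lambda>s. coeff (formal_coeff m t lam s) 0 / N1 m t - (if s = 0 then 1 else d s))"
  have a0: "N1 m t > 0" by (rule N1_pos[where t = t and m = m, OF m tm])
  have const: "formal_coeff m t lam s = [:coeff (formal_coeff m t lam s) 0:]" if "s < m" for s
    using formal_coeff_const[OF m that, of t lam lam] by (metis degree_0_id)
  have A: "A m t > 0" unfolding A_def using m tm Gamma_real_pos[of "1 / 2"]
    by (intro divide_pos_pos mult_pos_pos Gamma_real_pos) (auto simp del: Gamma_one_half_real)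
  \<comment> \<open>The two normalisations of the leading term agree because 4^m A_m is the
    reciprocal of N1^m.\<close>
  have scale: "(real n / (4 ^ m * A m t)) powr (1 / real m) = N1 m t / ?z n" if n: "n \<ge> 1" for n
  proof -
    have "(real n / (4 ^ m * A m t)) powr (1 / real m)
        = real n powr (1 / real m) * ((1 / 4) ^ m) powr (1 / real m) * (1 / A m t) powr (1 / real m)"
      using A by (simp add: powr_mult[symmetric] power_one_over)
    also have "((1 / 4) ^ m) powr (1 / real m) = (1 / 4 :: real)"
      using m by (simp add: powr_realpow[symmetric] powr_powr)
    also have "1 / A m t = Gamma (1 / 2) * Gamma (real m) / (t m * Gamma (real m + 1 / 2))"
      by (simp add: A_def)
    also have "real n powr (1 / real m) * (1 / 4) * (Gamma (1 / 2) * Gamma (real m) / (t m * Gamma (real m + 1 / 2))) powr (1 / real m)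
        = N1 m t / ?z n"
      using n by (simp add: N1_def zeta_def powr_minus_divide)
    finally show ?thesis .
  qed
  have "(\<lambda>n. \<beta> n * ?z n - (\<Sum>s\<le>m - 1. poly (fps_nth formal_\<beta> s) (Delta lam n) * ?z n ^ s)) \<in> O(\<lambda>n. ?z n ^ Suc (m - 1))"
    using has_expansion_\<beta>[of "m - 1"] by (simp only: has_expansion_def)
  moreover have "(\<Sum>s\<le>m - 1. poly (fps_nth formal_\<beta> s) (Delta lam n) * ?z n ^ s)
      = (\<Sum>s\<le>m - 1. coeff (formal_coeff m t lam s) 0 * ?z n ^ s)" for n
  proof (intro sum.cong refl)
    fix s assume "s \<in> {..m - 1}"
    then have "s < m" using m by auto
    then show "poly (fps_nth formal_\<beta> s) (Delta lam n) * ?z n ^ s = coeff (formal_coeff m t lam s) 0 * ?z n ^ s"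
      using arg_cong[OF const, of s "\<lambda>p. poly p (Delta lam n)"] by simp
  qed
  ultimately have O1: "(\<lambda>n. (1 / N1 m t) * (\<beta> n * ?z n - (\<Sum>s\<le>m - 1. coeff (formal_coeff m t lam s) 0 * ?z n ^ s))) \<in> O(\<lambda>n. ?z n ^ Suc (m - 1))"
    using a0 by simp
  have "(\<lambda>n. \<beta> n / (real n / (4 ^ m * A m t)) powr (1 / real m)
      - (1 + (\<Sum>i=1..m - 1. d i * real n powr (- (real i / real m))))) \<in> O(\<lambda>n. real n powr (- (real (m - 1 + 1) / real m)))"
    using assms(1) unfolding beta_expansion_def by blast
  then have O2: "(\<lambda>n. \<beta> n * ?z n / N1 m t - (1 + (\<Sum>i=1..m - 1. d i * ?z n ^ i))) \<in> O(\<lambda>n. ?z n ^ Suc (m - 1))"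
  proof (rule landau_o.big.cong_ex[THEN iffD1, rotated -1])
    show "eventually (\<lambda>n. \<beta> n / (real n / (4 ^ m * A m t)) powr (1 / real m)
        - (1 + (\<Sum>i=1..m - 1. d i * real n powr (- (real i / real m))))
        = \<beta> n * ?z n / N1 m t - (1 + (\<Sum>i=1..m - 1. d i * ?z n ^ i))) sequentially"
      using eventually_ge_at_top[of 1] by eventually_elim (simp add: scale zeta_power_eq)
    show "eventually (\<lambda>n. real n powr (- (real (m - 1 + 1) / real m)) = ?z n ^ Suc (m - 1)) sequentially"
      using eventually_ge_at_top[of 1] by eventually_elim (simp add: zeta_power_eq del: power_Suc)
  qed
  note sum_in_bigo(2)[OF O2 O1]
  moreover have "(\<beta> n * ?z n / N1 m t - (1 + (\<Sum>i=1..m - 1. d i * ?z n ^ i)))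
      - (1 / N1 m t) * (\<beta> n * ?z n - (\<Sum>s\<le>m - 1. coeff (formal_coeff m t lam s) 0 * ?z n ^ s))
      = (\<Sum>s\<le>m - 1. e s * ?z n ^ s)" for n
  proof -
    have "{..m - 1} = insert 0 {1..m - 1}" by auto
    then have "1 + (\<Sum>i=1..m - 1. d i * ?z n ^ i) = (\<Sum>s\<le>m - 1. (if s = 0 then 1 else d s) * ?z n ^ s)"
      by simp
    then show ?thesis
      by (simp add: e_def left_diff_distrib sum_subtractf right_diff_distrib sum_distrib_left sum_divide_distrib)
  qed
  ultimately have "(\<lambda>n. \<Sum>s\<le>m - 1. e s * ?z n ^ s) \<in> O(\<lambda>n. ?z n ^ Suc (m - 1))" by (simp only:)
  from zeta_expansion_unique[OF m this, of s] s have "e s = 0" by auto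
  then have "coeff (formal_coeff m t lam s) 0 = N1 m t * d s" using s a0 by (simp add: e_def field_simps)
  moreover have "s < m" using s by auto
  ultimately show ?thesis using const[of s] by simp
qed

text \<open>Uniqueness is relative to the coefficients of order 0, where the hierarchy has degree m
  in the leading coefficient; from order 1 on it is affine in the new coefficient. It concerns the
  sum of a and b, because the formal equations see only that sum.\<close>

theorem theorem8:
  fixes m :: nat and t :: "nat \<Rightarrow> real" and lam :: real
    and P :: "nat \<Rightarrow> real poly" and \<beta> :: "nat \<Rightarrow> real"
  assumes "m \<ge> 1" and "t m > 0" and "lam > -1"
    and "monic_orthogonal (weight m t lam) P" and "three_term P \<beta>"
  shows "\<exists>(a :: nat \<Rightarrow> nat \<Rightarrow> real) (b :: nat \<Rightarrow> nat \<Rightarrow> real poly).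
    formal_solution m t lam a b \<and>
    (\<forall>a' b'. formal_solution m t lam a' b' \<and>
             (\<forall>k\<in>{1..m}. [:a' 0 k:] + b' 0 k = [:a 0 k:] + b 0 k)
        \<longrightarrow> (\<forall>s. \<forall>k\<in>{1..m}. [:a' s k:] + b' s k = [:a s k:] + b s k)) \<and>
    (\<forall>p\<ge>1. \<forall>k\<in>{1..m}. (\<lambda>n. E m t lam \<beta> a b p k n) \<in> O(\<lambda>_. 1)) \<and>
    (\<forall>k\<in>{1..m}. a 0 k = 1) \<and>
    (\<forall>P' \<beta>' d. monic_orthogonal (weight m t (- 1 / 2)) P' \<and> three_term P' \<beta>' \<and>
               beta_expansion m t \<beta>' d
        \<longrightarrow> (\<forall>s\<in>{1..m - 1}. a s 1 = d s)) \<and>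
    (\<forall>s\<ge>1. \<forall>k\<in>{1..m}. poly (b s k) 0 = 0) \<and>
    (\<forall>s\<in>{1..m - 1}. \<forall>k\<in>{1..m}. b s k = 0)"
proof -
  interpret freud_recurrence m t lam P \<beta> by unfold_locales (use assms in auto)
  define g where "g = formal_\<beta>"
  define c where "c = (\<lambda>s k. smult (1 / N m t k) (fps_nth (formal_F m lam g k) s))"
  \<comment> \<open>Taking for a the value at \<Delta> = 0 and for b the rest makes (iii) hold by
    construction.\<close>
  define a where "a = (\<lambda>s k. coeff (c s k) 0)"
  define b where "b = (\<lambda>s k. c s k - [:a s k:])"
  have ab: "[:a s k:] + b s k = c s k" for s k by (simp add: b_def)
  have Np: "N m t k > 0" for k by (rule N_pos[where t = t and m = m, OF m tm])
  have a0: "N1 m t > 0" by (rule N1_pos[where t = t and m = m, OF m tm])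
  have N1: "N m t (Suc 0) = N1 m t" by (simp add: N_def)
  have g0: "fps_nth g 0 = [:N1 m t:]" by (simp add: g_def formal_coeff.simps[of m t lam 0])
  have G: "ansatz m t a b k = formal_F m lam g k" for k
    by (rule fps_ext) (use Np[of k] in \<open>simp add: ansatz_def ab c_def\<close>)
  have G1: "ansatz m t a b 1 = g" by (simp add: G)
  have hier: "formal_hierarchy m t lam g = 1 + fps_const [:0, 1:] * fps_X ^ m"
    unfolding g_def by (rule formal_hierarchy_exists[where t = t and m = m, OF m tm])
  have sol: "formal_solution m t lam a b"
    unfolding formal_solution_iff[OF m] G1 using G hier by simp
  have c0: "c 0 k = [:1:]" if "k \<ge> 1" for k
    using formal_F_nth_0[OF m that g0] Np[of k] by (simp add: c_def N_eq_limit_coeff[OF that])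
  have unique: "[:a' s k:] + b' s k = [:a s k:] + b s k"
    if sol': "formal_solution m t lam a' b'" and z: "\<forall>k\<in>{1..m}. [:a' 0 k:] + b' 0 k = [:a 0 k:] + b 0 k"
      and k: "k \<in> {1..m}" for a' b' s k
  proof -
    let ?g' = "ansatz m t a' b' 1"
    have "[:a' 0 1:] + b' 0 1 = [:1:]" using z m c0[of 1] by (simp add: ab)
    then have g'0: "fps_nth ?g' 0 = [:N1 m t:]" by (simp add: ansatz_def N1)
    note sol'' = sol'[unfolded formal_solution_iff[OF m]]
    have G': "ansatz m t a' b' k = formal_F m lam ?g' k" by (rule bspec[OF conjunct1[OF sol''] k])
    have h': "formal_hierarchy m t lam ?g' = 1 + fps_const [:0, 1:] * fps_X ^ m" by (rule conjunct2[OF sol''])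
    have g': "?g' = g" by (rule formal_hierarchy_unique[where t = t and m = m, OF m tm a0 g'0 g0]) (rule trans[OF h' hier[symmetric]])
    have "fps_nth (ansatz m t a' b' k) s = fps_nth (ansatz m t a b k) s" unfolding G' G g' ..
    then have "smult (N m t k) ([:a' s k:] + b' s k) = smult (N m t k) ([:a s k:] + b s k)"
      by (simp add: ansatz_def)
    from arg_cong[OF this, of "smult (1 / N m t k)"] show ?thesis
      using Np[of k] by (simp only: smult_smult) simp
  qed
  have E: "(\<lambda>n. E m t lam \<beta> a b p k n) \<in> O(\<lambda>_. 1)" for p k
  proof -
    have "has_expansion m lam p (\<lambda>n. F \<beta> k n * zeta m n ^ k) (formal_F m lam g k)"
      unfolding g_def by (rule has_expansion_F[OF m has_expansion_\<beta>])
    then obtain M where M: "eventually (\<lambda>n. norm (F \<beta> k n * zeta m n ^ k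
        - (\<Sum>s\<le>p. poly (fps_nth (formal_F m lam g k) s) (Delta lam n) * zeta m n ^ s)) \<le> M * norm (zeta m n ^ Suc p)) sequentially"
      unfolding has_expansion_def by (rule landau_o.bigE)
    show ?thesis
    proof (rule bigoI[where c = "M / N m t k"])
      show "eventually (\<lambda>n. norm (E m t lam \<beta> a b p k n) \<le> M / N m t k * norm (1::real)) sequentially"
        using M eventually_ge_at_top[of 1]
      proof eventually_elim
        case (elim n)
        have z: "zeta m n > 0" using elim zeta_pos by auto
        have pw: "real n powr (real j / real m) = 1 / zeta m n ^ j" for j
          unfolding zeta_power_eq[OF elim(2)] by (simp add: powr_minus_divide)
        let ?R = "F \<beta> k n * zeta m n ^ k - (\<Sum>s\<le>p. poly (fps_nth (formal_F m lam g k) s) (Delta lam n) * zeta m n ^ s)"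
        have "a s k + poly (b s k) x = poly (fps_nth (formal_F m lam g k) s) x / N m t k" for s x
        proof -
          have "a s k + poly (b s k) x = poly (c s k) x" unfolding ab[symmetric] by simp
          then show ?thesis by (simp add: c_def)
        qed
        then have "E m t lam \<beta> a b p k n = 1 / zeta m n ^ Suc p * (1 / N m t k * ?R)"
          unfolding E_def Suc_eq_plus1[symmetric] pw
          by (simp add: right_diff_distrib sum_distrib_left atLeast0AtMost mult_ac del: power_Suc)
        also have "norm \<dots> = 1 / zeta m n ^ Suc p * (1 / N m t k * norm ?R)"
          using z Np[of k] by (simp add: abs_mult)
        also have "\<dots> \<le> 1 / zeta m n ^ Suc p * (1 / N m t k * (M * zeta m n ^ Suc p))"
          using elim(1) z Np[of k] by (intro mult_left_mono) (auto simp: abs_mult)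
        also have "\<dots> = M / N m t k" using z by simp
        finally show ?case by simp
      qed
    qed
  qed
  \<comment> \<open>Below order m the coefficients do not depend on \<lambda>, so they may be read
    off at \<lambda> = -1/2, where the given expansion applies.\<close>
  have ii: "a s 1 = d s"
    if "monic_orthogonal (weight m t (- 1 / 2)) P'" "three_term P' \<beta>'" "beta_expansion m t \<beta>' d" "s \<in> {1..m - 1}"
    for P' \<beta>' d s
  proof -
    interpret F': freud_recurrence m t "- 1 / 2" P' \<beta>' by unfold_locales (use m tm that in auto)
    have "formal_coeff m t lam s = formal_coeff m t (- 1 / 2) s"
      using formal_coeff_const[OF m, of s t lam "- 1 / 2"] that(4) by auto
    also have "\<dots> = [:N1 m t * d s:]" by (rule F'.beta_expansion_unique[OF that(3,4)])
    finally show ?thesis using a0 by (simp add: a_def c_def g_def N1)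
  qed
  have iv: "b s k = 0" if "s \<in> {1..m - 1}" for s k
  proof -
    have "const_agree (m - 1) g g"
      using formal_coeff_const[OF m, of _ t lam lam] m by (auto simp: const_agree_def g_def)
    then have "const_agree (m - 1) (formal_F m lam g k) (formal_F m lam g k)"
      by (intro const_agree_formal_F) (use m in auto)
    then have "degree (fps_nth (formal_F m lam g k) s) = 0" using that by (auto simp: const_agree_def)
    then have "degree (c s k) = 0" by (simp add: c_def)
    then show ?thesis unfolding b_def a_def by (metis degree_0_id diff_self)
  qed
  have "poly (b s k) 0 = 0" for s k by (simp add: b_def a_def poly_0_coeff_0)
  then show ?thesis
    using sol unique E ii iv c0 by (intro exI[of _ a] exI[of _ b]) (auto simp: a_def)
qed

end
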